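(* Let $k$ be an infinite field which contains a primitive $n$th root of unity for some $n>2$. Then Kaplansky's 10th conjecture is false over $k$; that is, there is a positive integer $d$ such that there exist infinitely many pairwise non-isomorphic Hopf algebras over $k$ of dimension $d$.
   Context: Kaplansky's 10th conjecture (1975) over a field $k$: for every positive integer $d$ there exist only finitely many isomorphism classes of Hopf algebras over $k$ of dimension $d$. *)

theory Defs
  imports Complex_Main "HOL-Library.Function_Algebras"
begin

section \<open>Vector spaces as subspaces of ambient spaces\<close>

text \<open>
  A vector space is a subspace (the carrier) of an ambient vector space in the sense of the library,
  which is a whole type; this allows dimensions that are not fixed by the type.  All operations
  are only meaningful on the carriers.
\<close>

record ('k, 'a) vspace =
  carrier :: "'a set"
  scale :: "'k \<Rightarrow> 'a \<Rightarrow> 'a"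

locale vspace =
  fixes V :: "('k::field, 'a::ab_group_add, 'm) vspace_scheme"
  assumes ambient: "vector_space (scale V)"
    and subspace: "module.subspace (scale V) (carrier V)"

definition vdim :: "('k::field, 'a::ab_group_add, 'm) vspace_scheme \<Rightarrow> nat" where
  "vdim V = vector_space.dim (scale V) (carrier V)"

definition ground :: "('k::field, 'k) vspace" where
  "ground = \<lparr>carrier = UNIV, scale = (*)\<rparr>"

definition linear_on ::
  "('k::field, 'a::ab_group_add, 'm) vspace_scheme \<Rightarrow> ('k, 'b::ab_group_add, 'n) vspace_scheme
    \<Rightarrow> ('a \<Rightarrow> 'b) \<Rightarrow> bool" where
  "linear_on V W f \<longleftrightarrow>
     (\<forall>x\<in>carrier V. f x \<in> carrier W) \<and>
     (\<forall>x\<in>carrier V. \<forall>y\<in>carrier V. f (x + y) = f x + f y) \<and>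
     (\<forall>c. \<forall>x\<in>carrier V. f (scale V c x) = scale W c (f x))"

definition bilinear_on ::
  "('k::field, 'a::ab_group_add, 'm) vspace_scheme \<Rightarrow> ('k, 'b::ab_group_add, 'n) vspace_scheme
    \<Rightarrow> ('k, 'c::ab_group_add, 'l) vspace_scheme \<Rightarrow> ('a \<Rightarrow> 'b \<Rightarrow> 'c) \<Rightarrow> bool" where
  "bilinear_on V W U b \<longleftrightarrow>
     (\<forall>y\<in>carrier W. linear_on V U (\<lambda>x. b x y)) \<and> (\<forall>x\<in>carrier V. linear_on W U (b x))"


section \<open>Tensor products\<close>

text \<open>
  The pure tensor of \<open>x\<close> and \<open>y\<close> is evaluation at \<open>(x, y)\<close> of bilinear forms, and the
  tensor product is the span of the pure tensors in the space of functionals on bilinear forms.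
  Over a field this has the universal property of the tensor product; see
  \<open>bilinear_on_pure\<close>, \<open>tensor_lift_pure\<close>, \<open>linear_on_tensor_lift\<close> and
  \<open>linear_on_tensor_unique\<close> below.  The value \<open>0\<close> on functions that are not bilinear
  on the carriers makes the construction independent of the ambient spaces.
\<close>

type_synonym ('k, 'a, 'b) tensor = "('a \<Rightarrow> 'b \<Rightarrow> 'k) \<Rightarrow> 'k"

definition pure ::
  "('k::field, 'a::ab_group_add, 'm) vspace_scheme \<Rightarrow> ('k, 'b::ab_group_add, 'n) vspace_scheme
    \<Rightarrow> 'a \<Rightarrow> 'b \<Rightarrow> ('k, 'a, 'b) tensor" where
  "pure V W x y = (\<lambda>\<beta>. if bilinear_on V W ground \<beta> then \<beta> x y else 0)"

definition fscale :: "'k::field \<Rightarrow> ('x \<Rightarrow> 'k) \<Rightarrow> 'x \<Rightarrow> 'k" where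
  "fscale c f = (\<lambda>x. c * f x)"

definition tensor_product ::
  "('k::field, 'a::ab_group_add, 'm) vspace_scheme \<Rightarrow> ('k, 'b::ab_group_add, 'n) vspace_scheme
    \<Rightarrow> ('k, ('k, 'a, 'b) tensor) vspace" (infixr "\<otimes>" 75) where
  "V \<otimes> W =
     \<lparr>carrier = module.span fscale {pure V W x y | x y. x \<in> carrier V \<and> y \<in> carrier W},
      scale = fscale\<rparr>"

text \<open>
  The linear map on \<open>V \<otimes> W\<close> induced by a bilinear map \<open>b\<close>: it sends
  \<open>\<Sum>\<^sub>i x\<^sub>i \<otimes> y\<^sub>i\<close> to \<open>\<Sum>\<^sub>i b x\<^sub>i y\<^sub>i\<close>.
\<close>

definition tensor_lift ::
  "('k::field, 'a::ab_group_add, 'm) vspace_scheme \<Rightarrow> ('k, 'b::ab_group_add, 'n) vspace_scheme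
    \<Rightarrow> ('a \<Rightarrow> 'b \<Rightarrow> 'c::ab_group_add) \<Rightarrow> ('k, 'a, 'b) tensor \<Rightarrow> 'c" where
  "tensor_lift V W b t =
     (THE u. \<exists>xs. set xs \<subseteq> carrier V \<times> carrier W \<and>
                  t = (\<Sum>(x, y)\<leftarrow>xs. pure V W x y) \<and> u = (\<Sum>(x, y)\<leftarrow>xs. b x y))"

definition tensor_map ::
  "('k::field, 'a::ab_group_add, 'm) vspace_scheme \<Rightarrow> ('k, 'b::ab_group_add, 'n) vspace_scheme
    \<Rightarrow> ('k, 'c::ab_group_add, 'p) vspace_scheme \<Rightarrow> ('k, 'd::ab_group_add, 'q) vspace_scheme
    \<Rightarrow> ('a \<Rightarrow> 'c) \<Rightarrow> ('b \<Rightarrow> 'd) \<Rightarrow> ('k, 'a, 'b) tensor \<Rightarrow> ('k, 'c, 'd) tensor" where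
  "tensor_map V W V' W' f g = tensor_lift V W (\<lambda>x y. pure V' W' (f x) (g y))"

definition tensor_assoc ::
  "('k::field, 'a::ab_group_add, 'm) vspace_scheme \<Rightarrow> ('k, 'b::ab_group_add, 'n) vspace_scheme
    \<Rightarrow> ('k, 'c::ab_group_add, 'l) vspace_scheme
    \<Rightarrow> ('k, ('k, 'a, 'b) tensor, 'c) tensor \<Rightarrow> ('k, 'a, ('k, 'b, 'c) tensor) tensor" where
  "tensor_assoc V W U =
     tensor_lift (V \<otimes> W) U (\<lambda>t z. tensor_lift V W (\<lambda>x y. pure V (W \<otimes> U) x (pure W U y z)) t)"

lemma fscale_vector_space: "vector_space (fscale :: 'k::field \<Rightarrow> ('x \<Rightarrow> 'k) \<Rightarrow> 'x \<Rightarrow> 'k)"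
  by unfold_locales (auto simp: fscale_def fun_eq_iff algebra_simps)

interpretation fs: vector_space "fscale :: 'k::field \<Rightarrow> ('x \<Rightarrow> 'k) \<Rightarrow> 'x \<Rightarrow> 'k"
  by (rule fscale_vector_space)

lemma vspace_tensor_product: "vspace (V \<otimes> W)"
  by (simp add: vspace_def tensor_product_def fscale_vector_space fs.subspace_span)

lemma vspace_ground: "vspace ground"
proof -
  interpret g: vector_space "(*) :: 'k \<Rightarrow> 'k \<Rightarrow> 'k::field"
    by unfold_locales (auto simp: algebra_simps)
  show ?thesis
    by (simp add: vspace_def ground_def g.vector_space_axioms g.subspace_UNIV)
qed

lemma bilinear_on_pure:
  assumes "vspace V" "vspace W"
  shows "bilinear_on V W (V \<otimes> W) (pure V W)"
  unfolding bilinear_on_def linear_on_def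
proof (intro conjI ballI allI)
  interpret v: vspace V by fact
  interpret w: vspace W by fact
  interpret v: vector_space "scale V" by (rule v.ambient)
  interpret w: vector_space "scale W" by (rule w.ambient)
  fix x y assume xy: "y \<in> carrier W" "x \<in> carrier V"
  show "pure V W x y \<in> carrier (V \<otimes> W)" "pure V W x y \<in> carrier (V \<otimes> W)"
    using xy by (auto simp: tensor_product_def intro!: fs.span_base)
  show "pure V W (x + x') y = pure V W x y + pure V W x' y" if "x' \<in> carrier V" for x'
    using xy that by (auto simp: pure_def fun_eq_iff bilinear_on_def linear_on_def)
  show "pure V W x (y + y') = pure V W x y + pure V W x y'" if "y' \<in> carrier W" for y'
    using xy that by (auto simp: pure_def fun_eq_iff bilinear_on_def linear_on_def)
  show "pure V W (scale V c x) y = scale (V \<otimes> W) c (pure V W x y)" for c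
    using xy by (auto simp: pure_def fun_eq_iff bilinear_on_def linear_on_def tensor_product_def
        fscale_def ground_def)
  show "pure V W x (scale W c y) = scale (V \<otimes> W) c (pure V W x y)" for c
    using xy by (auto simp: pure_def fun_eq_iff bilinear_on_def linear_on_def tensor_product_def
        fscale_def ground_def)
qed

lemma tensor_representation:
  assumes "vspace V" "vspace W" "t \<in> carrier (V \<otimes> W)"
  shows "\<exists>xs. set xs \<subseteq> carrier V \<times> carrier W \<and> t = (\<Sum>(x, y)\<leftarrow>xs. pure V W x y)"
proof -
  interpret v: vspace V by fact
  interpret v: vector_space "scale V" by (rule v.ambient)
  note bil = bilinear_on_pure[OF assms(1,2), unfolded bilinear_on_def linear_on_def]
  have "t \<in> fs.span {pure V W x y | x y. x \<in> carrier V \<and> y \<in> carrier W}"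
    using assms(3) by (simp add: tensor_product_def)
  then show ?thesis
  proof (induction t rule: fs.span_induct_alt)
    case base
    show ?case by (rule exI[of _ "[]"]) (auto simp: zero_fun_def)
  next
    case (step c u t)
    then obtain x y xs where *: "u = pure V W x y" "x \<in> carrier V" "y \<in> carrier W"
      "set xs \<subseteq> carrier V \<times> carrier W" "t = (\<Sum>(x, y)\<leftarrow>xs. pure V W x y)"
      by blast
    have "scale V c x \<in> carrier V"
      using v.subspace * by (auto simp: v.subspace_def)
    moreover have "fscale c u = pure V W (scale V c x) y"
      using bil * by (simp add: tensor_product_def)
    ultimately show ?case
      using * by (intro exI[of _ "(scale V c x, y) # xs"]) auto
  qed
qed

lemma linear_form_sum_list:
  assumes "linear_on U ground \<phi>" "vspace U" "\<And>p. p \<in> set xs \<Longrightarrow> g p \<in> carrier U"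
  shows "\<phi> (\<Sum>p\<leftarrow>xs. g p) = (\<Sum>p\<leftarrow>xs. \<phi> (g p)) \<and> (\<Sum>p\<leftarrow>xs. g p) \<in> carrier U"
proof -
  interpret u: vspace U by fact
  interpret u: vector_space "scale U" by (rule u.ambient)
  have 0: "0 \<in> carrier U" and add: "\<And>x y. x \<in> carrier U \<Longrightarrow> y \<in> carrier U \<Longrightarrow> x + y \<in> carrier U"
    using u.subspace by (auto simp: u.subspace_def)
  have "\<phi> (0 + 0) = \<phi> 0 + \<phi> 0"
    using assms(1) 0 unfolding linear_on_def by blast
  then have "\<phi> 0 = 0" by (metis add_cancel_right_right add_0)
  then show ?thesis
    using assms(3)
  proof (induction xs)
    case Nil
    then show ?case using 0 by simp
  next
    case (Cons p xs)
    then show ?case using assms(1) add by (simp add: linear_on_def)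
  qed
qed

lemma linear_forms_separate:
  assumes "vspace U" "u \<in> carrier U" "u' \<in> carrier U"
    and "\<And>\<phi>. linear_on U ground \<phi> \<Longrightarrow> \<phi> u = \<phi> u'"
  shows "u = u'"
proof (rule ccontr)
  assume "u \<noteq> u'"
  interpret u: vspace U by fact
  interpret u: vector_space "scale U" by (rule u.ambient)
  interpret g: vector_space "(*) :: 'a \<Rightarrow> 'a \<Rightarrow> 'a"
    by unfold_locales (auto simp: algebra_simps)
  interpret p: vector_space_pair "scale U" "(*) :: 'a \<Rightarrow> 'a \<Rightarrow> 'a" ..
  have "u.independent {u - u'}"
    using \<open>u \<noteq> u'\<close> by (simp add: u.dependent_single)
  from p.linear_independent_extend[OF this, of "\<lambda>_. 1"]
  obtain \<phi> where \<phi>: "Vector_Spaces.linear (scale U) (*) \<phi>" "\<phi> (u - u') = 1" by auto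
  have "linear_on U ground \<phi>"
    using p.linear_add[OF \<phi>(1)] p.linear_scale[OF \<phi>(1)] by (simp add: linear_on_def ground_def)
  then have "\<phi> u = \<phi> u'" by (rule assms(4))
  moreover have "\<phi> (u - u') = \<phi> u - \<phi> u'"
    by (rule p.linear_diff[OF \<phi>(1)])
  ultimately show False using \<phi>(2) by simp
qed

lemma tensor_lift_sum_list:
  assumes "vspace U" "bilinear_on V W U b"
    and "set xs \<subseteq> carrier V \<times> carrier W"
  shows "tensor_lift V W b (\<Sum>(x, y)\<leftarrow>xs. pure V W x y) = (\<Sum>(x, y)\<leftarrow>xs. b x y)"
  unfolding tensor_lift_def
proof (rule the_equality)
  show "\<exists>ys. set ys \<subseteq> carrier V \<times> carrier W \<and>
      (\<Sum>(x, y)\<leftarrow>xs. pure V W x y) = (\<Sum>(x, y)\<leftarrow>ys. pure V W x y) \<and>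
      (\<Sum>(x, y)\<leftarrow>xs. b x y) = (\<Sum>(x, y)\<leftarrow>ys. b x y)"
    using assms by blast
next
  fix u
  assume "\<exists>ys. set ys \<subseteq> carrier V \<times> carrier W \<and>
      (\<Sum>(x, y)\<leftarrow>xs. pure V W x y) = (\<Sum>(x, y)\<leftarrow>ys. pure V W x y) \<and> u = (\<Sum>(x, y)\<leftarrow>ys. b x y)"
  then obtain ys where ys: "set ys \<subseteq> carrier V \<times> carrier W"
    "(\<Sum>(x, y)\<leftarrow>xs. pure V W x y) = (\<Sum>(x, y)\<leftarrow>ys. pure V W x y)" "u = (\<Sum>(x, y)\<leftarrow>ys. b x y)"
    by blast
  have b_in: "b x y \<in> carrier U" if "x \<in> carrier V" "y \<in> carrier W" for x y
    using assms(2) that by (auto simp: bilinear_on_def linear_on_def)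
  have eval: "(\<Sum>(x, y)\<leftarrow>zs. pure V W x y) \<beta> = (\<Sum>(x, y)\<leftarrow>zs. \<beta> x y)"
    if "bilinear_on V W ground \<beta>" for zs \<beta>
    using that by (induction zs) (auto simp: pure_def)
  have lin: "\<phi> (\<Sum>(x, y)\<leftarrow>zs. b x y) = (\<Sum>(x, y)\<leftarrow>zs. \<phi> (b x y)) \<and> (\<Sum>(x, y)\<leftarrow>zs. b x y) \<in> carrier U"
    if "linear_on U ground \<phi>" "set zs \<subseteq> carrier V \<times> carrier W" for zs \<phi>
  proof -
    have "(\<lambda>(x, y). b x y) p \<in> carrier U" if "p \<in> set zs" for p
      using b_in that \<open>set zs \<subseteq> _\<close> by auto
    from linear_form_sum_list[OF \<open>linear_on U ground \<phi>\<close> assms(1) this]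
    show ?thesis by (simp add: case_prod_unfold)
  qed
  have zero: "linear_on U ground (\<lambda>_. 0)"
    by (auto simp: linear_on_def ground_def)
  show "u = (\<Sum>(x, y)\<leftarrow>xs. b x y)"
  proof (rule linear_forms_separate[OF assms(1)])
    show "u \<in> carrier U" "(\<Sum>(x, y)\<leftarrow>xs. b x y) \<in> carrier U"
      using lin[OF zero] ys assms(3) by auto
    fix \<phi> assume \<phi>: "linear_on U ground \<phi>"
    have "bilinear_on V W ground (\<lambda>x y. \<phi> (b x y))"
      using \<phi> assms(2) by (auto simp: bilinear_on_def linear_on_def)
    from eval[OF this] ys(2)
    have "(\<Sum>(x, y)\<leftarrow>xs. \<phi> (b x y)) = (\<Sum>(x, y)\<leftarrow>ys. \<phi> (b x y))" by metis
    then show "\<phi> u = \<phi> (\<Sum>(x, y)\<leftarrow>xs. b x y)"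
      using lin[OF \<phi> assms(3)] lin[OF \<phi> ys(1)] ys(3) by simp
  qed
qed

lemma tensor_lift_pure:
  assumes "vspace U" "bilinear_on V W U b" "x \<in> carrier V" "y \<in> carrier W"
  shows "tensor_lift V W b (pure V W x y) = b x y"
  using tensor_lift_sum_list[OF assms(1,2), of "[(x, y)]"] assms(3,4) by simp

lemma linear_on_tensor_lift:
  assumes "vspace V" "vspace W" "vspace U" "bilinear_on V W U b"
  shows "linear_on (V \<otimes> W) U (tensor_lift V W b)"
proof -
  interpret v: vspace V by fact
  interpret v: vector_space "scale V" by (rule v.ambient)
  interpret u: vspace U by fact
  interpret u: vector_space "scale U" by (rule u.ambient)
  note pur = bilinear_on_pure[OF assms(1,2), unfolded bilinear_on_def linear_on_def]
  note bil = assms(4)[unfolded bilinear_on_def linear_on_def]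
  note rep = tensor_representation[OF assms(1,2)]
  note lift = tensor_lift_sum_list[OF assms(3,4)]
  have zero: "linear_on U ground (\<lambda>_. 0)"
    by (auto simp: linear_on_def ground_def)
  show ?thesis
    unfolding linear_on_def
  proof (intro conjI ballI allI)
    fix s assume "s \<in> carrier (V \<otimes> W)"
    then obtain xs where xs: "set xs \<subseteq> carrier V \<times> carrier W" "s = (\<Sum>(x, y)\<leftarrow>xs. pure V W x y)"
      using rep by blast
    have "\<And>p. p \<in> set xs \<Longrightarrow> (\<lambda>(x, y). b x y) p \<in> carrier U"
      using xs(1) bil by auto
    from linear_form_sum_list[OF zero assms(3), of xs, OF this]
    show "tensor_lift V W b s \<in> carrier U"
      using lift[OF xs(1)] xs(2) by simp
    show "tensor_lift V W b (s + t) = tensor_lift V W b s + tensor_lift V W b t"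
      if t: "t \<in> carrier (V \<otimes> W)" for t
    proof -
      obtain ys where ys: "set ys \<subseteq> carrier V \<times> carrier W" "t = (\<Sum>(x, y)\<leftarrow>ys. pure V W x y)"
        using rep[OF t] by blast
      have "set (xs @ ys) \<subseteq> carrier V \<times> carrier W"
        using xs ys by simp
      from lift[OF this] show ?thesis
        using lift[OF xs(1)] lift[OF ys(1)] xs(2) ys(2) by simp
    qed
    show "tensor_lift V W b (scale (V \<otimes> W) c s) = scale U c (tensor_lift V W b s)" for c
    proof -
      let ?ys = "map (\<lambda>(x, y). (scale V c x, y)) xs"
      have sub: "set ?ys \<subseteq> carrier V \<times> carrier W"
        using xs(1) v.subspace by (auto simp: v.subspace_def)
      have 1: "scale (V \<otimes> W) c (\<Sum>(x, y)\<leftarrow>xs. pure V W x y) = (\<Sum>(x, y)\<leftarrow>?ys. pure V W x y)"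
        using xs(1)
      proof (induction xs)
        case Nil
        then show ?case by (simp add: tensor_product_def fscale_def fun_eq_iff)
      next
        case (Cons p xs)
        then show ?case using pur
          by (auto simp: tensor_product_def fs.scale_right_distrib simp del: plus_fun_apply)
      qed
      have 2: "scale U c (\<Sum>(x, y)\<leftarrow>xs. b x y) = (\<Sum>(x, y)\<leftarrow>?ys. b x y)"
        using xs(1)
      proof (induction xs)
        case Nil
        then show ?case by (simp add: u.scale_zero_right)
      next
        case (Cons p xs)
        then show ?case using bil
          by (auto simp: u.scale_right_distrib)
      qed
      show ?thesis
        using lift[OF sub] lift[OF xs(1)] 1 2 xs(2) by simp
    qed
  qed
qed

lemma linear_on_tensor_unique:
  assumes "vspace V" "vspace W" "vspace U"
    and "linear_on (V \<otimes> W) U f" "linear_on (V \<otimes> W) U g"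
    and "\<And>x y. x \<in> carrier V \<Longrightarrow> y \<in> carrier W \<Longrightarrow> f (pure V W x y) = g (pure V W x y)"
    and "t \<in> carrier (V \<otimes> W)"
  shows "f t = g t"
proof -
  interpret u: vspace U by fact
  interpret u: vector_space "scale U" by (rule u.ambient)
  interpret t: vspace "V \<otimes> W" by (rule vspace_tensor_product)
  note pur = bilinear_on_pure[OF assms(1,2), unfolded bilinear_on_def linear_on_def]
  have t0: "0 \<in> carrier (V \<otimes> W)"
    by (simp add: tensor_product_def fs.span_zero)
  obtain xs where xs: "set xs \<subseteq> carrier V \<times> carrier W" "t = (\<Sum>(x, y)\<leftarrow>xs. pure V W x y)"
    using tensor_representation[OF assms(1,2,7)] by blast
  have "f (0 + 0) = f 0 + f 0" "g (0 + 0) = g 0 + g 0"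
    using assms(4,5) t0 unfolding linear_on_def by blast+
  then have z: "f 0 = 0" "g 0 = 0" by simp_all
  have "(\<Sum>(x, y)\<leftarrow>xs. pure V W x y) \<in> carrier (V \<otimes> W) \<and>
      f (\<Sum>(x, y)\<leftarrow>xs. pure V W x y) = g (\<Sum>(x, y)\<leftarrow>xs. pure V W x y)"
    using xs(1)
  proof (induction xs)
    case Nil
    then show ?case using z t0 by (simp del: zero_fun_apply)
  next
    case (Cons p xs)
    then obtain x y where p: "p = (x, y)" "x \<in> carrier V" "y \<in> carrier W" by auto
    have pc: "pure V W x y \<in> carrier (V \<otimes> W)" using pur p by auto
    have IH: "(\<Sum>(x, y)\<leftarrow>xs. pure V W x y) \<in> carrier (V \<otimes> W)"
      "f (\<Sum>(x, y)\<leftarrow>xs. pure V W x y) = g (\<Sum>(x, y)\<leftarrow>xs. pure V W x y)"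
      using Cons by auto
    have "pure V W x y + (\<Sum>(x, y)\<leftarrow>xs. pure V W x y) \<in> carrier (V \<otimes> W)"
      using pc IH(1) by (simp add: tensor_product_def fs.span_add)
    moreover have "f (pure V W x y + (\<Sum>(x, y)\<leftarrow>xs. pure V W x y))
        = f (pure V W x y) + f (\<Sum>(x, y)\<leftarrow>xs. pure V W x y)"
      using assms(4) pc IH(1) unfolding linear_on_def by blast
    moreover have "g (pure V W x y + (\<Sum>(x, y)\<leftarrow>xs. pure V W x y))
        = g (pure V W x y) + g (\<Sum>(x, y)\<leftarrow>xs. pure V W x y)"
      using assms(5) pc IH(1) unfolding linear_on_def by blast
    ultimately show ?case
      using assms(6) p IH(2) by (simp del: plus_fun_apply)
  qed
  then show ?thesis using xs(2) by simp
qed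


section \<open>Hopf algebras\<close>

record ('k, 'a) hopf = "('k, 'a) vspace" +
  mult :: "'a \<Rightarrow> 'a \<Rightarrow> 'a"  (infixl "\<cdot>\<index>" 70)
  unit :: "'a"  ("\<one>\<index>")
  comult :: "'a \<Rightarrow> ('k, 'a, 'a) tensor"
  counit :: "'a \<Rightarrow> 'k"
  antipode :: "'a \<Rightarrow> 'a"

definition tensor_mult ::
  "('k::field, 'a::ab_group_add, 'm) hopf_scheme
    \<Rightarrow> ('k, 'a, 'a) tensor \<Rightarrow> ('k, 'a, 'a) tensor \<Rightarrow> ('k, 'a, 'a) tensor" where
  "tensor_mult H s t =
     tensor_lift H H (\<lambda>a b. tensor_lift H H (\<lambda>c d. pure H H (a \<cdot>\<^bsub>H\<^esub> c) (b \<cdot>\<^bsub>H\<^esub> d)) t) s"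

locale unital_algebra = vspace H for H :: "('k::field, 'a::ab_group_add, 'm) hopf_scheme" (structure) +
  assumes mult_bilinear: "bilinear_on H H H (\<cdot>)"
    and mult_assoc: "\<lbrakk>x \<in> carrier H; y \<in> carrier H; z \<in> carrier H\<rbrakk> \<Longrightarrow> (x \<cdot> y) \<cdot> z = x \<cdot> (y \<cdot> z)"
    and unit_closed: "\<one> \<in> carrier H"
    and unit_left: "x \<in> carrier H \<Longrightarrow> \<one> \<cdot> x = x"
    and unit_right: "x \<in> carrier H \<Longrightarrow> x \<cdot> \<one> = x"

text \<open>In the counit axioms \<open>k \<otimes> H\<close> and \<open>H \<otimes> k\<close> are identified with \<open>H\<close>.\<close>

locale counital_coalgebra = vspace H for H :: "('k::field, 'a::ab_group_add, 'm) hopf_scheme" (structure) +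
  assumes comult_linear: "linear_on H (H \<otimes> H) (comult H)"
    and counit_linear: "linear_on H ground (counit H)"
    and coassoc: "x \<in> carrier H \<Longrightarrow>
          tensor_assoc H H H (tensor_map H H (H \<otimes> H) H (comult H) id (comult H x))
          = tensor_map H H H (H \<otimes> H) id (comult H) (comult H x)"
    and counit_left: "x \<in> carrier H \<Longrightarrow>
          tensor_lift H H (\<lambda>a b. scale H (counit H a) b) (comult H x) = x"
    and counit_right: "x \<in> carrier H \<Longrightarrow>
          tensor_lift H H (\<lambda>a b. scale H (counit H b) a) (comult H x) = x"

locale bialgebra = unital_algebra H + counital_coalgebra H
  for H :: "('k::field, 'a::ab_group_add, 'm) hopf_scheme" (structure) +
  assumes comult_mult: "\<lbrakk>x \<in> carrier H; y \<in> carrier H\<rbrakk> \<Longrightarrow>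
          comult H (x \<cdot> y) = tensor_mult H (comult H x) (comult H y)"
    and comult_unit: "comult H \<one> = pure H H \<one> \<one>"
    and counit_mult: "\<lbrakk>x \<in> carrier H; y \<in> carrier H\<rbrakk> \<Longrightarrow>
          counit H (x \<cdot> y) = counit H x * counit H y"
    and counit_unit: "counit H \<one> = 1"

locale hopf_algebra = bialgebra H
  for H :: "('k::field, 'a::ab_group_add, 'm) hopf_scheme" (structure) +
  assumes antipode_linear: "linear_on H H (antipode H)"
    and antipode_left: "x \<in> carrier H \<Longrightarrow>
          tensor_lift H H (\<lambda>a b. antipode H a \<cdot> b) (comult H x) = scale H (counit H x) \<one>"
    and antipode_right: "x \<in> carrier H \<Longrightarrow>
          tensor_lift H H (\<lambda>a b. a \<cdot> antipode H b) (comult H x) = scale H (counit H x) \<one>"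

text \<open>
  A bialgebra isomorphism between Hopf algebras automatically commutes with the antipodes.
\<close>

definition hopf_iso ::
  "('k::field, 'a::ab_group_add, 'm) hopf_scheme \<Rightarrow> ('k, 'b::ab_group_add, 'n) hopf_scheme
    \<Rightarrow> ('a \<Rightarrow> 'b) \<Rightarrow> bool" where
  "hopf_iso H H' f \<longleftrightarrow>
     bij_betw f (carrier H) (carrier H') \<and> linear_on H H' f \<and>
     (\<forall>x\<in>carrier H. \<forall>y\<in>carrier H. f (x \<cdot>\<^bsub>H\<^esub> y) = f x \<cdot>\<^bsub>H'\<^esub> f y) \<and>
     f \<one>\<^bsub>H\<^esub> = \<one>\<^bsub>H'\<^esub> \<and>
     (\<forall>x\<in>carrier H. comult H' (f x) = tensor_map H H H' H' f f (comult H x)) \<and>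
     (\<forall>x\<in>carrier H. counit H' (f x) = counit H x)"

definition hopf_isomorphic ::
  "('k::field, 'a::ab_group_add, 'm) hopf_scheme \<Rightarrow> ('k, 'b::ab_group_add, 'n) hopf_scheme \<Rightarrow> bool" where
  "hopf_isomorphic H H' \<longleftrightarrow> (\<exists>f. hopf_iso H H' f)"

text \<open>
  The Hopf algebras of dimension \<open>d\<close> over the field \<open>'k\<close>, with underlying space inside
  \<open>nat \<Rightarrow> 'k\<close>.  For \<open>d > 0\<close> every Hopf algebra of dimension \<open>d\<close> is isomorphic to one
  of these, because its underlying space is isomorphic to \<open>{f. \<forall>i\<ge>d. f i = 0}\<close>.  For \<open>d > 0\<close>
  the condition \<open>vdim H = d\<close> entails finite dimension; \<open>vdim\<close> is \<open>0\<close> for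
  infinite-dimensional spaces.
\<close>

definition hopf_algebras :: "nat \<Rightarrow> ('k::field, nat \<Rightarrow> 'k) hopf set" where
  "hopf_algebras d = {H. hopf_algebra H \<and> vdim H = d}"

definition kaplansky_tenth_conjecture :: "'k::field itself \<Rightarrow> bool" where
  "kaplansky_tenth_conjecture _ \<longleftrightarrow>
     (\<forall>d>0. finite ((hopf_algebras d :: ('k, nat \<Rightarrow> 'k) hopf set) //
                     {(H, H'). H \<in> hopf_algebras d \<and> H' \<in> hopf_algebras d \<and> hopf_isomorphic H H'}))"

definition primitive_root_of_unity :: "nat \<Rightarrow> 'k::field \<Rightarrow> bool" where
  "primitive_root_of_unity n \<zeta> \<longleftrightarrow> n > 0 \<and> \<zeta> ^ n = 1 \<and> (\<forall>m. 0 < m \<and> m < n \<longrightarrow> \<zeta> ^ m \<noteq> 1)"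

end

theory Submission
  imports "HOL-Library.Nat_Bijection" "HOL-Computational_Algebra.Polynomial" Defs
begin

text \<open>
  Let \<open>q\<close> be a primitive \<open>n\<close>-th root of unity.  For a scalar \<open>c\<close> consider the algebra generated by
  \<open>K, E, F\<close> with
  \<open>K\<^sup>2\<^sup>n = 1\<close>, \<open>K E = q E K\<close>, \<open>K F = q\<^sup>-\<^sup>1 F K\<close>, \<open>E F - F E = c (K - K\<^sup>-\<^sup>1)\<close>,
  \<open>E\<^sup>n = K\<^sup>n - 1\<close>, \<open>F\<^sup>n = 1 - K\<^sup>n\<close>.
  It has the basis \<open>F\<^sup>l K\<^sup>i E\<^sup>k\<close> with \<open>l, k < n\<close> and \<open>i < 2 n\<close>, and it is a Hopf algebra with
  \<open>\<Delta> K = K \<otimes> K\<close>, \<open>\<Delta> E = E \<otimes> 1 + K \<otimes> E\<close>, \<open>\<Delta> F = F \<otimes> K\<^sup>-\<^sup>1 + 1 \<otimes> F\<close>,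
  because the middle Gaussian binomials of order \<open>n\<close> vanish at \<open>q\<close>.
  The group-like elements lie in the span of the powers of \<open>K\<close>, and every skew-primitive element is
  a combination of \<open>E\<close>, \<open>F K\<close> and powers of \<open>K\<close>.  As \<open>n > 2\<close>, the scalars \<open>q\<close> and \<open>q\<^sup>-\<^sup>1\<close> differ, so
  commutation with \<open>K\<close> separates \<open>E\<close> from \<open>F K\<close>, and an isomorphism from the algebra for \<open>c'\<close> to
  the one for \<open>c\<close> must send \<open>K, E, F\<close> to \<open>K, a E, b F\<close>.  The power relations force
  \<open>a\<^sup>n = b\<^sup>n = 1\<close> and the commutator relation \<open>c' = a b c\<close>.  Hence \<open>c\<^sup>n\<close> is an invariant, and it takes
  infinitely many values over an infinite field.
\<close>

section \<open>Linear maps and tensor products\<close>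

text \<open>The commutator relation alone cannot tell parameters apart: rescaling \<open>E\<close>
  turns any nonzero \<open>c\<close> into any other. The relations for \<open>E^n\<close> and
  \<open>F^n\<close> take that freedom away, but only if their right sides are nonzero. Hence
  \<open>K\<close> has order \<open>2 * n\<close>: then \<open>K^n\<close> differs from 1, yet it is
  central and its own inverse. The right sides are dictated by the coproduct: once the middle
  binomials vanish, it treats \<open>E^n\<close> exactly as \<open>K^n - 1\<close>, and
  \<open>F^n\<close>, whose coproduct carries \<open>K^-n = K^n\<close>, exactly as
  \<open>1 - K^n\<close>.

  A presentation by generators and relations does not reveal a dimension. So the algebra is built on
  a space with a prescribed basis, left multiplication by the generators is written down there, and
  the relations are verified for these operators. Identities between the structure maps are then
  mostly inductions: they hold at 1 and survive left multiplication by \<open>K\<close>,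
  \<open>E\<close> and \<open>F\<close>.

  Group-like and skew-primitive elements are determined in coordinates, by applying explicit
  functionals to one leg of the coproduct. Since every Gaussian binomial below order
  \<open>n\<close> is nonzero, these functionals lose no information that matters.\<close>

sublocale vspace \<subseteq> vs: vector_space "scale V"
  by (rule ambient)

context vspace
begin

lemma zero_closed [simp]: "0 \<in> carrier V"
  using subspace by (auto simp: vs.subspace_def)

lemma add_closed [simp]: "x \<in> carrier V \<Longrightarrow> y \<in> carrier V \<Longrightarrow> x + y \<in> carrier V"
  using subspace by (auto simp: vs.subspace_def)

lemma scale_closed [simp]: "x \<in> carrier V \<Longrightarrow> scale V a x \<in> carrier V"
  using subspace by (auto simp: vs.subspace_def)

lemma uminus_closed [simp]: "x \<in> carrier V \<Longrightarrow> - x \<in> carrier V"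
  using subspace by (rule vs.subspace_neg)

lemma diff_closed [simp]: "x \<in> carrier V \<Longrightarrow> y \<in> carrier V \<Longrightarrow> x - y \<in> carrier V"
  using subspace by (rule vs.subspace_diff)

lemma sum_closed: "(\<And>i. i \<in> A \<Longrightarrow> g i \<in> carrier V) \<Longrightarrow> sum g A \<in> carrier V"
  using subspace by (rule vs.subspace_sum)

end

lemma linear_onI:
  assumes "\<And>x. x \<in> carrier V \<Longrightarrow> f x \<in> carrier W"
    and "\<And>x y. x \<in> carrier V \<Longrightarrow> y \<in> carrier V \<Longrightarrow> f (x + y) = f x + f y"
    and "\<And>a x. x \<in> carrier V \<Longrightarrow> f (scale V a x) = scale W a (f x)"
  shows "linear_on V W f"
  using assms by (auto simp: linear_on_def)

lemma
  assumes "linear_on V W f"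
  shows linear_on_closed: "x \<in> carrier V \<Longrightarrow> f x \<in> carrier W"
    and linear_on_plus: "x \<in> carrier V \<Longrightarrow> y \<in> carrier V \<Longrightarrow> f (x + y) = f x + f y"
    and linear_on_smult: "x \<in> carrier V \<Longrightarrow> f (scale V a x) = scale W a (f x)"
  using assms by (auto simp: linear_on_def)

lemma linear_on_0:
  assumes "vspace V" "linear_on V W f"
  shows "f 0 = 0"
proof -
  interpret vspace V by fact
  have "f (0 + 0) = f 0 + f 0"
    by (rule linear_on_plus[OF assms(2)]) auto
  then show ?thesis by simp
qed

lemma linear_on_uminus:
  assumes "vspace V" "linear_on V W f" "x \<in> carrier V"
  shows "f (- x) = - f x"
proof -
  interpret vspace V by fact
  have "f (x + - x) = f x + f (- x)"
    by (rule linear_on_plus[OF assms(2)]) (auto simp: assms)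
  then show ?thesis
    using linear_on_0[OF assms(1,2)] by (simp add: minus_unique)
qed

lemma linear_on_minus:
  assumes "vspace V" "linear_on V W f" "x \<in> carrier V" "y \<in> carrier V"
  shows "f (x - y) = f x - f y"
proof -
  interpret vspace V by fact
  have "f (x + - y) = f x + f (- y)"
    by (rule linear_on_plus[OF assms(2)]) (auto simp: assms)
  then show ?thesis
    using linear_on_uminus[OF assms(1,2,4)] by simp
qed

lemma linear_on_sum:
  assumes "vspace V" "linear_on V W f" "\<And>i. i \<in> A \<Longrightarrow> g i \<in> carrier V"
  shows "f (sum g A) = (\<Sum>i\<in>A. f (g i))"
  using assms(3)
proof (induction A rule: infinite_finite_induct)
  case (insert i A)
  interpret vspace V by fact
  have "f (g i + sum g A) = f (g i) + f (sum g A)"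
    by (rule linear_on_plus[OF assms(2)]) (auto intro: sum_closed insert.prems)
  with insert show ?case by simp
qed (auto simp: linear_on_0[OF assms(1,2)])

lemma linear_on_id: "linear_on V V (\<lambda>x. x)"
  by (auto simp: linear_on_def)

lemma linear_on_comp:
  "linear_on V W f \<Longrightarrow> linear_on W U g \<Longrightarrow> linear_on V U (\<lambda>x. g (f x))"
  by (auto simp: linear_on_def)

lemma linear_on_funpow:
  "linear_on V V f \<Longrightarrow> linear_on V V (f ^^ m)"
  by (induction m) (auto simp: linear_on_def)

lemma linear_on_zero: "vspace W \<Longrightarrow> linear_on V W (\<lambda>_. 0)"
proof -
  assume "vspace W"
  then interpret vspace W .
  show ?thesis by (auto simp: linear_on_def)
qed

lemma linear_on_add:
  assumes "vspace W" "linear_on V W f" "linear_on V W g"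
  shows "linear_on V W (\<lambda>x. f x + g x)"
proof -
  interpret vspace W by fact
  show ?thesis
    using assms by (auto simp: linear_on_def vs.scale_right_distrib algebra_simps)
qed

lemma linear_on_diff:
  assumes "vspace W" "linear_on V W f" "linear_on V W g"
  shows "linear_on V W (\<lambda>x. f x - g x)"
proof -
  interpret vspace W by fact
  show ?thesis
    using assms by (auto simp: linear_on_def vs.scale_right_diff_distrib algebra_simps)
qed

lemma linear_on_scale:
  assumes "vspace W" "linear_on V W f"
  shows "linear_on V W (\<lambda>x. scale W a (f x))"
proof -
  interpret vspace W by fact
  show ?thesis
    using assms by (auto simp: linear_on_def vs.scale_right_distrib vs.scale_left_commute)
qed

lemma linear_on_sum_fun:
  assumes "vspace W" "\<And>i. i \<in> A \<Longrightarrow> linear_on V W (f i)"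
  shows "linear_on V W (\<lambda>x. \<Sum>i\<in>A. f i x)"
  using assms(2)
proof (induction A rule: infinite_finite_induct)
  case (insert i A)
  then show ?case
    using linear_on_add[OF assms(1), of V "f i" "\<lambda>x. \<Sum>i\<in>A. f i x"] by simp
qed (simp_all add: linear_on_zero assms(1))

lemma linear_on_form_scale:
  assumes "vspace W" "linear_on V ground f" "y \<in> carrier W"
  shows "linear_on V W (\<lambda>x. scale W (f x) y)"
proof -
  interpret vspace W by fact
  show ?thesis
    using assms by (auto simp: linear_on_def ground_def vs.scale_left_distrib)
qed

section \<open>Bilinear maps and functoriality of the tensor product\<close>

lemma bilinear_onI:
  assumes "\<And>y. y \<in> carrier W \<Longrightarrow> linear_on V U (\<lambda>x. b x y)"
    and "\<And>x. x \<in> carrier V \<Longrightarrow> linear_on W U (b x)"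
  shows "bilinear_on V W U b"
  using assms by (auto simp: bilinear_on_def)

lemma
  assumes "bilinear_on V W U b"
  shows bilinear_on_left: "y \<in> carrier W \<Longrightarrow> linear_on V U (\<lambda>x. b x y)"
    and bilinear_on_right: "x \<in> carrier V \<Longrightarrow> linear_on W U (b x)"
  using assms by (auto simp: bilinear_on_def linear_on_def)

lemma bilinear_on_comp:
  assumes "bilinear_on V' W' U b" "linear_on V V' f" "linear_on W W' g"
  shows "bilinear_on V W U (\<lambda>x y. b (f x) (g y))"
proof (rule bilinear_onI)
  show "linear_on V U (\<lambda>x. b (f x) (g y))" if "y \<in> carrier W" for y
    using linear_on_comp[OF assms(2) bilinear_on_left[OF assms(1) linear_on_closed[OF assms(3) that]]] .
  show "linear_on W U (\<lambda>y. b (f x) (g y))" if "x \<in> carrier V" for x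
    using linear_on_comp[OF assms(3) bilinear_on_right[OF assms(1) linear_on_closed[OF assms(2) that]]] .
qed

lemma bilinear_on_compose_linear:
  assumes "bilinear_on V W U b" "linear_on U U' f"
  shows "bilinear_on V W U' (\<lambda>x y. f (b x y))"
  using assms by (auto simp: bilinear_on_def intro: linear_on_comp)

lemma bilinear_on_add:
  assumes "vspace U" "bilinear_on V W U b" "bilinear_on V W U b'"
  shows "bilinear_on V W U (\<lambda>x y. b x y + b' x y)"
  using assms by (auto simp: bilinear_on_def intro!: linear_on_add)

lemma bilinear_on_form_scale:
  assumes "vspace W" "linear_on V ground f"
  shows "bilinear_on V W W (\<lambda>x y. scale W (f x) y)"
  by (intro bilinear_onI linear_on_form_scale linear_on_scale linear_on_id assms)

lemma bilinear_on_scale_form: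
  assumes "vspace V" "linear_on W ground f"
  shows "bilinear_on V W V (\<lambda>x y. scale V (f y) x)"
  by (intro bilinear_onI linear_on_form_scale linear_on_scale linear_on_id assms)

lemma pure_closed:
  "x \<in> carrier V \<Longrightarrow> y \<in> carrier W \<Longrightarrow> pure V W x y \<in> carrier (V \<otimes> W)"
  by (auto simp: tensor_product_def intro!: fs.span_base)

lemma scale_tensor [simp]: "scale (V \<otimes> W) = fscale"
  by (simp add: tensor_product_def)

lemma linear_on_pure_left:
  "vspace V \<Longrightarrow> vspace W \<Longrightarrow> y \<in> carrier W \<Longrightarrow> linear_on V (V \<otimes> W) (\<lambda>x. pure V W x y)"
  using bilinear_on_left[OF bilinear_on_pure] .

lemma linear_on_pure_right:
  "vspace V \<Longrightarrow> vspace W \<Longrightarrow> x \<in> carrier V \<Longrightarrow> linear_on W (V \<otimes> W) (pure V W x)"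
  using bilinear_on_right[OF bilinear_on_pure] .

lemma bilinear_on_tensor_map:
  assumes "vspace V'" "vspace W'" "linear_on V V' f" "linear_on W W' g"
  shows "bilinear_on V W (V' \<otimes> W') (\<lambda>x y. pure V' W' (f x) (g y))"
  by (rule bilinear_on_comp[OF bilinear_on_pure]) (fact assms)+

lemma linear_on_tensor_map:
  assumes "vspace V" "vspace W" "vspace V'" "vspace W'" "linear_on V V' f" "linear_on W W' g"
  shows "linear_on (V \<otimes> W) (V' \<otimes> W') (tensor_map V W V' W' f g)"
  unfolding tensor_map_def
  by (intro linear_on_tensor_lift bilinear_on_tensor_map vspace_tensor_product assms)

lemma tensor_map_pure:
  assumes "vspace V'" "vspace W'" "linear_on V V' f" "linear_on W W' g"
    "x \<in> carrier V" "y \<in> carrier W"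
  shows "tensor_map V W V' W' f g (pure V W x y) = pure V' W' (f x) (g y)"
  unfolding tensor_map_def
  by (rule tensor_lift_pure[OF vspace_tensor_product bilinear_on_tensor_map]) (fact assms)+

lemma tensor_map_comp:
  assumes "vspace V" "vspace W" "vspace V'" "vspace W'" "vspace V''" "vspace W''"
    and "linear_on V V' f" "linear_on W W' g" "linear_on V' V'' f'" "linear_on W' W'' g'"
    and "t \<in> carrier (V \<otimes> W)"
  shows "tensor_map V' W' V'' W'' f' g' (tensor_map V W V' W' f g t)
    = tensor_map V W V'' W'' (\<lambda>x. f' (f x)) (\<lambda>y. g' (g y)) t"
proof (rule linear_on_tensor_unique[OF assms(1,2) vspace_tensor_product _ _ _ assms(11)])
  show "linear_on (V \<otimes> W) (V'' \<otimes> W'') (\<lambda>t. tensor_map V' W' V'' W'' f' g' (tensor_map V W V' W' f g t))"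
    by (rule linear_on_comp[OF linear_on_tensor_map linear_on_tensor_map]) (fact assms)+
  show "linear_on (V \<otimes> W) (V'' \<otimes> W'')
      (tensor_map V W V'' W'' (\<lambda>x. f' (f x)) (\<lambda>y. g' (g y)))"
    by (rule linear_on_tensor_map[OF assms(1,2,5,6) linear_on_comp[OF assms(7,9)] linear_on_comp[OF assms(8,10)]])
next
  fix x y assume xy: "x \<in> carrier V" "y \<in> carrier W"
  then have "f x \<in> carrier V'" "g y \<in> carrier W'"
    using assms by (auto intro: linear_on_closed)
  with xy show "tensor_map V' W' V'' W'' f' g' (tensor_map V W V' W' f g (pure V W x y))
     = tensor_map V W V'' W'' (\<lambda>x. f' (f x)) (\<lambda>y. g' (g y)) (pure V W x y)"
    using assms by (simp add: tensor_map_pure linear_on_comp[OF assms(7,9)] linear_on_comp[OF assms(8,10)])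
qed

lemma tensor_map_id:
  assumes "vspace V" "vspace W" "t \<in> carrier (V \<otimes> W)"
  shows "tensor_map V W V W (\<lambda>x. x) (\<lambda>y. y) t = t"
  by (rule linear_on_tensor_unique[OF assms(1,2) vspace_tensor_product
        linear_on_tensor_map[OF assms(1,2) assms(1,2) linear_on_id linear_on_id] linear_on_id
        tensor_map_pure[OF assms(1,2) linear_on_id linear_on_id] assms(3)])

lemma tensor_lift_comp:
  assumes "vspace V" "vspace W" "vspace U" "vspace U'"
    and "bilinear_on V W U b" "linear_on U U' f" "t \<in> carrier (V \<otimes> W)"
  shows "f (tensor_lift V W b t) = tensor_lift V W (\<lambda>x y. f (b x y)) t"
proof (rule linear_on_tensor_unique[OF assms(1,2,4) _ _ _ assms(7)])
  have bil: "bilinear_on V W U' (\<lambda>x y. f (b x y))"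
    by (rule bilinear_on_compose_linear) (fact assms)+
  show "linear_on (V \<otimes> W) U' (\<lambda>t. f (tensor_lift V W b t))"
    by (rule linear_on_comp[OF linear_on_tensor_lift]) (fact assms)+
  show "linear_on (V \<otimes> W) U' (tensor_lift V W (\<lambda>x y. f (b x y)))"
    by (rule linear_on_tensor_lift) (fact assms bil)+
  show "f (tensor_lift V W b (pure V W x y)) = tensor_lift V W (\<lambda>x y. f (b x y)) (pure V W x y)"
    if "x \<in> carrier V" "y \<in> carrier W" for x y
    using assms bil that by (simp add: tensor_lift_pure)
qed

lemma tensor_lift_zero:
  fixes V :: "('k::field, 'a::ab_group_add, 'p) vspace_scheme"
    and W :: "('k, 'b::ab_group_add, 'q) vspace_scheme"
    and U :: "('k, 'c::ab_group_add, 'm) vspace_scheme"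
  assumes "vspace V" "vspace W" "vspace U" "t \<in> carrier (V \<otimes> W)"
  shows "tensor_lift V W (\<lambda>_ _. 0 :: 'c) t = (0 :: 'c)"
proof (rule linear_on_tensor_unique[OF assms(1,2,3) _ _ _ assms(4)])
  have b: "bilinear_on V W U (\<lambda>_ _. 0 :: 'c)"
    by (intro bilinear_onI linear_on_zero assms)
  then show "linear_on (V \<otimes> W) U (tensor_lift V W (\<lambda>_ _. 0 :: 'c))"
    by (intro linear_on_tensor_lift assms)
  show "linear_on (V \<otimes> W) U (\<lambda>_. 0)"
    by (rule linear_on_zero[OF assms(3)])
  show "tensor_lift V W (\<lambda>_ _. 0 :: 'c) (pure V W x y) = 0" if "x \<in> carrier V" "y \<in> carrier W" for x y
    using tensor_lift_pure[OF assms(3) b that] .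
qed

text \<open>The lists in the definition of \<open>tensor_lift\<close> only contain pairs from the
  carriers, so the two descriptions are equivalent word by word. This allows identities that hold
  only on the carriers to be rewritten under a lift.\<close>

lemma tensor_lift_cong:
  assumes "\<And>x y. x \<in> carrier V \<Longrightarrow> y \<in> carrier W \<Longrightarrow> b x y = b' x y"
  shows "tensor_lift V W b t = tensor_lift V W b' t"
proof -
  have eq: "(\<Sum>(x, y)\<leftarrow>xs. b x y) = (\<Sum>(x, y)\<leftarrow>xs. b' x y)" if "set xs \<subseteq> carrier V \<times> carrier W" for xs
    using that assms by (induction xs) auto
  have "(set xs \<subseteq> carrier V \<times> carrier W \<and> t = (\<Sum>(x, y)\<leftarrow>xs. pure V W x y) \<and> u = (\<Sum>(x, y)\<leftarrow>xs. b x y))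
    \<longleftrightarrow> (set xs \<subseteq> carrier V \<times> carrier W \<and> t = (\<Sum>(x, y)\<leftarrow>xs. pure V W x y) \<and> u = (\<Sum>(x, y)\<leftarrow>xs. b' x y))"
    for xs u
    by (intro conj_cong refl) (simp add: eq)
  then show ?thesis
    unfolding tensor_lift_def by simp
qed

lemma tensor_map_cong:
  assumes "\<And>x. x \<in> carrier V \<Longrightarrow> f x = f' x" "\<And>y. y \<in> carrier W \<Longrightarrow> g y = g' y"
  shows "tensor_map V W V' W' f g t = tensor_map V W V' W' f' g' t"
  unfolding tensor_map_def by (rule tensor_lift_cong) (simp add: assms)

section \<open>The rebracketing map and its naturality\<close>

lemma bilinear_on_tensor_assoc_inner:
  assumes "vspace V" "vspace W" "vspace U" "z \<in> carrier U"
  shows "bilinear_on V W (V \<otimes> (W \<otimes> U)) (\<lambda>x y. pure V (W \<otimes> U) x (pure W U y z))"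
proof (rule bilinear_onI)
  have WU: "vspace (W \<otimes> U)" by (rule vspace_tensor_product)
  show "linear_on V (V \<otimes> W \<otimes> U) (\<lambda>x. pure V (W \<otimes> U) x (pure W U y z))" if "y \<in> carrier W" for y
    by (intro linear_on_pure_left assms WU pure_closed that)
  show "linear_on W (V \<otimes> W \<otimes> U) (\<lambda>y. pure V (W \<otimes> U) x (pure W U y z))" if "x \<in> carrier V" for x
    by (rule linear_on_comp[OF linear_on_pure_left[OF assms(2,3,4)] linear_on_pure_right[OF assms(1) WU that]])
qed

text \<open>Linearity in \<open>z\<close> cannot be read off the inner lift, where \<open>z\<close>
  is a parameter. But with \<open>z\<close> fixed, both sides of each law are linear in
  \<open>t\<close>, so the law only has to be checked on pure tensors.\<close>

lemma bilinear_on_tensor_assoc: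
  assumes "vspace V" "vspace W" "vspace U"
  shows "bilinear_on (V \<otimes> W) U (V \<otimes> (W \<otimes> U))
    (\<lambda>t z. tensor_lift V W (\<lambda>x y. pure V (W \<otimes> U) x (pure W U y z)) t)"
proof (rule bilinear_onI)
  note ten = vspace_tensor_product
  show lin: "linear_on (V \<otimes> W) (V \<otimes> W \<otimes> U) (tensor_lift V W (\<lambda>x y. pure V (W \<otimes> U) x (pure W U y z)))"
    if "z \<in> carrier U" for z
    by (intro linear_on_tensor_lift bilinear_on_tensor_assoc_inner assms that ten)
  interpret u: vspace U by fact
  interpret T: vspace "V \<otimes> W \<otimes> U" by (rule ten)
  fix t assume t: "t \<in> carrier (V \<otimes> W)"
  show "linear_on U (V \<otimes> W \<otimes> U) (\<lambda>z. tensor_lift V W (\<lambda>x y. pure V (W \<otimes> U) x (pure W U y z)) t)"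
  proof (rule linear_onI)
    show "tensor_lift V W (\<lambda>x y. pure V (W \<otimes> U) x (pure W U y z)) t \<in> carrier (V \<otimes> W \<otimes> U)"
      if "z \<in> carrier U" for z
      using linear_on_closed[OF lin[OF that] t] .
    fix z assume z: "z \<in> carrier U"
    show "tensor_lift V W (\<lambda>x y. pure V (W \<otimes> U) x (pure W U y (z + z'))) t =
         tensor_lift V W (\<lambda>x y. pure V (W \<otimes> U) x (pure W U y z)) t +
         tensor_lift V W (\<lambda>x y. pure V (W \<otimes> U) x (pure W U y z')) t" if z': "z' \<in> carrier U" for z'
    proof (rule linear_on_tensor_unique[OF assms(1,2) ten _ _ _ t])
      show "linear_on (V \<otimes> W) (V \<otimes> W \<otimes> U) (tensor_lift V W (\<lambda>x y. pure V (W \<otimes> U) x (pure W U y (z + z'))))"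
        by (intro lin u.add_closed z z')
      show "linear_on (V \<otimes> W) (V \<otimes> W \<otimes> U) (\<lambda>t. tensor_lift V W (\<lambda>x y. pure V (W \<otimes> U) x (pure W U y z)) t +
         tensor_lift V W (\<lambda>x y. pure V (W \<otimes> U) x (pure W U y z')) t)"
        by (intro linear_on_add lin ten z z')
      fix x y assume xy: "x \<in> carrier V" "y \<in> carrier W"
      have "pure V (W \<otimes> U) x (pure W U y (z + z')) = pure V (W \<otimes> U) x (pure W U y z) + pure V (W \<otimes> U) x (pure W U y z')"
        using linear_on_plus[OF linear_on_comp[OF linear_on_pure_right[OF assms(2,3) xy(2)] linear_on_pure_right[OF assms(1) ten xy(1)]] z z'] .
      then show "tensor_lift V W (\<lambda>x y. pure V (W \<otimes> U) x (pure W U y (z + z'))) (pure V W x y) =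
         tensor_lift V W (\<lambda>x y. pure V (W \<otimes> U) x (pure W U y z)) (pure V W x y) +
         tensor_lift V W (\<lambda>x y. pure V (W \<otimes> U) x (pure W U y z')) (pure V W x y)"
        using tensor_lift_pure[OF ten bilinear_on_tensor_assoc_inner[OF assms] xy] z z' u.add_closed by simp
    qed
    show "tensor_lift V W (\<lambda>x y. pure V (W \<otimes> U) x (pure W U y (scale U a z))) t =
         scale (V \<otimes> W \<otimes> U) a (tensor_lift V W (\<lambda>x y. pure V (W \<otimes> U) x (pure W U y z)) t)" for a
    proof (rule linear_on_tensor_unique[OF assms(1,2) ten _ _ _ t])
      show "linear_on (V \<otimes> W) (V \<otimes> W \<otimes> U) (tensor_lift V W (\<lambda>x y. pure V (W \<otimes> U) x (pure W U y (scale U a z))))"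
        by (intro lin u.scale_closed z)
      show "linear_on (V \<otimes> W) (V \<otimes> W \<otimes> U) (\<lambda>t. scale (V \<otimes> W \<otimes> U) a (tensor_lift V W (\<lambda>x y. pure V (W \<otimes> U) x (pure W U y z)) t))"
        by (intro linear_on_scale lin ten z)
      fix x y assume xy: "x \<in> carrier V" "y \<in> carrier W"
      have "pure V (W \<otimes> U) x (pure W U y (scale U a z)) = scale (V \<otimes> W \<otimes> U) a (pure V (W \<otimes> U) x (pure W U y z))"
        using linear_on_smult[OF linear_on_comp[OF linear_on_pure_right[OF assms(2,3) xy(2)] linear_on_pure_right[OF assms(1) ten xy(1)]] z] .
      then show "tensor_lift V W (\<lambda>x y. pure V (W \<otimes> U) x (pure W U y (scale U a z))) (pure V W x y) =
         scale (V \<otimes> W \<otimes> U) a (tensor_lift V W (\<lambda>x y. pure V (W \<otimes> U) x (pure W U y z)) (pure V W x y))"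
        using tensor_lift_pure[OF ten bilinear_on_tensor_assoc_inner[OF assms] xy] z u.scale_closed by simp
    qed
  qed
qed

lemma linear_on_tensor_assoc:
  assumes "vspace V" "vspace W" "vspace U"
  shows "linear_on ((V \<otimes> W) \<otimes> U) (V \<otimes> (W \<otimes> U)) (tensor_assoc V W U)"
  unfolding tensor_assoc_def
  by (intro linear_on_tensor_lift bilinear_on_tensor_assoc vspace_tensor_product assms)

lemma tensor_assoc_pure:
  assumes "vspace V" "vspace W" "vspace U" "x \<in> carrier V" "y \<in> carrier W" "z \<in> carrier U"
  shows "tensor_assoc V W U (pure (V \<otimes> W) U (pure V W x y) z) = pure V (W \<otimes> U) x (pure W U y z)"
  unfolding tensor_assoc_def
  by (subst tensor_lift_pure[OF vspace_tensor_product bilinear_on_tensor_assoc])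
    (simp_all add: assms pure_closed tensor_lift_pure[OF vspace_tensor_product bilinear_on_tensor_assoc_inner])

lemma linear_on_tensor_unique3:
  assumes "vspace V" "vspace W" "vspace U" "vspace X"
    and f: "linear_on ((V \<otimes> W) \<otimes> U) X f" and g: "linear_on ((V \<otimes> W) \<otimes> U) X g"
    and eq: "\<And>x y z. x \<in> carrier V \<Longrightarrow> y \<in> carrier W \<Longrightarrow> z \<in> carrier U \<Longrightarrow>
      f (pure (V \<otimes> W) U (pure V W x y) z) = g (pure (V \<otimes> W) U (pure V W x y) z)"
    and t: "t \<in> carrier ((V \<otimes> W) \<otimes> U)"
  shows "f t = g t"
proof (rule linear_on_tensor_unique[OF vspace_tensor_product assms(3,4) f g _ t])
  fix s z assume s: "s \<in> carrier (V \<otimes> W)" and z: "z \<in> carrier U"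
  note lin = linear_on_pure_left[OF vspace_tensor_product assms(3) z]
  show "f (pure (V \<otimes> W) U s z) = g (pure (V \<otimes> W) U s z)"
    by (rule linear_on_tensor_unique[OF assms(1,2,4) linear_on_comp[OF lin f] linear_on_comp[OF lin g] eq s])
      (use z in auto)
qed

text \<open>Both sides are linear and agree on pure tensors of three vectors. Coassociativity uses
  this to move operators on the three legs across the rebracketing.\<close>

lemma tensor_assoc_natural:
  assumes "vspace V" "vspace W" "vspace U" "linear_on V V f" "linear_on W W g" "linear_on U U h"
    and t: "t \<in> carrier ((V \<otimes> W) \<otimes> U)"
  shows "tensor_assoc V W U (tensor_map (V \<otimes> W) U (V \<otimes> W) U (tensor_map V W V W f g) h t)
    = tensor_map V (W \<otimes> U) V (W \<otimes> U) f (tensor_map W U W U g h) (tensor_assoc V W U t)"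
proof (rule linear_on_tensor_unique3[OF assms(1-3) vspace_tensor_product _ _ _ t])
  note ten = vspace_tensor_product
  note fg = linear_on_tensor_map[OF assms(1,2,1,2,4,5)]
  note gh = linear_on_tensor_map[OF assms(2,3,2,3,5,6)]
  note as = linear_on_tensor_assoc[OF assms(1-3)]
  show "linear_on ((V \<otimes> W) \<otimes> U) (V \<otimes> W \<otimes> U)
     (\<lambda>t. tensor_assoc V W U (tensor_map (V \<otimes> W) U (V \<otimes> W) U (tensor_map V W V W f g) h t))"
    by (rule linear_on_comp[OF linear_on_tensor_map[OF ten assms(3) ten assms(3) fg assms(6)] as])
  show "linear_on ((V \<otimes> W) \<otimes> U) (V \<otimes> W \<otimes> U)
     (\<lambda>t. tensor_map V (W \<otimes> U) V (W \<otimes> U) f (tensor_map W U W U g h) (tensor_assoc V W U t))"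
    by (rule linear_on_comp[OF as linear_on_tensor_map[OF assms(1) ten assms(1) ten assms(4) gh]])
  show "tensor_assoc V W U (tensor_map (V \<otimes> W) U (V \<otimes> W) U (tensor_map V W V W f g) h
          (pure (V \<otimes> W) U (pure V W x y) z))
    = tensor_map V (W \<otimes> U) V (W \<otimes> U) f (tensor_map W U W U g h)
        (tensor_assoc V W U (pure (V \<otimes> W) U (pure V W x y) z))"
    if xyz: "x \<in> carrier V" "y \<in> carrier W" "z \<in> carrier U" for x y z
    unfolding tensor_map_pure[OF ten assms(3) fg assms(6) pure_closed[OF xyz(1,2)] xyz(3)]
      tensor_map_pure[OF assms(1,2,4,5) xyz(1,2)] tensor_assoc_pure[OF assms(1-3) xyz]
      tensor_map_pure[OF assms(1) ten assms(4) gh xyz(1) pure_closed[OF xyz(2,3)]]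
      tensor_map_pure[OF assms(2,3,5,6) xyz(2,3)]
    by (rule tensor_assoc_pure[OF assms(1-3)]) (intro linear_on_closed[OF assms(4)]
        linear_on_closed[OF assms(5)] linear_on_closed[OF assms(6)] xyz)+
qed

section \<open>Roots of unity and Gaussian binomials\<close>

text \<open>The Gaussian binomial coefficient, given by a Pascal recursion because quotients of
  q-factorials make no sense at a root of unity. Of the two recursions this one fits products
  ordered as \<open>x^b y^(k-b)\<close> with \<open>y x = q x y\<close>.\<close>

fun qbinom :: "'k::field \<Rightarrow> nat \<Rightarrow> nat \<Rightarrow> 'k" where
  "qbinom q k 0 = 1"
| "qbinom q 0 (Suc b) = 0"
| "qbinom q (Suc k) (Suc b) = qbinom q k b + q ^ Suc b * qbinom q k (Suc b)"

lemma qbinom_eq_0: "k < b \<Longrightarrow> qbinom q k b = 0"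
  by (induction q k b rule: qbinom.induct) auto

lemma qbinom_refl [simp]: "qbinom q k k = 1"
  by (induction k) (auto simp: qbinom_eq_0)

text \<open>The absorption identity with denominators cleared. At \<open>k + 1 = n\<close> its right
  side vanishes, which kills the middle coefficients of order \<open>n\<close>; below
  \<open>n\<close> the factors \<open>1 - q^(k+1)\<close> are nonzero and keep every coefficient
  nonzero.\<close>

lemma qbinom_absorb: "(1 - q ^ Suc b) * qbinom q (Suc k) (Suc b) = (1 - q ^ Suc k) * qbinom q k b"
proof (induction k arbitrary: b)
  case 0
  show ?case by (cases b) auto
next
  case (Suc k)
  have eq: "qbinom q (Suc (Suc k)) (Suc b) = qbinom q (Suc k) b + q ^ Suc b * qbinom q (Suc k) (Suc b)"
    by simp
  have 1: "(1 - q ^ Suc b) * qbinom q (Suc (Suc k)) (Suc b)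
      = (1 - q ^ Suc b) * qbinom q (Suc k) b + q ^ Suc b * ((1 - q ^ Suc k) * qbinom q k b)"
    unfolding eq Suc.IH[symmetric] by (simp only: algebra_simps)
  show ?case
  proof (cases b)
    case 0
    then show ?thesis unfolding 1 by (simp add: algebra_simps)
  next
    case (Suc b')
    have 2: "qbinom q (Suc k) (Suc b') - q ^ Suc b' * qbinom q k (Suc b') = qbinom q k b'"
      by simp
    have "(1 - q ^ b) * qbinom q (Suc k) b = (1 - q ^ Suc k) * (qbinom q (Suc k) b - q ^ b * qbinom q k b)"
      using Suc.IH[of b'] unfolding Suc 2 .
    \<comment> \<open>Multiplication by \<open>q\<close> trades \<open>q^b\<close> and
      \<open>q^(k+1)\<close> for the \<open>q^(b+1)\<close> and \<open>q^(k+2)\<close> of the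
      claim.\<close>
    then have "q * ((1 - q ^ b) * qbinom q (Suc k) b)
        = q * ((1 - q ^ Suc k) * (qbinom q (Suc k) b - q ^ b * qbinom q k b))"
      by (rule arg_cong)
    then show ?thesis
      unfolding 1 unfolding power_Suc by (simp add: algebra_simps del: qbinom.simps)
  qed
qed

lemma qbinom_root_eq_0:
  assumes "primitive_root_of_unity n q" "0 < b" "b < n"
  shows "qbinom q n b = 0"
proof -
  obtain b' k where "b = Suc b'" "n = Suc k" using assms by (metis gr0_implies_Suc less_trans)
  with assms qbinom_absorb[of q b' k] show ?thesis
    unfolding primitive_root_of_unity_def by (metis diff_self eq_iff_diff_eq_0 mult_eq_0_iff)
qed

lemma qbinom_nonzero:
  assumes "primitive_root_of_unity n q" "b \<le> k" "k < n"
  shows "qbinom q k b \<noteq> 0"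
  using assms(2,3)
proof (induction k arbitrary: b)
  case (Suc k)
  show ?case
  proof (cases b)
    case (Suc b')
    have "q ^ Suc k \<noteq> 1"
      using assms(1) Suc.prems unfolding primitive_root_of_unity_def by blast
    moreover have "qbinom q k b' \<noteq> 0"
      using Suc Suc.prems by (intro Suc.IH) auto
    ultimately show ?thesis
      using qbinom_absorb[of q b' k] unfolding Suc by (metis eq_iff_diff_eq_0 mult_eq_0_iff)
  qed simp
qed simp

lemma sum_power_root_eq_0:
  assumes "primitive_root_of_unity n q" "n > 1"
  shows "(\<Sum>j<n. q ^ j) = 0"
proof -
  have "q \<noteq> 1" using assms unfolding primitive_root_of_unity_def by (metis power_one_right zero_less_one)
  moreover have "(1 - q) * (\<Sum>j<n. q ^ j) = 0"
    using assms unfolding primitive_root_of_unity_def by (simp flip: one_diff_power_eq)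
  ultimately show ?thesis by simp
qed

text \<open>The product is \<open>(-1)^n * q^(n(n-1)/2)\<close>. For odd \<open>n\<close> the
  exponent of \<open>q\<close> is a multiple of \<open>n\<close>. For \<open>n = 2 * m\<close> it is
  \<open>m * (n - 1)\<close>, and \<open>q^m = -1\<close>, since its square is 1 and primitivity
  excludes 1. The value is the sign with which the antipode reorders the \<open>n\<close>-th powers
  of its values on \<open>E\<close> and \<open>F\<close>.\<close>

lemma prod_neg_powers_root:
  fixes q :: "'k::field"
  assumes "primitive_root_of_unity n q"
  shows "(\<Prod>i<n. - (q ^ i)) = - 1"
proof -
  have S: "2 * (\<Sum>i<m. i) = m * (m - 1)" for m :: nat
  proof (induction m)
    case (Suc m)
    then show ?case by (cases m) (simp_all add: algebra_simps)
  qed simp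
  have q: "q ^ n = 1" "n > 0" using assms by (auto simp: primitive_root_of_unity_def)
  have P: "(\<Prod>i<m. - (q ^ i)) = (- 1) ^ m * q ^ (\<Sum>i<m. i)" for m
    by (induction m) (simp_all add: power_add mult_ac)
  show ?thesis
  proof (cases "even n")
    case True
    then obtain m where m: "n = 2 * m" by blast
    then have "(\<Sum>i<n. i) = m * (n - 1)" using S[of n] by simp
    then have "q ^ (\<Sum>i<n. i) = (q ^ m) ^ (n - 1)" by (simp add: power_mult)
    moreover have "(q ^ m) ^ 2 = 1" using q m by (simp add: mult.commute flip: power_mult)
    then have "q ^ m = 1 \<or> q ^ m = - 1" by (simp add: power2_eq_1_iff)
    then have "q ^ m = - 1"
      using assms m q(2) by (auto simp: primitive_root_of_unity_def)
    ultimately show ?thesis using True q(2) by (simp add: P)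
  next
    case False
    then obtain m where m: "n = 2 * m + 1" by (meson oddE)
    then have "(\<Sum>i<n. i) = n * m" using S[of n] by simp
    then have "q ^ (\<Sum>i<n. i) = 1" using q by (simp add: power_mult)
    then show ?thesis using False by (simp add: P)
  qed
qed

lemma finite_power_fibre:
  fixes a :: "'k::field"
  assumes "n > 0"
  shows "finite {x. x ^ n = a}"
proof -
  have "coeff (monom 1 n - [:a:]) n = 1"
    using assms by (cases n) simp_all
  then have "monom 1 n - [:a:] \<noteq> 0" by (metis coeff_0 zero_neq_one)
  then have "finite {x. poly (monom 1 n - [:a:]) x = 0}" by (rule poly_roots_finite)
  then show ?thesis by (simp add: poly_monom)
qed

lemma primitive_root_inverse:
  "primitive_root_of_unity n q \<Longrightarrow> primitive_root_of_unity n (inverse q)"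
  unfolding primitive_root_of_unity_def by (auto simp: power_inverse)

text \<open>The binomial theorem for q-commuting operators. In the induction, \<open>x\<close>
  shifts the index and \<open>y\<close> picks up \<open>q^b\<close> on its way past
  \<open>x^b\<close>; Pascal's rule collects the two sums.\<close>

lemma (in vspace) qbinomial:
  assumes x: "linear_on V V x" and y: "linear_on V V y"
    and yx: "\<And>u. u \<in> carrier V \<Longrightarrow> y (x u) = scale V q (x (y u))"
    and u: "u \<in> carrier V"
  shows "((\<lambda>u. x u + y u) ^^ k) u = (\<Sum>b\<le>k. scale V (qbinom q k b) ((x ^^ b) ((y ^^ (k - b)) u)))"
proof (induction k)
  case (Suc k)
  have V: "vspace V" ..
  note cl [simp] = linear_on_closed[OF linear_on_funpow[OF x]] linear_on_closed[OF linear_on_funpow[OF y]]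
    linear_on_closed[OF x] linear_on_closed[OF y] u
  have yxp: "y ((x ^^ b) w) = scale V (q ^ b) ((x ^^ b) (y w))" if "w \<in> carrier V" for b w
    using that by (induction b) (simp_all add: yx linear_on_smult[OF x])
  let ?t = "\<lambda>b. scale V (q ^ b * qbinom q k b) ((x ^^ b) ((y ^^ (Suc k - b)) u))"
  have "((\<lambda>u. x u + y u) ^^ Suc k) u
      = (\<Sum>b\<le>k. x (scale V (qbinom q k b) ((x ^^ b) ((y ^^ (k - b)) u))))
        + (\<Sum>b\<le>k. y (scale V (qbinom q k b) ((x ^^ b) ((y ^^ (k - b)) u))))"
    by (simp add: Suc.IH linear_on_sum[OF V x] linear_on_sum[OF V y])
  also have "(\<Sum>b\<le>k. x (scale V (qbinom q k b) ((x ^^ b) ((y ^^ (k - b)) u))))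
      = (\<Sum>b\<le>k. scale V (qbinom q k b) ((x ^^ Suc b) ((y ^^ (k - b)) u)))"
    by (simp add: linear_on_smult[OF x])
  also have "(\<Sum>b\<le>k. y (scale V (qbinom q k b) ((x ^^ b) ((y ^^ (k - b)) u)))) = (\<Sum>b\<le>k. ?t b)"
    by (rule sum.cong) (auto simp: linear_on_smult[OF y] yxp Suc_diff_le mult.commute)
  \<comment> \<open>The added term has coefficient \<open>qbinom q k (Suc k) = 0\<close>; with it
    the index shift lines up with the other sum.\<close>
  also have "(\<Sum>b\<le>k. ?t b) = (\<Sum>b\<le>Suc k. ?t b)"
    by (simp add: qbinom_eq_0)
  also have "\<dots> = (y ^^ Suc k) u + (\<Sum>b\<le>k. ?t (Suc b))"
    by (subst sum.atMost_Suc_shift) simp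
  also have "(\<Sum>b\<le>k. scale V (qbinom q k b) ((x ^^ Suc b) ((y ^^ (k - b)) u)))
      + ((y ^^ Suc k) u + (\<Sum>b\<le>k. ?t (Suc b)))
      = (y ^^ Suc k) u + (\<Sum>b\<le>k. scale V (qbinom q (Suc k) (Suc b)) ((x ^^ Suc b) ((y ^^ (k - b)) u)))"
    by (simp add: sum.distrib vs.scale_left_distrib add_ac)
  also have "\<dots> = (\<Sum>b\<le>Suc k. scale V (qbinom q (Suc k) b) ((x ^^ b) ((y ^^ (Suc k - b)) u)))"
    unfolding sum.atMost_Suc_shift[of "\<lambda>b. scale V (qbinom q (Suc k) b) ((x ^^ b) ((y ^^ (Suc k - b)) u))"]
    by (simp del: qbinom.simps(3) funpow.simps)
  finally show ?case .
qed simp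

lemma (in vspace) qbinomial_root:
  assumes "linear_on V V x" "linear_on V V y"
    and "\<And>u. u \<in> carrier V \<Longrightarrow> y (x u) = scale V q (x (y u))"
    and "u \<in> carrier V" and "primitive_root_of_unity n q"
  shows "((\<lambda>u. x u + y u) ^^ n) u = (x ^^ n) u + (y ^^ n) u"
proof -
  have n: "n > 0" using assms(5) by (simp add: primitive_root_of_unity_def)
  have "((\<lambda>u. x u + y u) ^^ n) u = (\<Sum>b\<le>n. scale V (qbinom q n b) ((x ^^ b) ((y ^^ (n - b)) u)))"
    by (rule qbinomial) (fact assms)+
  also have "\<dots> = (\<Sum>b\<in>{0, n}. scale V (qbinom q n b) ((x ^^ b) ((y ^^ (n - b)) u)))"
    by (rule sum.mono_neutral_right) (auto simp: qbinom_root_eq_0[OF assms(5)])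
  also have "\<dots> = (x ^^ n) u + (y ^^ n) u"
    using n by (simp add: add.commute)
  finally show ?thesis .
qed

lemma funpow_ident [simp]: "((\<lambda>x. x) ^^ j) x = x"
  by (induction j) auto

section \<open>The defining relations\<close>

text \<open>The scalar \<open>c\<close> is an unconstrained parameter. Constants that do not mention
  it, such as the underlying space and the operators for \<open>K\<close> and \<open>F\<close>, are
  literally the same for all \<open>c\<close>; two members of the family can thus be compared on one
  space.\<close>

locale qparam =
  fixes n :: nat and q c :: "'k::field"
  assumes n_gt_2: "n > 2" and q_root: "primitive_root_of_unity n q"
begin

abbreviation p :: 'k where "p \<equiv> inverse q"

lemma p_root: "primitive_root_of_unity n p"
  by (rule primitive_root_inverse[OF q_root])

lemma q_pow [simp]: "q ^ n = 1"
  using q_root by (simp add: primitive_root_of_unity_def)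

lemma q_nonzero [simp]: "q \<noteq> 0"
  using q_pow n_gt_2 by (metis power_0_left zero_neq_one gr_implies_not0)

lemma p_pow [simp]: "p ^ n = 1"
  by (simp add: power_inverse)

lemma pq [simp]: "p * q = 1" "q * p = 1" "p * (q * x) = x" "q * (p * x) = x"
  by (simp_all flip: mult.assoc)

lemma pq_pow [simp]: "p ^ j * q ^ j = 1" "q ^ j * p ^ j = 1"
  by (simp_all flip: power_mult_distrib)

lemma q_neq_1 [simp]: "q \<noteq> 1"
  using q_root n_gt_2 by (metis One_nat_def Suc_lessD numeral_2_eq_2 power_one_right primitive_root_of_unity_def zero_less_one)

lemma q_neq_p: "q \<noteq> p"
proof
  assume "q = p"
  then have "q ^ 2 = 1" by (metis pq(2) power2_eq_square)
  then show False using q_root n_gt_2 by (auto simp: primitive_root_of_unity_def)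
qed

text \<open>These geometric sums measure the failure of \<open>E\<close> to commute with powers of
  \<open>F\<close>, and of \<open>F\<close> with powers of \<open>E\<close>. Both vanish at
  \<open>n\<close>, which is why \<open>n\<close>-th powers of \<open>E\<close> and \<open>F\<close>
  can be prescribed.\<close>

definition ap :: "nat \<Rightarrow> 'k" where "ap l = (\<Sum>j<l. p ^ j)"
definition aq :: "nat \<Rightarrow> 'k" where "aq l = (\<Sum>j<l. q ^ j)"

lemma ap_aq_0 [simp]: "ap 0 = 0" "aq 0 = 0"
  by (simp_all add: ap_def aq_def)

lemma ap_aq_Suc: "ap (Suc l) = ap l + p ^ l" "aq (Suc l) = aq l + q ^ l"
  by (simp_all add: ap_def aq_def)

lemma ap_aq_Suc_shift: "ap (Suc l) = 1 + p * ap l" "aq (Suc l) = 1 + q * aq l"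
  by (simp_all add: ap_def aq_def sum.lessThan_Suc_shift sum_distrib_left del: sum.lessThan_Suc)

lemma ap_aq_n [simp]: "ap n = 0" "aq n = 0"
  using sum_power_root_eq_0[OF p_root] sum_power_root_eq_0[OF q_root] n_gt_2
  by (simp_all add: ap_def aq_def)

end

text \<open>
  The relations of the algebra for an action on \<open>M\<close>, the inverse of \<open>K\<close> being its power
  \<open>2 * n - 1\<close>.  Working with operators instead of elements keeps composition associative.
\<close>

locale qmod_weak = qparam n q c + vspace M
  for n :: nat and q c :: "'k::field" and M :: "('k, 'b::ab_group_add, 'm) vspace_scheme" +
  fixes K E F :: "'b \<Rightarrow> 'b"
  assumes lin_K: "linear_on M M K" and lin_E: "linear_on M M E" and lin_F: "linear_on M M F"
    and KE: "u \<in> carrier M \<Longrightarrow> K (E u) = scale M q (E (K u))"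
    and KF: "u \<in> carrier M \<Longrightarrow> K (F u) = scale M (inverse q) (F (K u))"
    and EF: "u \<in> carrier M \<Longrightarrow> E (F u) - F (E u) = scale M c (K u - (K ^^ (2 * n - 1)) u)"
    and K_order: "u \<in> carrier M \<Longrightarrow> (K ^^ (2 * n)) u = u"
begin

definition Ki :: "'b \<Rightarrow> 'b" where "Ki = K ^^ (2 * n - 1)"

lemmas lin_pow = linear_on_funpow[OF lin_K, of "2 * n - 1", folded Ki_def] linear_on_funpow[OF lin_K] linear_on_funpow[OF lin_E] linear_on_funpow[OF lin_F]

lemma vspace_M: "vspace M" ..

lemmas op_closed [simp] = linear_on_closed[OF lin_K] linear_on_closed[OF lin_E] linear_on_closed[OF lin_F]
  lin_pow[THEN linear_on_closed]

lemmas op_linear = linear_on_plus[OF lin_K] linear_on_plus[OF lin_E] linear_on_plus[OF lin_F]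
  linear_on_smult[OF lin_K] linear_on_smult[OF lin_E] linear_on_smult[OF lin_F]
  linear_on_minus[OF vspace_M lin_K] linear_on_minus[OF vspace_M lin_E] linear_on_minus[OF vspace_M lin_F]
  lin_pow[THEN linear_on_plus] lin_pow[THEN linear_on_smult] lin_pow[THEN linear_on_minus[OF vspace_M]]

lemma K_Ki [simp]: "u \<in> carrier M \<Longrightarrow> K (Ki u) = u" "u \<in> carrier M \<Longrightarrow> Ki (K u) = u"
proof -
  assume u: "u \<in> carrier M"
  have "2 * n = Suc (2 * n - 1)" using n_gt_2 by simp
  then have "(K ^^ Suc (2 * n - 1)) u = u" using K_order[OF u] by metis
  then show "K (Ki u) = u" "Ki (K u) = u"
    by (simp_all add: Ki_def funpow_swap1)
qed

lemma K_mod: "u \<in> carrier M \<Longrightarrow> (K ^^ (i mod (2 * n))) u = (K ^^ i) u"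
proof (induction i rule: less_induct)
  case (less i)
  show ?case
  proof (cases "i < 2 * n")
    case False
    then have "i = (i - 2 * n) + 2 * n" by simp
    then have "(K ^^ i) u = (K ^^ (i - 2 * n)) ((K ^^ (2 * n)) u)"
      by (metis comp_apply funpow_add)
    also have "\<dots> = (K ^^ ((i - 2 * n) mod (2 * n))) u"
      using less False n_gt_2 by (simp add: K_order)
    also have "(i - 2 * n) mod (2 * n) = i mod (2 * n)"
      using False by (metis le_mod_geq not_le)
    finally show ?thesis ..
  qed simp
qed

lemma EK: "u \<in> carrier M \<Longrightarrow> E (K u) = scale M p (K (E u))"
  by (simp add: KE)

lemma FK: "u \<in> carrier M \<Longrightarrow> F (K u) = scale M q (K (F u))"
  by (simp add: KF)

lemma K_Epow: "u \<in> carrier M \<Longrightarrow> K ((E ^^ k) u) = scale M (q ^ k) ((E ^^ k) (K u))"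
  by (induction k) (simp_all add: KE op_linear)

lemma K_Fpow: "u \<in> carrier M \<Longrightarrow> K ((F ^^ l) u) = scale M (p ^ l) ((F ^^ l) (K u))"
  by (induction l) (simp_all add: KF op_linear)

lemma E_Kpow: "u \<in> carrier M \<Longrightarrow> E ((K ^^ i) u) = scale M (p ^ i) ((K ^^ i) (E u))"
  by (induction i) (simp_all add: EK op_linear)

lemma E_Ki: "u \<in> carrier M \<Longrightarrow> E (Ki u) = scale M q (Ki (E u))"
proof -
  assume u: "u \<in> carrier M"
  have "Ki (E u) = Ki (E (K (Ki u)))" using u by simp
  also have "\<dots> = Ki (scale M p (K (E (Ki u))))" using u by (simp only: EK op_closed)
  also have "\<dots> = scale M p (E (Ki u))" using u by (simp add: op_linear)
  finally show ?thesis by simp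
qed

lemma F_Ki: "u \<in> carrier M \<Longrightarrow> F (Ki u) = scale M p (Ki (F u))"
proof -
  assume u: "u \<in> carrier M"
  have "Ki (F u) = Ki (F (K (Ki u)))" using u by simp
  also have "\<dots> = Ki (scale M q (K (F (Ki u))))" using u by (simp only: FK op_closed)
  also have "\<dots> = scale M q (F (Ki u))" using u by (simp add: op_linear)
  finally show ?thesis by simp
qed

lemma Ki_Fpow: "u \<in> carrier M \<Longrightarrow> Ki ((F ^^ l) u) = scale M (q ^ l) ((F ^^ l) (Ki u))"
proof (induction l)
  case (Suc l)
  have "Ki (F w) = scale M q (F (Ki w))" if "w \<in> carrier M" for w
    using that by (simp add: F_Ki)
  with Suc show ?case by (simp add: op_linear)
qed simp

lemma E_F: "u \<in> carrier M \<Longrightarrow> E (F u) = F (E u) + scale M c (K u) - scale M c (Ki u)"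
  using EF[of u, folded Ki_def] by (simp add: vs.scale_right_diff_distrib algebra_simps)

text \<open>Each factor \<open>F\<close> in turn meets \<open>E\<close> and is replaced by
  \<open>c (K - K^-1)\<close>. Moving \<open>K\<close> past the \<open>j\<close> factors to its
  right costs \<open>p^j\<close>, moving \<open>K^-1\<close> costs \<open>q^j\<close>; the costs add
  up to the geometric sums.\<close>

lemma E_Fpow_Suc:
  "u \<in> carrier M \<Longrightarrow> E ((F ^^ Suc l) u) = (F ^^ Suc l) (E u)
    + scale M (c * ap (Suc l)) ((F ^^ l) (K u)) - scale M (c * aq (Suc l)) ((F ^^ l) (Ki u))"
proof (induction l)
  case 0
  then show ?case by (simp add: E_F ap_aq_Suc)
next
  case (Suc l)
  have "E ((F ^^ Suc (Suc l)) u) = E (F ((F ^^ Suc l) u))" by simp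
  also have "\<dots> = F (E ((F ^^ Suc l) u)) + scale M c (K ((F ^^ Suc l) u)) - scale M c (Ki ((F ^^ Suc l) u))"
    using Suc.prems by (intro E_F) (simp del: funpow.simps)
  finally show ?case
    unfolding Suc.IH[OF Suc.prems] K_Fpow[OF Suc.prems] Ki_Fpow[OF Suc.prems]
    using Suc.prems
    by (simp add: op_linear ap_aq_Suc[of "Suc l"] distrib_left vs.scale_left_distrib del: power_Suc)
qed

text \<open>At \<open>l = 0\<close> the truncated exponent \<open>l - 1\<close> is harmless, as both
  coefficients are 0.\<close>

lemma E_Fpow:
  "u \<in> carrier M \<Longrightarrow> E ((F ^^ l) u) = (F ^^ l) (E u)
    + scale M (c * ap l) ((F ^^ (l - 1)) (K u)) - scale M (c * aq l) ((F ^^ (l - 1)) (Ki u))"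
  using E_Fpow_Suc[of u "l - 1"] by (cases l) simp_all

lemma Epow_F_Suc:
  "u \<in> carrier M \<Longrightarrow> (E ^^ Suc m) (F u) = F ((E ^^ Suc m) u)
    + scale M (c * ap (Suc m)) (K ((E ^^ m) u)) - scale M (c * aq (Suc m)) (Ki ((E ^^ m) u))"
proof (induction m)
  case 0
  then show ?case by (simp add: E_F ap_aq_Suc)
next
  case (Suc m)
  have "(E ^^ Suc (Suc m)) (F u) = E ((E ^^ Suc m) (F u))" by simp
  moreover have "E (F ((E ^^ Suc m) u)) = F (E ((E ^^ Suc m) u)) + scale M c (K ((E ^^ Suc m) u)) - scale M c (Ki ((E ^^ Suc m) u))"
    using Suc.prems by (intro E_F) (simp del: funpow.simps)
  ultimately show ?case
    unfolding Suc.IH[OF Suc.prems]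
    using Suc.prems
    by (simp add: op_linear EK E_Ki ap_aq_Suc_shift[of "Suc m"] distrib_left vs.scale_left_distrib
        mult_ac del: power_Suc)
qed

lemma Epow_n_F: "u \<in> carrier M \<Longrightarrow> (E ^^ n) (F u) = F ((E ^^ n) u)"
  using Epow_F_Suc[of u "n - 1"] n_gt_2 by simp

lemma Ki_pow_2n: "u \<in> carrier M \<Longrightarrow> (Ki ^^ (2 * n)) u = u"
  using K_mod[of u "(2 * n - 1) * (2 * n)"] by (simp add: Ki_def funpow_mult mult.commute)

text \<open>The antipode sends \<open>K\<close> to its inverse, and the relations write an inverse
  as the power with exponent \<open>2 * n - 1\<close>; so this power of \<open>Ki\<close> has to be
  recognised as \<open>K\<close>.\<close>

lemma Ki_pow_pred: "u \<in> carrier M \<Longrightarrow> (Ki ^^ (2 * n - 1)) u = K u"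
proof -
  assume u: "u \<in> carrier M"
  have c: "(Ki ^^ j) u \<in> carrier M" for j
    by (induction j) (simp_all add: u)
  have "2 * n = Suc (2 * n - 1)" using n_gt_2 by simp
  then have "Ki ((Ki ^^ (2 * n - 1)) u) = u"
    using Ki_pow_2n[OF u] by (metis comp_apply funpow.simps(2))
  then show ?thesis
    using K_Ki(1)[OF c] by metis
qed

lemma E_Ki_pow: "u \<in> carrier M \<Longrightarrow> E ((Ki ^^ j) u) = scale M (q ^ j) ((Ki ^^ j) (E u))"
proof (induction j)
  case (Suc j)
  then have "(Ki ^^ j) u \<in> carrier M" "(Ki ^^ j) (E u) \<in> carrier M"
    by (simp_all add: linear_on_closed[OF linear_on_funpow[OF lin_pow(1)]])
  with Suc show ?case by (simp add: E_Ki op_linear)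
qed simp

lemma antipode_E_pow:
  "u \<in> carrier M \<Longrightarrow> ((\<lambda>u. - Ki (E u)) ^^ j) u
    = scale M (\<Prod>i<j. - (q ^ i)) ((Ki ^^ j) ((E ^^ j) u))"
proof (induction j)
  case (Suc j)
  have c: "(Ki ^^ j) w \<in> carrier M" if "w \<in> carrier M" for w
    using that by (simp add: linear_on_closed[OF linear_on_funpow[OF lin_pow(1)]])
  from Suc show ?case by (simp add: c op_linear E_Ki_pow mult.commute)
qed simp

lemma antipode_F_pow:
  "u \<in> carrier M \<Longrightarrow> ((\<lambda>u. - F (K u)) ^^ j) u
    = scale M (\<Prod>i<j. - (p ^ i)) ((F ^^ j) ((K ^^ j) u))"
proof (induction j)
  case (Suc j)
  then show ?case by (simp add: op_linear K_Fpow mult.commute)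
qed simp

end

text \<open>The power relations are split off because the one for \<open>E\<close> comes last in the
  construction: for the algebra itself, \<open>E^n\<close> is computed on a few vectors and spread
  by commutation rules already proved in \<open>qmod_weak\<close>.\<close>

locale qmod = qmod_weak n q c M K E F
  for n :: nat and q c :: "'k::field" and M :: "('k, 'b::ab_group_add, 'm) vspace_scheme"
    and K E F :: "'b \<Rightarrow> 'b" +
  assumes E_pow: "u \<in> carrier M \<Longrightarrow> (E ^^ n) u = (K ^^ n) u - u"
    and F_pow: "u \<in> carrier M \<Longrightarrow> (F ^^ n) u = u - (K ^^ n) u"

section \<open>The algebra\<close>

context qparam
begin

text \<open>The conjecture is stated for subspaces of \<open>nat \<Rightarrow> 'k\<close>, so the
  basis triples are numbered injectively by natural numbers; vectors of the space vanish at all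
  other numbers.\<close>

definition code :: "nat \<Rightarrow> nat \<Rightarrow> nat \<Rightarrow> nat" where
  "code l i k = prod_encode (l, prod_encode (i, k))"

definition Idx :: "(nat \<times> nat \<times> nat) set" where
  "Idx = {..<n} \<times> {..<2 * n} \<times> {..<n}"

text \<open>The basis vector \<open>F\<^sup>l K\<^sup>i E\<^sup>k\<close>; the exponent of \<open>K\<close> only matters modulo \<open>2 * n\<close>.\<close>

definition bv :: "nat \<Rightarrow> nat \<Rightarrow> nat \<Rightarrow> nat \<Rightarrow> 'k" where
  "bv l i k = (\<lambda>m. if m = code l (i mod (2 * n)) k then 1 else 0)"

definition Hsp :: "('k, nat \<Rightarrow> 'k) vspace" where
  "Hsp = \<lparr>carrier = {v. \<forall>m. m \<notin> (\<lambda>(l, i, k). code l i k) ` Idx \<longrightarrow> v m = 0}, scale = fscale\<rparr>"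

text \<open>Linear extension of \<open>T\<close> from the basis. The target is arbitrary because
  operators, actions, the counit and the test functionals are all made this way.\<close>

definition lext :: "('k, 'b::ab_group_add, 'm) vspace_scheme \<Rightarrow> (nat \<Rightarrow> nat \<Rightarrow> nat \<Rightarrow> 'b)
    \<Rightarrow> (nat \<Rightarrow> 'k) \<Rightarrow> 'b" where
  "lext M T v = (\<Sum>(l, i, k)\<in>Idx. scale M (v (code l i k)) (T l i k))"

lemma code_eq_iff [simp]: "code l i k = code l' i' k' \<longleftrightarrow> l = l' \<and> i = i' \<and> k = k'"
  by (simp add: code_def)

lemma finite_Idx [simp]: "finite Idx"
  by (simp add: Idx_def)

lemma n_pos [simp]: "n > 0" "0 < 2 * n"
  using n_gt_2 by auto

lemma scale_Hsp [simp]: "scale Hsp = fscale"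
  by (simp add: Hsp_def)

lemma vspace_Hsp: "vspace Hsp"
  by (auto simp: vspace_def fscale_vector_space Hsp_def fs.subspace_def fscale_def)

sublocale Hs: vspace Hsp
  by (rule vspace_Hsp)

lemma bv_closed [simp]: "l < n \<Longrightarrow> k < n \<Longrightarrow> bv l i k \<in> carrier Hsp"
  by (auto simp: Hsp_def bv_def Idx_def image_iff)

lemma bv_cong: "i mod (2 * n) = j mod (2 * n) \<Longrightarrow> bv l i k = bv l j k"
  by (simp add: bv_def)

text \<open>The exponent \<open>-1\<close> of \<open>K\<close>.\<close>

definition m1 :: nat where "m1 = 2 * n - 1"

lemma bv_mod [simp]: "bv l (i mod (2 * n)) k = bv l i k" "bv l (i mod (2 * n) + j) k = bv l (i + j) k"
    "bv l (Suc (i mod (2 * n))) k = bv l (Suc i) k"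
  by (rule bv_cong, simp add: mod_simps)+

lemma bv_wrap [simp]: "bv l (i + n + n) k = bv l i k" "bv l (i + 2 * n) k = bv l i k"
  "bv l (Suc (i + m1)) k = bv l i k"
proof -
  have "Suc (i + m1) = i + 2 * n" using n_gt_2 by (simp add: m1_def)
  then show "bv l (Suc (i + m1)) k = bv l i k" by (metis bv_cong mod_add_self2)
qed (rule bv_cong, simp add: add.assoc flip: mult_2)+

lemma bv_at_code: "i < 2 * n \<Longrightarrow> bv l j k (code l' i k') = (if l = l' \<and> j mod (2 * n) = i \<and> k = k' then 1 else 0)"
  by (auto simp: bv_def)

lemma lext_bv:
  assumes "vspace M" "l < n" "k < n"
  shows "lext M T (bv l i k) = T l (i mod (2 * n)) k"
proof -
  interpret M: vspace M by fact
  let ?x = "(l, i mod (2 * n), k)"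
  have "lext M T (bv l i k) = (\<Sum>x\<in>Idx. if x = ?x then (case x of (l, i, k) \<Rightarrow> T l i k) else 0)"
    unfolding lext_def
    by (rule sum.cong) (auto simp: bv_def split: if_splits)
  also have "\<dots> = T l (i mod (2 * n)) k"
    using assms by (simp add: sum.delta Idx_def)
  finally show ?thesis .
qed

lemma linear_on_lext:
  assumes "vspace M" "\<And>l i k. l < n \<Longrightarrow> i < 2 * n \<Longrightarrow> k < n \<Longrightarrow> T l i k \<in> carrier M"
  shows "linear_on Hsp M (lext M T)"
proof -
  interpret M: vspace M by fact
  show ?thesis
  proof (rule linear_onI)
    show "lext M T v \<in> carrier M" for v
      unfolding lext_def by (rule M.sum_closed) (auto simp: Idx_def assms)
    show "lext M T (v + w) = lext M T v + lext M T w" for v w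
      by (simp add: lext_def M.vs.scale_left_distrib case_prod_unfold sum.distrib)
    show "lext M T (scale Hsp a v) = scale M a (lext M T v)" for a v
      by (simp add: lext_def M.vs.scale_sum_right case_prod_unfold fscale_def)
  qed
qed

lemma Hsp_expand:
  assumes "v \<in> carrier Hsp"
  shows "v = (\<Sum>(l, i, k)\<in>Idx. fscale (v (code l i k)) (bv l i k))"
proof
  fix m
  have app: "(\<Sum>x\<in>A. g x) m = (\<Sum>x\<in>A. g x m)" for A and g :: "_ \<Rightarrow> nat \<Rightarrow> 'k"
    by (induction A rule: infinite_finite_induct) auto
  have "(\<Sum>(l, i, k)\<in>Idx. fscale (v (code l i k)) (bv l i k)) m
      = (\<Sum>x\<in>Idx. if m = (case x of (l, i, k) \<Rightarrow> code l i k) then v m else 0)"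
    unfolding app by (rule sum.cong) (auto simp: fscale_def bv_def Idx_def)
  also have "\<dots> = v m"
  proof (cases "m \<in> (\<lambda>(l, i, k). code l i k) ` Idx")
    case True
    then obtain l i k where x: "(l, i, k) \<in> Idx" "m = code l i k" by auto
    have "(\<Sum>x\<in>Idx. if m = (case x of (l, i, k) \<Rightarrow> code l i k) then v m else 0)
        = (\<Sum>x\<in>Idx. if x = (l, i, k) then v m else 0)"
      by (rule sum.cong) (auto simp: x)
    then show ?thesis using x by simp
  next
    case False
    then have "v m = 0" using assms by (simp add: Hsp_def)
    then show ?thesis by (simp only: if_cancel sum.neutral_const)
  qed
  finally show "v m = (\<Sum>(l, i, k)\<in>Idx. fscale (v (code l i k)) (bv l i k)) m" ..
qed

lemma Hsp_induct [consumes 1, case_names zero add basis]: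
  assumes "v \<in> carrier Hsp" "P 0"
    and "\<And>v w. v \<in> carrier Hsp \<Longrightarrow> w \<in> carrier Hsp \<Longrightarrow> P v \<Longrightarrow> P w \<Longrightarrow> P (v + w)"
    and "\<And>a l i k. l < n \<Longrightarrow> i < 2 * n \<Longrightarrow> k < n \<Longrightarrow> P (fscale a (bv l i k))"
  shows "P v"
proof -
  have "(\<Sum>(l, i, k)\<in>A. fscale (v (code l i k)) (bv l i k)) \<in> carrier Hsp \<and>
      P (\<Sum>(l, i, k)\<in>A. fscale (v (code l i k)) (bv l i k))" if "A \<subseteq> Idx" for A
    using finite_subset[OF that finite_Idx] that
  proof (induction A rule: finite_induct)
    case empty
    show ?case using assms(2) Hs.zero_closed by (simp only: sum.empty)
  next
    case (insert x A)
    obtain l i k where x: "x = (l, i, k)" by (cases x)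
    then have "l < n" "i < 2 * n" "k < n" using insert.prems by (auto simp: Idx_def)
    then show ?case
      using insert assms(3,4) Hs.scale_closed[OF bv_closed, of l k] Hs.add_closed
      by (simp add: x del: plus_fun_apply)
  qed
  from this[OF order.refl] show ?thesis
    using Hsp_expand[OF assms(1)] by simp
qed

lemma Hsp_linear_eq:
  assumes "linear_on Hsp M f" "linear_on Hsp M g"
    and "\<And>l i k. l < n \<Longrightarrow> i < 2 * n \<Longrightarrow> k < n \<Longrightarrow> f (bv l i k) = g (bv l i k)"
    and "v \<in> carrier Hsp"
  shows "f v = g v"
  using assms(4)
proof (induction rule: Hsp_induct)
  case zero
  show ?case using linear_on_0[OF vspace_Hsp assms(1)] linear_on_0[OF vspace_Hsp assms(2)] by (simp only:)
next
  case (add v w)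
  then show ?case by (simp only: linear_on_plus[OF assms(1)] linear_on_plus[OF assms(2)])
next
  case (basis a l i k)
  then show ?case
    using linear_on_smult[OF assms(1) bv_closed[of l k i], of a]
      linear_on_smult[OF assms(2) bv_closed[of l k i], of a] assms(3)
    by simp
qed

section \<open>Left multiplication by the generators on the prescribed basis\<close>

definition opK :: "(nat \<Rightarrow> 'k) \<Rightarrow> nat \<Rightarrow> 'k" where
  "opK = lext Hsp (\<lambda>l i k. fscale (p ^ l) (bv l (Suc i) k))"

text \<open>As \<open>F\<close> stands leftmost in a basis vector, nothing is reordered; only the
  top exponent wraps around, through \<open>F^n = 1 - K^n\<close>.\<close>

definition opF :: "(nat \<Rightarrow> 'k) \<Rightarrow> nat \<Rightarrow> 'k" where
  "opF = lext Hsp (\<lambda>l i k. if Suc l < n then bv (Suc l) i k else bv 0 i k - bv 0 (i + n) k)"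

text \<open>The terms after the first come from
  \<open>E F\<^sup>l = F\<^sup>l E + c F\<^sup>l\<^sup>-\<^sup>1 (ap l K - aq l K\<^sup>-\<^sup>1)\<close>.\<close>

definition opE :: "(nat \<Rightarrow> 'k) \<Rightarrow> nat \<Rightarrow> 'k" where
  "opE = lext Hsp (\<lambda>l i k.
     fscale (p ^ i) (if Suc k < n then bv l i (Suc k) else bv l (i + n) 0 - bv l i 0)
     + fscale (c * ap l) (bv (l - 1) (Suc i) k) - fscale (c * aq l) (bv (l - 1) (i + m1) k))"

lemma linear_ops: "linear_on Hsp Hsp opK" "linear_on Hsp Hsp opE" "linear_on Hsp Hsp opF"
  unfolding opK_def opE_def opF_def
  by (intro linear_on_lext vspace_Hsp;
      auto intro!: Hs.add_closed Hs.diff_closed Hs.scale_closed[unfolded scale_Hsp])+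

lemmas ops_closed [simp] = linear_ops[THEN linear_on_closed] linear_ops[THEN linear_on_funpow, THEN linear_on_closed]

lemmas ops_linear = linear_ops[THEN linear_on_plus] linear_ops[THEN linear_on_smult, unfolded scale_Hsp]
  linear_ops[THEN linear_on_minus[OF vspace_Hsp]]

lemma p_pow_mod [simp]: "p ^ (i mod (2 * n)) = p ^ i"
proof -
  have "p ^ i = p ^ (2 * n * (i div (2 * n)) + i mod (2 * n))" by simp
  also have "\<dots> = (p ^ n) ^ (2 * (i div (2 * n))) * p ^ (i mod (2 * n))"
    by (simp only: power_add power_mult[symmetric] mult_ac)
  finally show ?thesis by simp
qed

lemma ops_bv:
  assumes "l < n" "k < n"
  shows opK_bv: "opK (bv l i k) = fscale (p ^ l) (bv l (Suc i) k)"
    and opF_bv: "opF (bv l i k) = (if Suc l < n then bv (Suc l) i k else bv 0 i k - bv 0 (i + n) k)"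
    and opE_bv: "opE (bv l i k) =
     fscale (p ^ i) (if Suc k < n then bv l i (Suc k) else bv l (i + n) 0 - bv l i 0)
     + fscale (c * ap l) (bv (l - 1) (Suc i) k) - fscale (c * aq l) (bv (l - 1) (i + m1) k)"
  using assms by (simp_all add: opK_def opF_def opE_def lext_bv vspace_Hsp)

lemma opK_pow_bv: "l < n \<Longrightarrow> k < n \<Longrightarrow> (opK ^^ j) (bv l i k) = fscale (p ^ (l * j)) (bv l (i + j) k)"
proof (induction j)
  case (Suc j)
  then show ?case by (simp add: ops_linear opK_bv power_add mult_ac)
qed simp

lemma opF_pow_bv: "l + j < n \<Longrightarrow> k < n \<Longrightarrow> (opF ^^ j) (bv l i k) = bv (l + j) i k"
  by (induction j) (simp_all add: opF_bv)

lemma opE_pow_bv0: "k + j < n \<Longrightarrow> (opE ^^ j) (bv 0 i k) = fscale (p ^ (i * j)) (bv 0 i (k + j))"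
  by (induction j) (simp_all add: opE_bv ops_linear power_add mult_ac)

lemma p_pow_2n: "p ^ (2 * n) = 1" "p ^ m1 = q"
proof -
  show *: "p ^ (2 * n) = 1" by (metis p_pow mult.commute power_mult power_one)
  have "2 * n = Suc m1" using n_gt_2 by (simp add: m1_def)
  then have "p * p ^ m1 = 1" using * by (metis power_Suc)
  then show "p ^ m1 = q" by (metis pq(4) mult.right_neutral)
qed

lemma opKi_bv: "l < n \<Longrightarrow> k < n \<Longrightarrow> (opK ^^ m1) (bv l i k) = fscale (q ^ l) (bv l (i + m1) k)"
  using p_pow_2n(2) by (simp add: opK_pow_bv mult.commute[of l] power_mult)

lemma opF_pow_n:
  assumes "v \<in> carrier Hsp"
  shows "(opF ^^ n) v = v - (opK ^^ n) v"
proof (rule Hsp_linear_eq[where f = "opF ^^ n" and g = "\<lambda>v. v - (opK ^^ n) v", OF _ _ _ assms])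
  show "linear_on Hsp Hsp (opF ^^ n)" "linear_on Hsp Hsp (\<lambda>v. v - (opK ^^ n) v)"
    by (intro linear_on_diff linear_on_funpow linear_ops linear_on_id vspace_Hsp)+
  fix l i k assume *: "l < n" "k < n"
  \<comment> \<open>The exponent \<open>n - 1\<close> is reached after \<open>n - 1 - l\<close>
    steps, one more step wraps around, and the other \<open>l\<close> steps restore
    \<open>F^l\<close>.\<close>
  have "(opF ^^ n) (bv l i k) = (opF ^^ l) ((opF ^^ Suc (n - 1 - l)) (bv l i k))"
    using * by (simp flip: funpow_add comp_apply[of "opF ^^ l"] del: funpow.simps)
  also have "\<dots> = (opF ^^ l) (bv 0 i k - bv 0 (i + n) k)"
    using * by (simp add: opF_pow_bv opF_bv)
  also have "\<dots> = bv l i k - bv l (i + n) k"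
    using * linear_on_minus[OF vspace_Hsp linear_on_funpow[OF linear_ops(3)]] by (simp add: opF_pow_bv)
  also have "\<dots> = bv l i k - (opK ^^ n) (bv l i k)"
    using * by (simp add: opK_pow_bv mult.commute[of l] power_mult)
  finally show "(opF ^^ n) (bv l i k) = bv l i k - (opK ^^ n) (bv l i k)" .
qed

lemma ops_KE: "v \<in> carrier Hsp \<Longrightarrow> opK (opE v) = fscale q (opE (opK v))"
proof (rule Hsp_linear_eq[where M = Hsp and f = "\<lambda>v. opK (opE v)" and g = "\<lambda>v. fscale q (opE (opK v))"])
  show "linear_on Hsp Hsp (\<lambda>v. opK (opE v))"
    by (rule linear_on_comp[OF linear_ops(2,1)])
  show "linear_on Hsp Hsp (\<lambda>v. fscale q (opE (opK v)))"
    using linear_on_scale[OF vspace_Hsp linear_on_comp[OF linear_ops(1,2)]] by simp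
  fix l i k assume "l < n" "k < n"
  then show "opK (opE (bv l i k)) = fscale q (opE (opK (bv l i k)))"
    using n_gt_2
    by (cases l) (simp_all add: opE_bv opK_bv ops_linear fs.scale_right_distrib fs.scale_right_diff_distrib
        mult_ac Hs.scale_closed[unfolded scale_Hsp])
qed

lemma ops_KF: "v \<in> carrier Hsp \<Longrightarrow> opK (opF v) = fscale p (opF (opK v))"
proof (rule Hsp_linear_eq[where M = Hsp and f = "\<lambda>v. opK (opF v)" and g = "\<lambda>v. fscale p (opF (opK v))"])
  show "linear_on Hsp Hsp (\<lambda>v. opK (opF v))"
    by (rule linear_on_comp[OF linear_ops(3,1)])
  show "linear_on Hsp Hsp (\<lambda>v. fscale p (opF (opK v)))"
    using linear_on_scale[OF vspace_Hsp linear_on_comp[OF linear_ops(1,3)]] by simp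
  fix l i k assume lk: "l < n" "k < n"
  have "p * p ^ l = 1" if "\<not> Suc l < n"
    using that lk p_pow by (metis Suc_lessI power_Suc)
  with lk show "opK (opF (bv l i k)) = fscale p (opF (opK (bv l i k)))"
    by (simp add: opF_bv opK_bv ops_linear fs.scale_right_distrib fs.scale_right_diff_distrib)
qed

text \<open>Below the wrap-around the recursions of \<open>ap\<close> and \<open>aq\<close> produce
  the commutator. At \<open>l = n - 1\<close> the term \<open>E F\<close> has wrapped around and has
  no correction terms left, so those of \<open>F E\<close> must give the whole commutator; their
  coefficients are right because \<open>ap n = aq n = 0\<close>.\<close>

lemma ops_EF: "v \<in> carrier Hsp \<Longrightarrow> opE (opF v) - opF (opE v) = fscale c (opK v - (opK ^^ m1) v)"
proof (rule Hsp_linear_eq[where M = Hsp and f = "\<lambda>v. opE (opF v) - opF (opE v)" and g = "\<lambda>v. fscale c (opK v - (opK ^^ m1) v)"])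
  show "linear_on Hsp Hsp (\<lambda>v. opE (opF v) - opF (opE v))"
    by (intro linear_on_diff vspace_Hsp linear_on_comp[OF linear_ops(3,2)] linear_on_comp[OF linear_ops(2,3)])
  have "linear_on Hsp Hsp (\<lambda>v. scale Hsp c (opK v - (opK ^^ m1) v))"
    by (intro linear_on_scale linear_on_diff vspace_Hsp linear_ops linear_on_funpow)
  then show "linear_on Hsp Hsp (\<lambda>v. fscale c (opK v - (opK ^^ m1) v))"
    by simp
  fix l i k assume lk: "l < n" "k < n"
  \<comment> \<open>\<open>X l i\<close> stands for \<open>F^l K^i E^(k+1)\<close>, wrapped around
    or not. \<open>F\<close> shifts it like a basis vector, so the case distinction on
    \<open>k\<close> disappears.\<close>
  define X where "X = (\<lambda>l i. if Suc k < n then bv l i (Suc k) else bv l (i + n) 0 - bv l i 0)"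
  have X [simp]: "X l i \<in> carrier Hsp" if "l < n" for l i
    using that by (simp add: X_def)
  have opF_X: "opF (X l i) = (if Suc l < n then X (Suc l) i else X 0 i - X 0 (i + n))" if "l < n" for l i
    using that by (simp add: X_def ops_linear opF_bv)
  have E: "opE (bv l i k) = fscale (p ^ i) (X l i)
      + fscale (c * ap l) (bv (l - 1) (Suc i) k) - fscale (c * aq l) (bv (l - 1) (i + m1) k)" if "l < n" for l i
    using that lk by (simp add: opE_bv X_def)
  note lin = ops_linear Hs.scale_closed[unfolded scale_Hsp]
  show "opE (opF (bv l i k)) - opF (opE (bv l i k))
      = fscale c (opK (bv l i k) - (opK ^^ m1) (bv l i k))"
  proof (cases "Suc l < n")
    case True
    then show ?thesis
      using lk by (cases l) (simp_all add: opKi_bv opK_bv opF_bv E lin opF_X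
        ap_aq_Suc distrib_left fs.scale_left_distrib fs.scale_right_diff_distrib algebra_simps)
  next
    case False
    then have n: "n = Suc l" using lk n_gt_2 by auto
    obtain l' where l: "l = Suc l'" using n n_gt_2 by (cases l) auto
    have ap: "ap l = - (p ^ l)" "aq l = - (q ^ l)"
      using ap_aq_Suc[of l] ap_aq_n n by (simp_all add: eq_neg_iff_add_eq_0)
    have pn: "p ^ (i + n) = p ^ i" by (simp add: power_add)
    have "opE (opF (bv l i k)) = fscale (p ^ i) (X 0 i - X 0 (i + n))"
      using lk False by (simp add: opF_bv lin E pn fs.scale_right_diff_distrib)
    moreover have "opF (opE (bv l i k)) = fscale (p ^ i) (X 0 i - X 0 (i + n))
        + fscale (c * ap l) (bv l (Suc i) k) - fscale (c * aq l) (bv l (i + m1) k)"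
      using lk l False by (simp add: E lin opF_X opF_bv)
    moreover have "fscale c (opK (bv l i k) - (opK ^^ m1) (bv l i k))
        = fscale (c * p ^ l) (bv l (Suc i) k) - fscale (c * q ^ l) (bv l (i + m1) k)"
      using lk by (simp add: opK_bv opKi_bv fs.scale_right_diff_distrib)
    ultimately show ?thesis
      by (simp add: ap)
  qed
qed

lemma ops_K_order: "v \<in> carrier Hsp \<Longrightarrow> (opK ^^ (2 * n)) v = v"
proof (rule Hsp_linear_eq[where M = Hsp and f = "opK ^^ (2 * n)" and g = "\<lambda>v. v"])
  show "linear_on Hsp Hsp (opK ^^ (2 * n))" "linear_on Hsp Hsp (\<lambda>v. v)"
    by (intro linear_on_funpow linear_ops linear_on_id)+
  have "p ^ (l * (2 * n)) = 1" for l
    using p_pow_2n(1) by (metis mult.commute power_mult power_one)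
  then show "(opK ^^ (2 * n)) (bv l i k) = bv l i k" if "l < n" "k < n" for l i k
    using that by (simp add: opK_pow_bv)
qed

sublocale H: qmod_weak n q c Hsp opK opE opF
  by unfold_locales
    (use linear_ops ops_KE ops_KF ops_EF[unfolded m1_def] ops_K_order in \<open>simp_all del: One_nat_def\<close>)

lemma bv_pow: "l < n \<Longrightarrow> k < n \<Longrightarrow> bv l i k = (opF ^^ l) ((opK ^^ i) ((opE ^^ k) (bv 0 0 0)))"
  using opE_pow_bv0[of 0 k 0] opK_pow_bv[of 0 k i 0] opF_pow_bv[of 0 l k i] by simp

text \<open>The power \<open>E\<^sup>n\<close> commutes with \<open>F\<close> and \<open>K\<close>, so it is enough to know it on the powers of \<open>E\<close>.\<close>

lemma opE_pow_n:
  assumes "v \<in> carrier Hsp"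
  shows "(opE ^^ n) v = (opK ^^ n) v - v"
proof (rule Hsp_linear_eq[where f = "opE ^^ n" and g = "\<lambda>v. (opK ^^ n) v - v", OF _ _ _ assms])
  show "linear_on Hsp Hsp (opE ^^ n)" "linear_on Hsp Hsp (\<lambda>v. (opK ^^ n) v - v)"
    by (intro linear_on_diff linear_on_funpow linear_ops linear_on_id vspace_Hsp)+
  fix l i k assume *: "l < n" "k < n"
  let ?u = "bv 0 0 k"
  have "(opE ^^ n) ?u = (opE ^^ k) ((opE ^^ Suc (n - 1 - k)) ?u)"
    using * by (simp flip: funpow_add comp_apply[of "opE ^^ k"] del: funpow.simps)
  also have "\<dots> = (opE ^^ k) (bv 0 n 0 - bv 0 0 0)"
    using * by (simp add: opE_pow_bv0 opE_bv)
  also have "\<dots> = bv 0 n k - bv 0 0 k"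
    using * linear_on_minus[OF vspace_Hsp linear_on_funpow[OF linear_ops(2)]] by (simp add: opE_pow_bv0 power_mult)
  finally have base: "(opE ^^ n) ?u = bv 0 n k - bv 0 0 k" .
  have Fl: "(opE ^^ n) ((opF ^^ l) w) = (opF ^^ l) ((opE ^^ n) w)" if "w \<in> carrier Hsp" for w
    using that by (induction l) (simp_all add: H.Epow_n_F)
  have nK: "(opE ^^ n) (opK w) = opK ((opE ^^ n) w)" if "w \<in> carrier Hsp" for w
    using that by (simp add: H.K_Epow)
  have Ki: "(opE ^^ n) ((opK ^^ i) w) = (opK ^^ i) ((opE ^^ n) w)" if "w \<in> carrier Hsp" for w
    using that by (induction i) (simp_all add: nK)
  have "bv l i k = (opF ^^ l) ((opK ^^ i) ?u)"
    using * opK_pow_bv[of 0 k i 0] opF_pow_bv[of 0 l k i] by simp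
  then have "(opE ^^ n) (bv l i k) = (opF ^^ l) ((opK ^^ i) (bv 0 n k - bv 0 0 k))"
    using * by (simp add: Fl Ki base)
  also have "\<dots> = bv l (i + n) k - bv l i k"
    using * H.lin_pow[THEN linear_on_minus[OF vspace_Hsp]] by (simp add: opK_pow_bv opF_pow_bv add.commute)
  also have "\<dots> = (opK ^^ n) (bv l i k) - bv l i k"
    using * by (simp add: opK_pow_bv mult.commute[of l] power_mult)
  finally show "(opE ^^ n) (bv l i k) = (opK ^^ n) (bv l i k) - bv l i k" .
qed

sublocale H: qmod n q c Hsp opK opE opF
  by unfold_locales (use opE_pow_n opF_pow_n in auto)

text \<open>A basis vector is \<open>F^l K^i E^k\<close> applied to 1, so a subspace that contains 1
  and is stable under left multiplication by the generators is everything. This is the induction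
  principle for nearly all Hopf identities.\<close>

lemma Hsp_generated [consumes 1, case_names one K E F linear]:
  assumes "v \<in> carrier Hsp"
    and "P (bv 0 0 0)"
    and "\<And>v. v \<in> carrier Hsp \<Longrightarrow> P v \<Longrightarrow> P (opK v)"
    and "\<And>v. v \<in> carrier Hsp \<Longrightarrow> P v \<Longrightarrow> P (opE v)"
    and "\<And>v. v \<in> carrier Hsp \<Longrightarrow> P v \<Longrightarrow> P (opF v)"
    and lin: "\<And>a v w. v \<in> carrier Hsp \<Longrightarrow> w \<in> carrier Hsp \<Longrightarrow> P v \<Longrightarrow> P w \<Longrightarrow> P (fscale a v + w)"
  shows "P v"
proof -
  have E: "P ((opE ^^ k) (bv 0 0 0))" for k by (induction k) (auto intro: assms)
  have K: "P ((opK ^^ i) ((opE ^^ k) (bv 0 0 0)))" for i k by (induction i) (auto intro: assms E)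
  have F: "P ((opF ^^ l) ((opK ^^ i) ((opE ^^ k) (bv 0 0 0))))" for l i k by (induction l) (auto intro: assms K)
  have B: "P (bv l i k)" if "l < n" "k < n" for l i k
    using F bv_pow[OF that] by simp
  \<comment> \<open>Zero is the combination \<open>(-1) * v + v\<close> with \<open>v\<close> the
    unit.\<close>
  have zero: "P 0"
    using lin[OF bv_closed bv_closed B B, of 0 0 0 0 "- 1" 0 0] by (simp del: zero_fun_apply)
  show ?thesis
    using assms(1)
  proof (induction rule: Hsp_induct)
    case zero
    show ?case by fact
  next
    case (add v w)
    then show ?case using lin[of v w 1] by (simp only: fs.scale_one)
  next
    case (basis a l i k)
    then show ?case using lin[OF bv_closed Hs.zero_closed B zero, of l k a] by (simp only: add_0_right)
  qed
qed

end

section \<open>The universal property of the algebra\<close>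

context qmod
begin

text \<open>
  One formula gives the multiplication of the algebra (\<open>M\<close> the algebra itself), the
  comultiplication (\<open>M\<close> its tensor square) and the antipode (\<open>M\<close> the algebra with the operators
  of right multiplication).
\<close>

definition act :: "(nat \<Rightarrow> 'k) \<Rightarrow> 'b \<Rightarrow> 'b" where
  "act v u = lext M (\<lambda>l i k. (F ^^ l) ((K ^^ i) ((E ^^ k) u))) v"

lemma linear_on_act_left: "u \<in> carrier M \<Longrightarrow> linear_on Hsp M (\<lambda>v. act v u)"
  unfolding act_def by (intro linear_on_lext vspace_M) simp

lemma linear_on_act_right: "linear_on M M (act v)"
  unfolding act_def lext_def case_prod_unfold
  by (intro linear_on_sum_fun vspace_M linear_on_scale linear_on_comp[OF linear_on_comp[OF lin_pow(3) lin_pow(2)] lin_pow(4)])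

lemma act_closed [simp]: "u \<in> carrier M \<Longrightarrow> act v u \<in> carrier M"
  by (rule linear_on_closed[OF linear_on_act_right])

lemma act_bv: "l < n \<Longrightarrow> k < n \<Longrightarrow> u \<in> carrier M \<Longrightarrow> act (bv l i k) u = (F ^^ l) ((K ^^ i) ((E ^^ k) u))"
  by (simp add: act_def lext_bv[OF vspace_M] K_mod)

lemmas act_linear = linear_on_act_left[THEN linear_on_plus] linear_on_act_left[THEN linear_on_smult, unfolded scale_Hsp]
  linear_on_act_left[THEN linear_on_minus[OF vspace_Hsp]]

lemma act_one [simp]: "u \<in> carrier M \<Longrightarrow> act (bv 0 0 0) u = u"
  using act_bv[of 0 0 u 0] by simp

text \<open>Together with \<open>act_opF\<close> and \<open>act_opE\<close> this says that
  \<open>v \<mapsto> act v u\<close> turns left multiplication by the generators into the operators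
  of \<open>M\<close>. As it sends 1 to \<open>u\<close>, it is the module map that the relations
  promise.\<close>

lemma act_opK:
  assumes "u \<in> carrier M" "v \<in> carrier Hsp"
  shows "act (opK v) u = K (act v u)"
proof (rule Hsp_linear_eq[where f = "\<lambda>v. act (opK v) u" and g = "\<lambda>v. K (act v u)", OF _ _ _ assms(2)])
  show "linear_on Hsp M (\<lambda>v. act (opK v) u)" "linear_on Hsp M (\<lambda>v. K (act v u))"
    by (intro linear_on_comp[OF linear_ops(1) linear_on_act_left] linear_on_comp[OF linear_on_act_left lin_K] assms)+
  show "act (opK (bv l i k)) u = K (act (bv l i k) u)" if "l < n" "k < n" for l i k
    using that assms by (simp add: opK_bv act_linear act_bv K_Fpow)
qed

lemma act_opF:
  assumes "u \<in> carrier M" "v \<in> carrier Hsp"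
  shows "act (opF v) u = F (act v u)"
proof (rule Hsp_linear_eq[where f = "\<lambda>v. act (opF v) u" and g = "\<lambda>v. F (act v u)", OF _ _ _ assms(2)])
  show "linear_on Hsp M (\<lambda>v. act (opF v) u)" "linear_on Hsp M (\<lambda>v. F (act v u))"
    by (intro linear_on_comp[OF linear_ops(3) linear_on_act_left] linear_on_comp[OF linear_on_act_left lin_F] assms)+
  fix l i k assume lk: "l < n" "k < n"
  show "act (opF (bv l i k)) u = F (act (bv l i k) u)"
  proof (cases "Suc l < n")
    case True
    then show ?thesis using lk assms by (simp add: opF_bv act_bv)
  next
    case False
    then have n: "n = Suc l" using lk by simp
    have "F (act (bv l i k) u) = (F ^^ Suc l) ((K ^^ i) ((E ^^ k) u))"
      using lk assms by (simp add: act_bv)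
    also have "\<dots> = (F ^^ n) ((K ^^ i) ((E ^^ k) u))"
      by (simp only: n)
    also have "\<dots> = (K ^^ i) ((E ^^ k) u) - (K ^^ (n + i)) ((E ^^ k) u)"
      using assms by (simp add: F_pow funpow_add)
    finally show ?thesis
      using lk assms False by (simp add: opF_bv act_bv act_linear add.commute)
  qed
qed

lemma act_opE:
  assumes "u \<in> carrier M" "v \<in> carrier Hsp"
  shows "act (opE v) u = E (act v u)"
proof (rule Hsp_linear_eq[where f = "\<lambda>v. act (opE v) u" and g = "\<lambda>v. E (act v u)", OF _ _ _ assms(2)])
  show "linear_on Hsp M (\<lambda>v. act (opE v) u)" "linear_on Hsp M (\<lambda>v. E (act v u))"
    by (intro linear_on_comp[OF linear_ops(2) linear_on_act_left] linear_on_comp[OF linear_on_act_left lin_E] assms)+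
  fix l i k assume lk: "l < n" "k < n"
  let ?X = "if Suc k < n then bv l i (Suc k) else bv l (i + n) 0 - bv l i 0"
  let ?w = "(K ^^ i) ((E ^^ k) u)"
  have X: "act ?X u = (F ^^ l) ((K ^^ i) ((E ^^ Suc k) u))"
  proof (cases "Suc k < n")
    case True
    then show ?thesis using lk assms by (simp add: act_bv del: funpow.simps)
  next
    case False
    then have "Suc k = n" using lk by simp
    then have "(K ^^ i) ((E ^^ Suc k) u) = (K ^^ (i + n)) u - (K ^^ i) u"
      using assms by (simp add: E_pow funpow_add op_linear del: funpow.simps)
    then show ?thesis
      using lk assms False by (simp add: act_bv act_linear op_linear del: funpow.simps)
  qed
  have Ki: "(K ^^ (i + m1)) ((E ^^ k) u) = Ki ?w"
    unfolding Ki_def m1_def by (metis add.commute comp_apply funpow_add)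
  have "E (act (bv l i k) u) = (F ^^ l) (E ?w)
    + scale M (c * ap l) ((F ^^ (l - 1)) (K ?w)) - scale M (c * aq l) ((F ^^ (l - 1)) (Ki ?w))"
    using lk assms by (simp add: act_bv E_Fpow)
  also have "(F ^^ l) (E ?w) = scale M (p ^ i) (act ?X u)"
    unfolding X using assms by (simp add: E_Kpow op_linear)
  finally show "act (opE (bv l i k)) u = E (act (bv l i k) u)"
    unfolding opE_bv[OF lk] Ki[symmetric]
    using lk assms by (simp add: act_linear act_bv Hs.scale_closed[unfolded scale_Hsp])
qed

lemma act_opK_pow:
  assumes "u \<in> carrier M" "v \<in> carrier Hsp"
  shows "act ((opK ^^ j) v) u = (K ^^ j) (act v u)"
  by (induction j) (simp_all add: act_opK assms)

lemma act_opKi: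
  assumes "u \<in> carrier M" "v \<in> carrier Hsp"
  shows "act (H.Ki v) u = Ki (act v u)"
  unfolding Ki_def H.Ki_def by (rule act_opK_pow[OF assms])

end

section \<open>Product, coproduct and counit\<close>

context qparam
begin

abbreviation mul :: "(nat \<Rightarrow> 'k) \<Rightarrow> (nat \<Rightarrow> 'k) \<Rightarrow> nat \<Rightarrow> 'k" where
  "mul \<equiv> H.act"

abbreviation one :: "nat \<Rightarrow> 'k" where
  "one \<equiv> bv 0 0 0"

lemma one_closed [simp]: "one \<in> carrier Hsp"
  by simp

lemma bilinear_mul: "bilinear_on Hsp Hsp Hsp mul"
  by (intro bilinear_onI H.linear_on_act_left H.linear_on_act_right)

lemma mul_one_right [simp]: "v \<in> carrier Hsp \<Longrightarrow> mul v one = v"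
proof (induction rule: Hsp_generated)
  case (linear a v w)
  then show ?case
    by (simp add: H.act_linear Hs.scale_closed[unfolded scale_Hsp] del: plus_fun_apply)
qed (simp_all add: H.act_opK H.act_opE H.act_opF)

text \<open>Induction on the left factor alone: \<open>mul\<close> is the action of the algebra on
  itself, so a generator in front of \<open>v\<close> can be pulled out on both sides.\<close>

lemma mul_assoc:
  assumes "v \<in> carrier Hsp" "w \<in> carrier Hsp" "u \<in> carrier Hsp"
  shows "mul (mul v w) u = mul v (mul w u)"
  using assms(1)
proof (induction rule: Hsp_generated)
  case (linear a v w)
  then show ?case using assms
    by (simp add: H.act_linear Hs.scale_closed[unfolded scale_Hsp] del: plus_fun_apply)
qed (simp_all add: H.act_opK H.act_opE H.act_opF assms)

abbreviation HH where "HH \<equiv> Hsp \<otimes> Hsp"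
abbreviation tm where "tm \<equiv> tensor_map Hsp Hsp Hsp Hsp"
abbreviation pu where "pu \<equiv> pure Hsp Hsp"

text \<open>These three are left multiplication by the intended coproducts of \<open>K\<close>,
  \<open>E\<close> and \<open>F\<close> on the tensor square; \<open>H.Ki\<close> is left
  multiplication by the inverse of \<open>K\<close>.\<close>

definition KK where "KK = tm opK opK"
definition EE where "EE = (\<lambda>t. tm opE (\<lambda>x. x) t + tm opK opE t)"
definition FF where "FF = (\<lambda>t. tm opF H.Ki t + tm (\<lambda>x. x) opF t)"

lemma vspace_HH: "vspace HH"
  by (rule vspace_tensor_product)

sublocale HH: vspace HH
  by (rule vspace_HH)

lemma linear_tm: "linear_on Hsp Hsp f \<Longrightarrow> linear_on Hsp Hsp g \<Longrightarrow> linear_on HH HH (tm f g)"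
  by (rule linear_on_tensor_map[OF vspace_Hsp vspace_Hsp vspace_Hsp vspace_Hsp])

lemma linear_KK: "linear_on HH HH KK" and linear_EE: "linear_on HH HH EE" and linear_FF: "linear_on HH HH FF"
  unfolding KK_def EE_def FF_def
  by (intro linear_on_add linear_tm linear_ops linear_on_id vspace_HH H.lin_pow)+

lemma pu_closed [simp]: "x \<in> carrier Hsp \<Longrightarrow> y \<in> carrier Hsp \<Longrightarrow> pu x y \<in> carrier HH"
  by (rule pure_closed)

lemma pu_linear:
  assumes "x \<in> carrier Hsp" "y \<in> carrier Hsp"
  shows "x' \<in> carrier Hsp \<Longrightarrow> pu (x + x') y = pu x y + pu x' y"
    and "y' \<in> carrier Hsp \<Longrightarrow> pu x (y + y') = pu x y + pu x y'"
    and "x' \<in> carrier Hsp \<Longrightarrow> pu (x - x') y = pu x y - pu x' y"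
    and "y' \<in> carrier Hsp \<Longrightarrow> pu x (y - y') = pu x y - pu x y'"
    and "pu (fscale a x) y = fscale a (pu x y)"
    and "pu x (fscale a y) = fscale a (pu x y)"
  using linear_on_pure_left[OF vspace_Hsp vspace_Hsp assms(2), THEN linear_on_plus, OF assms(1)]
    linear_on_pure_left[OF vspace_Hsp vspace_Hsp assms(2), THEN linear_on_smult, OF assms(1)]
    linear_on_pure_left[OF vspace_Hsp vspace_Hsp assms(2), THEN linear_on_minus[OF vspace_Hsp], OF assms(1)]
    linear_on_pure_right[OF vspace_Hsp vspace_Hsp assms(1), THEN linear_on_plus, OF assms(2)]
    linear_on_pure_right[OF vspace_Hsp vspace_Hsp assms(1), THEN linear_on_smult, OF assms(2)]
    linear_on_pure_right[OF vspace_Hsp vspace_Hsp assms(1), THEN linear_on_minus[OF vspace_Hsp], OF assms(2)]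
  by simp_all

lemma tm_pu:
  "linear_on Hsp Hsp f \<Longrightarrow> linear_on Hsp Hsp g \<Longrightarrow> x \<in> carrier Hsp \<Longrightarrow> y \<in> carrier Hsp \<Longrightarrow>
    tm f g (pu x y) = pu (f x) (g y)"
  by (rule tensor_map_pure[OF vspace_Hsp vspace_Hsp])

lemma tm_pow_pu:
  assumes "linear_on Hsp Hsp f" "linear_on Hsp Hsp g" "x \<in> carrier Hsp" "y \<in> carrier Hsp"
  shows "(tm f g ^^ j) (pu x y) = pu ((f ^^ j) x) ((g ^^ j) y)"
  by (induction j) (simp_all add: tm_pu assms linear_on_funpow[THEN linear_on_closed])

lemma lin_Ki: "linear_on Hsp Hsp H.Ki"
  by (rule H.lin_pow)

lemma KK_pu [simp]: "x \<in> carrier Hsp \<Longrightarrow> y \<in> carrier Hsp \<Longrightarrow> KK (pu x y) = pu (opK x) (opK y)"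
  by (simp add: KK_def tm_pu linear_ops)

lemma EE_pu [simp]: "x \<in> carrier Hsp \<Longrightarrow> y \<in> carrier Hsp \<Longrightarrow> EE (pu x y) = pu (opE x) y + pu (opK x) (opE y)"
  by (simp add: EE_def tm_pu linear_ops linear_on_id)

lemma FF_pu [simp]: "x \<in> carrier Hsp \<Longrightarrow> y \<in> carrier Hsp \<Longrightarrow> FF (pu x y) = pu (opF x) (H.Ki y) + pu x (opF y)"
  by (simp add: FF_def tm_pu linear_ops linear_on_id lin_Ki)

lemma KK_pow_pu: "x \<in> carrier Hsp \<Longrightarrow> y \<in> carrier Hsp \<Longrightarrow> (KK ^^ j) (pu x y) = pu ((opK ^^ j) x) ((opK ^^ j) y)"
  by (simp add: KK_def tm_pow_pu linear_ops)

lemmas HH_eq = linear_on_tensor_unique[OF vspace_Hsp vspace_Hsp]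

lemmas tops_linear = linear_KK[THEN linear_on_plus] linear_KK[THEN linear_on_smult, unfolded scale_tensor]
  linear_EE[THEN linear_on_plus] linear_EE[THEN linear_on_smult, unfolded scale_tensor]
  linear_FF[THEN linear_on_plus] linear_FF[THEN linear_on_smult, unfolded scale_tensor]

text \<open>As \<open>K\<close> has order \<open>2 * n\<close>, its power \<open>K^n\<close> is its
  own inverse.\<close>

lemma Ki_pow_n: "x \<in> carrier Hsp \<Longrightarrow> (H.Ki ^^ n) x = (opK ^^ n) x"
proof -
  assume x: "x \<in> carrier Hsp"
  have "(2 * n - 1) * n = n + 2 * n * (n - 1)"
    using n_gt_2 by (cases n) (simp_all add: algebra_simps)
  then have "((2 * n - 1) * n) mod (2 * n) = n mod (2 * n)"
    by (metis mod_mult_self2)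
  then have "(opK ^^ ((2 * n - 1) * n)) x = (opK ^^ n) x"
    by (metis H.K_mod x)
  then show ?thesis
    by (simp add: H.Ki_def funpow_mult mult.commute)
qed

lemma KK_EE: "t \<in> carrier HH \<Longrightarrow> KK (EE t) = fscale q (EE (KK t))"
proof (rule HH_eq[OF vspace_HH, where f = "\<lambda>t. KK (EE t)" and g = "\<lambda>t. fscale q (EE (KK t))"])
  show "linear_on HH HH (\<lambda>t. KK (EE t))"
    by (rule linear_on_comp[OF linear_EE linear_KK])
  show "linear_on HH HH (\<lambda>t. fscale q (EE (KK t)))"
    using linear_on_scale[OF vspace_HH linear_on_comp[OF linear_KK linear_EE]] by simp
  show "KK (EE (pu x y)) = fscale q (EE (KK (pu x y)))" if "x \<in> carrier Hsp" "y \<in> carrier Hsp" for x y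
    using that by (simp add: tops_linear pu_linear ops_KE fs.scale_right_distrib del: plus_fun_apply)
qed

lemma KK_FF: "t \<in> carrier HH \<Longrightarrow> KK (FF t) = fscale p (FF (KK t))"
proof (rule HH_eq[OF vspace_HH, where f = "\<lambda>t. KK (FF t)" and g = "\<lambda>t. fscale p (FF (KK t))"])
  show "linear_on HH HH (\<lambda>t. KK (FF t))"
    by (rule linear_on_comp[OF linear_FF linear_KK])
  show "linear_on HH HH (\<lambda>t. fscale p (FF (KK t)))"
    using linear_on_scale[OF vspace_HH linear_on_comp[OF linear_KK linear_FF]] by simp
  show "KK (FF (pu x y)) = fscale p (FF (KK (pu x y)))" if "x \<in> carrier Hsp" "y \<in> carrier Hsp" for x y
    using that by (simp add: tops_linear pu_linear ops_KF fs.scale_right_distrib del: plus_fun_apply)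
qed

text \<open>The mixed terms \<open>K F \<otimes> E K^-1\<close> and
  \<open>F K \<otimes> K^-1 E\<close> cancel, because the reordering factors \<open>p\<close> and
  \<open>q\<close> are inverse. The two remaining commutators,
  \<open>c (K - K^-1) \<otimes> K^-1\<close> and \<open>K \<otimes> c (K - K^-1)\<close>,
  telescope.\<close>

lemma EE_FF: "t \<in> carrier HH \<Longrightarrow> EE (FF t) - FF (EE t) = fscale c (KK t - (KK ^^ (2 * n - 1)) t)"
proof (rule HH_eq[OF vspace_HH, where f = "\<lambda>t. EE (FF t) - FF (EE t)"
      and g = "\<lambda>t. fscale c (KK t - (KK ^^ (2 * n - 1)) t)"])
  show "linear_on HH HH (\<lambda>t. EE (FF t) - FF (EE t))"
    by (intro linear_on_diff vspace_HH linear_on_comp[OF linear_FF linear_EE] linear_on_comp[OF linear_EE linear_FF])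
  have "linear_on HH HH (\<lambda>t. scale HH c (KK t - (KK ^^ (2 * n - 1)) t))"
    by (intro linear_on_scale linear_on_diff vspace_HH linear_KK linear_on_funpow)
  then show "linear_on HH HH (\<lambda>t. fscale c (KK t - (KK ^^ (2 * n - 1)) t))"
    by simp
  fix x y assume xy: "x \<in> carrier Hsp" "y \<in> carrier Hsp"
  have "(KK ^^ (2 * n - 1)) (pu x y) = pu (H.Ki x) (H.Ki y)"
    using KK_pow_pu[OF xy] by (simp add: H.Ki_def)
  with xy show "EE (FF (pu x y)) - FF (EE (pu x y)) = fscale c (KK (pu x y) - (KK ^^ (2 * n - 1)) (pu x y))"
    by (simp add: tops_linear pu_linear H.E_F[unfolded scale_Hsp] ops_KF H.E_Ki[unfolded scale_Hsp]
        fs.scale_right_diff_distrib Hs.scale_closed[unfolded scale_Hsp] del: plus_fun_apply minus_apply)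
qed

text \<open>The two summands of \<open>EE\<close> q-commute, so the \<open>n\<close>-th power is
  \<open>E^n \<otimes> 1 + K^n \<otimes> E^n\<close>. With \<open>E^n = K^n - 1\<close> this
  telescopes to \<open>K^n \<otimes> K^n - 1 \<otimes> 1\<close>.\<close>

lemma EE_pow_n: "t \<in> carrier HH \<Longrightarrow> (EE ^^ n) t = (KK ^^ n) t - t"
proof (rule HH_eq[OF vspace_HH, where f = "EE ^^ n" and g = "\<lambda>t. (KK ^^ n) t - t"])
  show "linear_on HH HH (EE ^^ n)" "linear_on HH HH (\<lambda>t. (KK ^^ n) t - t)"
    by (intro linear_on_diff linear_on_funpow linear_EE linear_KK linear_on_id vspace_HH)+
  fix x y assume xy: "x \<in> carrier Hsp" "y \<in> carrier Hsp"
  have lin: "linear_on HH HH (tm opE (\<lambda>x. x))" "linear_on HH HH (tm opK opE)"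
    by (intro linear_tm linear_ops linear_on_id)+
  have "(EE ^^ n) (pu x y) = (tm opE (\<lambda>x. x) ^^ n) (pu x y) + (tm opK opE ^^ n) (pu x y)"
    unfolding EE_def
  proof (rule HH.qbinomial_root[OF lin _ _ q_root])
    fix t assume t: "t \<in> carrier HH"
    show "tm opK opE (tm opE (\<lambda>x. x) t) = scale HH q (tm opE (\<lambda>x. x) (tm opK opE t))"
    proof (rule HH_eq[OF vspace_HH linear_on_comp[OF lin] linear_on_scale[OF vspace_HH linear_on_comp[OF lin(2,1)]] _ t])
      show "tm opK opE (tm opE (\<lambda>x. x) (pu x y)) = scale HH q (tm opE (\<lambda>x. x) (tm opK opE (pu x y)))"
        if "x \<in> carrier Hsp" "y \<in> carrier Hsp" for x y
        using that by (simp add: tm_pu linear_ops linear_on_id ops_KE pu_linear)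
    qed
  qed (use xy in simp)
  also have "\<dots> = pu ((opK ^^ n) x - x) y + pu ((opK ^^ n) x) ((opK ^^ n) y - y)"
    using xy by (simp add: tm_pow_pu linear_ops linear_on_id opE_pow_n del: plus_fun_apply)
  also have "\<dots> = (KK ^^ n) (pu x y) - pu x y"
    using xy by (simp add: pu_linear KK_pow_pu del: plus_fun_apply minus_apply)
  finally show "(EE ^^ n) (pu x y) = (KK ^^ n) (pu x y) - pu x y" .
qed

text \<open>As for \<open>EE\<close>, but the summands commute up to \<open>p\<close>, and the
  second leg of the first summand contributes \<open>K^-n\<close>, which has to be replaced by
  \<open>K^n\<close> before the sum telescopes.\<close>

lemma FF_pow_n: "t \<in> carrier HH \<Longrightarrow> (FF ^^ n) t = t - (KK ^^ n) t"
proof (rule HH_eq[OF vspace_HH, where f = "FF ^^ n" and g = "\<lambda>t. t - (KK ^^ n) t"])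
  show "linear_on HH HH (FF ^^ n)" "linear_on HH HH (\<lambda>t. t - (KK ^^ n) t)"
    by (intro linear_on_diff linear_on_funpow linear_FF linear_KK linear_on_id vspace_HH)+
  fix x y assume xy: "x \<in> carrier Hsp" "y \<in> carrier Hsp"
  have lin: "linear_on HH HH (tm opF H.Ki)" "linear_on HH HH (tm (\<lambda>x. x) opF)"
    by (intro linear_tm linear_ops linear_on_id lin_Ki)+
  have "(FF ^^ n) (pu x y) = (tm opF H.Ki ^^ n) (pu x y) + (tm (\<lambda>x. x) opF ^^ n) (pu x y)"
    unfolding FF_def
  proof (rule HH.qbinomial_root[OF lin _ _ p_root])
    fix t assume t: "t \<in> carrier HH"
    show "tm (\<lambda>x. x) opF (tm opF H.Ki t) = scale HH p (tm opF H.Ki (tm (\<lambda>x. x) opF t))"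
    proof (rule HH_eq[OF vspace_HH linear_on_comp[OF lin] linear_on_scale[OF vspace_HH linear_on_comp[OF lin(2,1)]] _ t])
      show "tm (\<lambda>x. x) opF (tm opF H.Ki (pu x y)) = scale HH p (tm opF H.Ki (tm (\<lambda>x. x) opF (pu x y)))"
        if "x \<in> carrier Hsp" "y \<in> carrier Hsp" for x y
        using that by (simp add: tm_pu linear_ops linear_on_id lin_Ki H.F_Ki[unfolded scale_Hsp] pu_linear)
    qed
  qed (use xy in simp)
  also have "\<dots> = pu (x - (opK ^^ n) x) ((opK ^^ n) y) + pu x (y - (opK ^^ n) y)"
    using xy by (simp add: tm_pow_pu linear_ops linear_on_id lin_Ki opF_pow_n Ki_pow_n del: plus_fun_apply)
  also have "\<dots> = pu x y - (KK ^^ n) (pu x y)"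
    using xy by (simp add: pu_linear KK_pow_pu del: plus_fun_apply minus_apply)
  finally show "(FF ^^ n) (pu x y) = pu x y - (KK ^^ n) (pu x y)" .
qed

lemma KK_order: "t \<in> carrier HH \<Longrightarrow> (KK ^^ (2 * n)) t = t"
  by (rule HH_eq[OF vspace_HH linear_on_funpow[OF linear_KK] linear_on_id])
    (simp_all add: KK_pow_pu ops_K_order)

sublocale T: qmod n q c HH KK EE FF
  by unfold_locales
    (use linear_KK linear_EE linear_FF KK_EE KK_FF EE_FF EE_pow_n FF_pow_n KK_order in
      \<open>simp_all del: One_nat_def\<close>)

definition comul where "comul v = T.act v (pu one one)"

definition eps :: "(nat \<Rightarrow> 'k) \<Rightarrow> 'k" where
  "eps = lext ground (\<lambda>l i k. if l = 0 \<and> k = 0 then 1 else 0)"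

lemma linear_comul: "linear_on Hsp HH comul"
  unfolding comul_def by (intro T.linear_on_act_left) simp

lemma comul_closed [simp]: "v \<in> carrier Hsp \<Longrightarrow> comul v \<in> carrier HH"
  by (rule linear_on_closed[OF linear_comul])

lemma comul_ops [simp]:
  assumes "v \<in> carrier Hsp"
  shows "comul (opK v) = KK (comul v)" "comul (opE v) = EE (comul v)" "comul (opF v) = FF (comul v)"
    "comul (H.Ki v) = T.Ki (comul v)"
  using assms by (simp_all add: comul_def T.act_opK T.act_opE T.act_opF T.act_opKi)

lemma comul_one [simp]: "comul one = pu one one"
  by (simp add: comul_def)

lemma linear_eps: "linear_on Hsp ground eps"
  unfolding eps_def by (rule linear_on_lext[OF vspace_ground]) (simp add: ground_def)

lemmas eps_linear = linear_eps[THEN linear_on_plus] linear_eps[THEN linear_on_smult, unfolded scale_Hsp]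
  linear_eps[THEN linear_on_minus[OF vspace_Hsp]]

lemma scale_ground [simp]: "scale ground = (*)" and carrier_ground [simp]: "carrier ground = UNIV"
  by (simp_all add: ground_def)

lemma eps_bv: "l < n \<Longrightarrow> k < n \<Longrightarrow> eps (bv l i k) = (if l = 0 \<and> k = 0 then 1 else 0)"
  by (simp add: eps_def lext_bv[OF vspace_ground])

lemma eps_ops [simp]:
  assumes "v \<in> carrier Hsp"
  shows "eps (opK v) = eps v" "eps (opE v) = 0" "eps (opF v) = 0"
proof -
  note rule = Hsp_linear_eq[OF linear_on_comp[OF _ linear_eps] _ _ assms]
  show "eps (opK v) = eps v"
  proof (rule rule[OF linear_ops(1) linear_eps])
    show "eps (opK (bv l i k)) = eps (bv l i k)" if "l < n" "k < n" for l i k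
      using that by (simp add: opK_bv eps_linear eps_bv)
  qed
  show "eps (opF v) = 0"
  proof (rule rule[OF linear_ops(3) linear_on_zero[OF vspace_ground]])
    show "eps (opF (bv l i k)) = 0" if "l < n" "k < n" for l i k
      using that by (simp add: opF_bv eps_linear eps_bv)
  qed
  show "eps (opE v) = 0"
  proof (rule rule[OF linear_ops(2) linear_on_zero[OF vspace_ground]])
    fix l i k assume lk: "l < n" "k < n"
    have "eps (if Suc k < n then bv l i (Suc k) else bv l (i + n) 0 - bv l i 0) = 0"
      using lk by (simp add: eps_linear eps_bv)
    \<comment> \<open>Where the correction terms have no \<open>F\<close> left, their coefficients
      agree, and the counit does not see the exponents of \<open>K\<close> in which they
      differ.\<close>
    moreover have "ap l = aq l" if "l - 1 = 0"
      using that by (cases l) (simp_all add: ap_aq_Suc)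
    ultimately show "eps (opE (bv l i k)) = 0"
      using lk by (auto simp: opE_bv eps_linear eps_bv Hs.scale_closed[unfolded scale_Hsp])
  qed
qed

lemma eps_one [simp]: "eps one = 1"
  by (simp add: eps_bv)

end

section \<open>The Hopf algebra\<close>

context qparam
begin

lemma linear_mul_right: "linear_on Hsp Hsp (mul v)"
  by (rule H.linear_on_act_right)

lemma linear_mul_left: "w \<in> carrier Hsp \<Longrightarrow> linear_on Hsp Hsp (\<lambda>v. mul v w)"
  by (rule H.linear_on_act_left)

lemmas mul_linear =
  H.act_linear
  linear_mul_right[THEN linear_on_plus] linear_mul_right[THEN linear_on_smult, unfolded scale_Hsp]
  linear_mul_right[THEN linear_on_minus[OF vspace_Hsp]]
  linear_mul_left[THEN linear_on_uminus[OF vspace_Hsp]]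
  linear_mul_right[THEN linear_on_uminus[OF vspace_Hsp]]

lemmas mul_ops = H.act_opK H.act_opE H.act_opF H.act_opKi

section \<open>The antipode\<close>

lemma ops_uminus:
  assumes "v \<in> carrier Hsp"
  shows "opK (- v) = - opK v" "opE (- v) = - opE v" "opF (- v) = - opF v" "H.Ki (- v) = - H.Ki v"
  using linear_ops[THEN linear_on_uminus[OF vspace_Hsp]] lin_Ki[THEN linear_on_uminus[OF vspace_Hsp]] assms
  by auto

text \<open>The values that the antipode axiom forces on \<open>K\<close>, \<open>E\<close> and
  \<open>F\<close>: \<open>K^-1\<close>, \<open>- K^-1 E\<close> and \<open>- F K\<close>.\<close>

definition KI where "KI = H.Ki one"
definition SE where "SE = - H.Ki (opE one)"
definition SF where "SF = - opF (opK one)"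

lemma S_closed [simp]: "KI \<in> carrier Hsp" "SE \<in> carrier Hsp" "SF \<in> carrier Hsp"
  by (simp_all add: KI_def SE_def SF_def)

lemma mul_S:
  assumes "w \<in> carrier Hsp"
  shows "mul KI w = H.Ki w" "mul SE w = - H.Ki (opE w)" "mul SF w = - opF (opK w)"
  using assms by (simp_all add: KI_def SE_def SF_def mul_ops mul_linear)

text \<open>A power of a right multiplication becomes a single right multiplication by a power of
  \<open>a\<close>, and that power is computed with left multiplications.\<close>

lemma mul_right_pow:
  assumes "a \<in> carrier Hsp" "w \<in> carrier Hsp"
  shows "((\<lambda>w. mul w a) ^^ j) w = mul w ((mul a ^^ j) one)"
  using assms(2)
proof (induction j arbitrary: w)
  case (Suc j)
  have "(mul a ^^ j) one \<in> carrier Hsp"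
    by (rule linear_on_closed[OF linear_on_funpow[OF linear_mul_right]]) simp
  moreover have "((\<lambda>w. mul w a) ^^ Suc j) w = ((\<lambda>w. mul w a) ^^ j) (mul w a)"
    using funpow_swap1[of "\<lambda>w. mul w a" j w] by simp
  ultimately show ?case
    using Suc assms(1) by (simp add: mul_assoc)
qed simp

lemma mul_pow_eq:
  assumes "a \<in> carrier Hsp" "\<And>w. w \<in> carrier Hsp \<Longrightarrow> mul a w = g w"
  shows "(mul a ^^ j) one = (g ^^ j) one"
proof (induction j)
  case (Suc j)
  have "(mul a ^^ j) one \<in> carrier Hsp"
    by (rule linear_on_closed[OF linear_on_funpow[OF linear_mul_right]]) simp
  with Suc show ?case by (simp add: assms(2))
qed simp

text \<open>Reordering \<open>(- K^-1 E)^n\<close> gives \<open>- K^-n E^n\<close>, the sign being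
  the product of the \<open>- (q^i)\<close>. With \<open>E^n = K^n - 1\<close> and
  \<open>K^-n = K^n\<close> this is \<open>K^n - 1\<close> again. The computation for
  \<open>F\<close> is the same with \<open>p\<close>.\<close>

lemma S_pow:
  "(mul KI ^^ j) one = (H.Ki ^^ j) one"
  "(mul SE ^^ n) one = (opK ^^ n) one - one"
  "(mul SF ^^ n) one = one - (opK ^^ n) one"
proof -
  show "(mul KI ^^ j) one = (H.Ki ^^ j) one"
    by (rule mul_pow_eq) (simp_all add: mul_S)
  have K2: "(opK ^^ n) ((opK ^^ n) one) = one"
    using ops_K_order[of one] by (simp add: mult_2 funpow_add)
  have "(mul SE ^^ n) one = ((\<lambda>u. - H.Ki (opE u)) ^^ n) one"
    by (rule mul_pow_eq) (simp_all add: mul_S)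
  also have "\<dots> = - (opK ^^ n) ((opK ^^ n) one - one)"
    by (simp add: H.antipode_E_pow prod_neg_powers_root[OF q_root] opE_pow_n Ki_pow_n)
  also have "\<dots> = (opK ^^ n) one - one"
    using linear_on_minus[OF vspace_Hsp linear_on_funpow[OF linear_ops(1)], of "(opK ^^ n) one" one n]
    by (simp add: K2)
  finally show "(mul SE ^^ n) one = (opK ^^ n) one - one" .
  have "(mul SF ^^ n) one = ((\<lambda>u. - opF (opK u)) ^^ n) one"
    by (rule mul_pow_eq) (simp_all add: mul_S)
  also have "\<dots> = - ((opK ^^ n) one - (opK ^^ n) ((opK ^^ n) one))"
    by (simp add: H.antipode_F_pow prod_neg_powers_root[OF p_root] opF_pow_n)
  finally show "(mul SF ^^ n) one = one - (opK ^^ n) one"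
    by (simp add: K2)
qed

text \<open>Right multiplications compose in reverse order, so an antihomomorphism of the algebra
  becomes an ordinary action and only the relations have to be checked.\<close>

sublocale S: qmod n q c Hsp "\<lambda>w. mul w KI" "\<lambda>w. mul w SE" "\<lambda>w. mul w SF"
proof unfold_locales
  fix w assume w: "w \<in> carrier Hsp"
  have 1: "mul SE KI = fscale q (mul KI SE)"
    by (simp add: mul_S) (simp add: KI_def SE_def ops_uminus H.E_Ki[unfolded scale_Hsp] H.op_linear[unfolded scale_Hsp])
  show "mul (mul w SE) KI = scale Hsp q (mul (mul w KI) SE)"
    using w by (simp add: mul_assoc 1 mul_linear)
  have 2: "mul SF KI = fscale p (mul KI SF)"
    by (simp add: mul_S) (simp add: KI_def SF_def ops_uminus H.FK[unfolded scale_Hsp] H.op_linear[unfolded scale_Hsp]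
        Hs.scale_closed[unfolded scale_Hsp])
  show "mul (mul w SF) KI = scale Hsp (inverse q) (mul (mul w KI) SF)"
    using w by (simp add: mul_assoc 2 mul_linear)
  \<comment> \<open>\<open>SF SE\<close> is \<open>F E\<close> because the inner
    \<open>K K^-1\<close> cancels, and \<open>SE SF\<close> is \<open>E F\<close> because
    \<open>E F\<close> commutes with \<open>K\<close>; the commutator changes sign as it
    should.\<close>
  have 3: "mul SF SE - mul SE SF = fscale c (KI - opK one)"
  proof -
    have "mul SF SE = opF (opE one)"
      by (simp add: mul_S) (simp add: SE_def ops_uminus)
    moreover have "mul SE SF = opE (opF one)"
      by (simp add: mul_S) (simp add: SF_def ops_uminus H.FK[unfolded scale_Hsp] H.EK[unfolded scale_Hsp] H.op_linear[unfolded scale_Hsp]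
          Hs.scale_closed[unfolded scale_Hsp])
    ultimately show ?thesis
      using H.E_F[of one] by (simp add: KI_def fs.scale_right_diff_distrib)
  qed
  have "mul (mul w SF) SE - mul (mul w SE) SF = mul w (mul SF SE - mul SE SF)"
    using w by (simp add: mul_assoc mul_linear)
  also have "\<dots> = fscale c (mul w KI - mul w (opK one))"
    unfolding 3 using w by (simp add: mul_linear)
  also have "mul w (opK one) = ((\<lambda>w. mul w KI) ^^ (2 * n - 1)) w"
    using w by (simp add: mul_right_pow S_pow H.Ki_pow_pred del: One_nat_def)
  finally show "mul (mul w SF) SE - mul (mul w SE) SF = scale Hsp c (mul w KI - ((\<lambda>w. mul w KI) ^^ (2 * n - 1)) w)"
    unfolding scale_Hsp .
  show "((\<lambda>w. mul w KI) ^^ (2 * n)) w = w"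
    using w by (simp add: mul_right_pow S_pow H.Ki_pow_2n)
  show "((\<lambda>w. mul w SE) ^^ n) w = ((\<lambda>w. mul w KI) ^^ n) w - w"
    using w by (simp add: mul_right_pow S_pow Ki_pow_n mul_linear)
  show "((\<lambda>w. mul w SF) ^^ n) w = w - ((\<lambda>w. mul w KI) ^^ n) w"
    using w by (simp add: mul_right_pow S_pow Ki_pow_n mul_linear)
qed (simp_all add: linear_mul_left)

definition anti where "anti v = S.act v one"

lemma linear_anti: "linear_on Hsp Hsp anti"
  unfolding anti_def by (intro S.linear_on_act_left) simp

lemma anti_closed [simp]: "v \<in> carrier Hsp \<Longrightarrow> anti v \<in> carrier Hsp"
  by (rule linear_on_closed[OF linear_anti])

lemma anti_ops [simp]:
  assumes "v \<in> carrier Hsp"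
  shows "anti (opK v) = mul (anti v) KI" "anti (opE v) = mul (anti v) SE" "anti (opF v) = mul (anti v) SF"
    "anti (H.Ki v) = mul (anti v) (opK one)"
proof -
  show "anti (opK v) = mul (anti v) KI" "anti (opE v) = mul (anti v) SE" "anti (opF v) = mul (anti v) SF"
    using assms by (simp_all add: anti_def S.act_opK S.act_opE S.act_opF)
  have "anti (H.Ki v) = S.Ki (anti v)"
    using assms by (simp add: anti_def S.act_opKi)
  also have "\<dots> = mul (anti v) (opK one)"
    using assms by (simp add: S.Ki_def mul_right_pow S_pow H.Ki_pow_pred del: One_nat_def)
  finally show "anti (H.Ki v) = mul (anti v) (opK one)" .
qed

lemma anti_one [simp]: "anti one = one"
  by (simp add: anti_def)

lemma eps_Ki [simp]: "v \<in> carrier Hsp \<Longrightarrow> eps (H.Ki v) = eps v"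
  using eps_ops(1)[of "H.Ki v"] by simp

section \<open>The Hopf algebra axioms by induction along the generators\<close>

lemma bilinear_comp_ops:
  assumes "bilinear_on Hsp Hsp U b"
  shows "bilinear_on Hsp Hsp U (\<lambda>x y. b (opK x) (opK y))"
    "bilinear_on Hsp Hsp U (\<lambda>x y. b (opE x) y)" "bilinear_on Hsp Hsp U (\<lambda>x y. b (opK x) (opE y))"
    "bilinear_on Hsp Hsp U (\<lambda>x y. b (opF x) (H.Ki y))" "bilinear_on Hsp Hsp U (\<lambda>x y. b x (opF y))"
  by (rule bilinear_on_comp[OF assms]; intro linear_ops linear_on_id lin_Ki)+

text \<open>Moves an operator from the tensor into the bilinear map, where it acts on the two legs
  separately. A claim about \<open>comul (opE v)\<close> thereby becomes one about
  \<open>comul v\<close>.\<close>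

lemma lift_ops:
  assumes U: "vspace U" and b: "bilinear_on Hsp Hsp U b" and t: "t \<in> carrier HH"
  shows lift_KK: "tensor_lift Hsp Hsp b (KK t) = tensor_lift Hsp Hsp (\<lambda>x y. b (opK x) (opK y)) t"
    and lift_EE: "tensor_lift Hsp Hsp b (EE t) = tensor_lift Hsp Hsp (\<lambda>x y. b (opE x) y + b (opK x) (opE y)) t"
    and lift_FF: "tensor_lift Hsp Hsp b (FF t) = tensor_lift Hsp Hsp (\<lambda>x y. b (opF x) (H.Ki y) + b x (opF y)) t"
proof -
  note lb = linear_on_tensor_lift[OF vspace_Hsp vspace_Hsp U]
  note bc = bilinear_comp_ops[OF b]
  show "tensor_lift Hsp Hsp b (KK t) = tensor_lift Hsp Hsp (\<lambda>x y. b (opK x) (opK y)) t"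
    by (rule HH_eq[OF U linear_on_comp[OF linear_KK lb[OF b]] lb[OF bc(1)] _ t])
      (simp add: tensor_lift_pure[OF U b] tensor_lift_pure[OF U bc(1)])
  note E = bilinear_on_add[OF U bc(2,3)] and F = bilinear_on_add[OF U bc(4,5)]
  show "tensor_lift Hsp Hsp b (EE t) = tensor_lift Hsp Hsp (\<lambda>x y. b (opE x) y + b (opK x) (opE y)) t"
    by (rule HH_eq[OF U linear_on_comp[OF linear_EE lb[OF b]] lb[OF E] _ t])
      (simp add: tensor_lift_pure[OF U b] tensor_lift_pure[OF U E] linear_on_plus[OF lb[OF b]] del: plus_fun_apply)
  show "tensor_lift Hsp Hsp b (FF t) = tensor_lift Hsp Hsp (\<lambda>x y. b (opF x) (H.Ki y) + b x (opF y)) t"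
    by (rule HH_eq[OF U linear_on_comp[OF linear_FF lb[OF b]] lb[OF F] _ t])
      (simp add: tensor_lift_pure[OF U b] tensor_lift_pure[OF U F] linear_on_plus[OF lb[OF b]] del: plus_fun_apply)
qed

lemma linear_tm_mul:
  assumes t: "t \<in> carrier HH"
  shows "b \<in> carrier Hsp \<Longrightarrow> linear_on Hsp HH (\<lambda>a. tm (mul a) (mul b) t)"
    and "a \<in> carrier Hsp \<Longrightarrow> linear_on Hsp HH (\<lambda>b. tm (mul a) (mul b) t)"
proof -
  note lin = linear_tm[OF linear_mul_right linear_mul_right]
  note sc = Hs.scale_closed[unfolded scale_Hsp]
  show "linear_on Hsp HH (\<lambda>a. tm (mul a) (mul b) t)" if "b \<in> carrier Hsp"
  proof (rule linear_onI)
    show "tm (mul a) (mul b) t \<in> carrier HH" for a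
      using linear_on_closed[OF lin t] .
    show "tm (mul (a + a')) (mul b) t = tm (mul a) (mul b) t + tm (mul a') (mul b) t"
      if "a \<in> carrier Hsp" "a' \<in> carrier Hsp" for a a'
      by (rule HH_eq[OF vspace_HH lin linear_on_add[OF vspace_HH lin lin] _ t])
        (simp add: tm_pu linear_mul_right mul_linear pu_linear that del: plus_fun_apply)
    show "tm (mul (scale Hsp s a)) (mul b) t = scale HH s (tm (mul a) (mul b) t)"
      if "a \<in> carrier Hsp" for s a
      by (rule HH_eq[OF vspace_HH lin linear_on_scale[OF vspace_HH lin] _ t])
        (simp add: tm_pu linear_mul_right mul_linear pu_linear that del: plus_fun_apply)
  qed
  show "linear_on Hsp HH (\<lambda>b. tm (mul a) (mul b) t)" if "a \<in> carrier Hsp"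
  proof (rule linear_onI)
    show "tm (mul a) (mul b) t \<in> carrier HH" for b
      using linear_on_closed[OF lin t] .
    show "tm (mul a) (mul (b + b')) t = tm (mul a) (mul b) t + tm (mul a) (mul b') t"
      if "b \<in> carrier Hsp" "b' \<in> carrier Hsp" for b b'
      by (rule HH_eq[OF vspace_HH lin linear_on_add[OF vspace_HH lin lin] _ t])
        (simp add: tm_pu linear_mul_right mul_linear pu_linear that del: plus_fun_apply)
    show "tm (mul a) (mul (scale Hsp s b)) t = scale HH s (tm (mul a) (mul b) t)"
      if "b \<in> carrier Hsp" for s b
      by (rule HH_eq[OF vspace_HH lin linear_on_scale[OF vspace_HH lin] _ t])
        (simp add: tm_pu linear_mul_right mul_linear pu_linear that del: plus_fun_apply)
  qed
qed

text \<open>The product of the tensor square, with the inner lift written as \<open>tm\<close> so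
  that functoriality of \<open>tensor_map\<close> applies.\<close>

definition tmul where "tmul s t = tensor_lift Hsp Hsp (\<lambda>a b. tm (mul a) (mul b) t) s"

lemma bilinear_tm_mul: "t \<in> carrier HH \<Longrightarrow> bilinear_on Hsp Hsp HH (\<lambda>a b. tm (mul a) (mul b) t)"
  by (intro bilinear_onI linear_tm_mul)

lemma linear_tmul: "t \<in> carrier HH \<Longrightarrow> linear_on HH HH (\<lambda>s. tmul s t)"
  unfolding tmul_def by (intro linear_on_tensor_lift vspace_Hsp vspace_HH bilinear_tm_mul)

text \<open>The three operators are left multiplications on the legs, so they commute with right
  multiplication by \<open>t\<close>. This is the induction step for the multiplicativity of
  \<open>comul\<close>.\<close>

lemma tmul_ops:
  assumes s: "s \<in> carrier HH" and t: "t \<in> carrier HH"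
  shows "tmul (KK s) t = KK (tmul s t)" "tmul (EE s) t = EE (tmul s t)" "tmul (FF s) t = FF (tmul s t)"
proof -
  note b = bilinear_tm_mul[OF t]
  note lin = linear_tm[OF linear_mul_right linear_mul_right]
  have comp: "tm (mul (f a)) (mul (g b)) t = tm f g (tm (mul a) (mul b) t)"
    if "a \<in> carrier Hsp" "b \<in> carrier Hsp" "linear_on Hsp Hsp f" "linear_on Hsp Hsp g"
      "\<And>w. w \<in> carrier Hsp \<Longrightarrow> mul (f a) w = f (mul a w)" "\<And>w. w \<in> carrier Hsp \<Longrightarrow> mul (g b) w = g (mul b w)"
    for a b f g
    using that
    by (subst tensor_map_comp[OF vspace_Hsp vspace_Hsp vspace_Hsp vspace_Hsp vspace_Hsp vspace_Hsp
          linear_mul_right linear_mul_right _ _ t]) (auto intro: tensor_map_cong)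
  note post = tensor_lift_comp[OF vspace_Hsp vspace_Hsp vspace_HH vspace_HH b _ s]
  show "tmul (KK s) t = KK (tmul s t)"
    unfolding tmul_def lift_KK[OF vspace_HH b s] post[OF linear_KK]
    by (rule tensor_lift_cong) (simp add: comp linear_ops KK_def mul_ops)
  show "tmul (EE s) t = EE (tmul s t)"
    unfolding tmul_def lift_EE[OF vspace_HH b s] post[OF linear_EE]
    by (rule tensor_lift_cong) (simp add: comp[of _ _ opK opE] comp[of _ _ opE "\<lambda>x. x"] linear_ops linear_on_id EE_def mul_ops)
  show "tmul (FF s) t = FF (tmul s t)"
    unfolding tmul_def lift_FF[OF vspace_HH b s] post[OF linear_FF]
    by (rule tensor_lift_cong) (simp add: comp[of _ _ opF H.Ki] comp[of _ _ "\<lambda>x. x" opF] linear_ops linear_on_id lin_Ki FF_def mul_ops)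
qed

lemma tmul_one: "t \<in> carrier HH \<Longrightarrow> tmul (pu one one) t = t"
proof -
  assume t: "t \<in> carrier HH"
  have "tmul (pu one one) t = tm (mul one) (mul one) t"
    unfolding tmul_def by (rule tensor_lift_pure[OF vspace_HH bilinear_tm_mul[OF t]]) simp_all
  also have "\<dots> = tm (\<lambda>x. x) (\<lambda>x. x) t"
    by (rule tensor_map_cong) simp_all
  finally show ?thesis
    using tensor_map_id[OF vspace_Hsp vspace_Hsp t] by simp
qed

lemma comul_mul:
  assumes "x \<in> carrier Hsp" "y \<in> carrier Hsp"
  shows "comul (mul x y) = tmul (comul x) (comul y)"
  using assms(1)
proof (induction rule: Hsp_generated)
  case (linear a v w)
  then show ?case using assms(2)
    by (simp add: mul_linear linear_on_plus[OF linear_comul] linear_on_smult[OF linear_comul, unfolded scale_Hsp scale_tensor]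
        linear_on_plus[OF linear_tmul] linear_on_smult[OF linear_tmul, unfolded scale_tensor]
        Hs.scale_closed[unfolded scale_Hsp] HH.scale_closed[unfolded scale_tensor] del: plus_fun_apply)
qed (simp_all add: mul_ops assms(2) tmul_ops tmul_one)

lemma eps_mul:
  assumes "x \<in> carrier Hsp" "y \<in> carrier Hsp"
  shows "eps (mul x y) = eps x * eps y"
  using assms(1)
proof (induction rule: Hsp_generated)
  case (linear a v w)
  then show ?case using assms(2)
    by (simp add: mul_linear eps_linear Hs.scale_closed[unfolded scale_Hsp] distrib_right del: plus_fun_apply)
qed (simp_all add: mul_ops assms(2))

text \<open>The common frame of the counit and antipode axioms: each states that a lift composed
  with the coproduct is a given linear map.\<close>

lemma comul_linear_eq:
  assumes "linear_on HH Hsp f" "linear_on Hsp Hsp g" "x \<in> carrier Hsp"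
    and "f (pu one one) = g one"
    and "\<And>v. v \<in> carrier Hsp \<Longrightarrow> f (comul v) = g v \<Longrightarrow> f (KK (comul v)) = g (opK v)"
    and "\<And>v. v \<in> carrier Hsp \<Longrightarrow> f (comul v) = g v \<Longrightarrow> f (EE (comul v)) = g (opE v)"
    and "\<And>v. v \<in> carrier Hsp \<Longrightarrow> f (comul v) = g v \<Longrightarrow> f (FF (comul v)) = g (opF v)"
  shows "f (comul x) = g x"
  using assms(3)
proof (induction rule: Hsp_generated)
  case (linear a v w)
  then show ?case
    using linear_on_comp[OF linear_comul assms(1), THEN linear_on_plus, OF Hs.scale_closed]
      linear_on_comp[OF linear_comul assms(1), THEN linear_on_smult]
      assms(2)[THEN linear_on_plus, OF Hs.scale_closed] assms(2)[THEN linear_on_smult]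
    by (simp del: plus_fun_apply)
qed (simp_all add: assms)

lemma counit_l:
  assumes "x \<in> carrier Hsp"
  shows "tensor_lift Hsp Hsp (\<lambda>a b. fscale (eps a) b) (comul x) = x"
proof -
  have b: "bilinear_on Hsp Hsp Hsp (\<lambda>a b. fscale (eps a) b)"
    using bilinear_on_form_scale[OF vspace_Hsp linear_eps] by simp
  note lift = lift_ops[OF vspace_Hsp b comul_closed]
  note post = tensor_lift_comp[OF vspace_Hsp vspace_Hsp vspace_Hsp vspace_Hsp b _ comul_closed]
  show ?thesis
  proof (rule comul_linear_eq[OF linear_on_tensor_lift[OF vspace_Hsp vspace_Hsp vspace_Hsp b] linear_on_id assms])
    show "tensor_lift Hsp Hsp (\<lambda>a b. fscale (eps a) b) (pu one one) = one"
      by (simp add: tensor_lift_pure[OF vspace_Hsp b])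
    fix v assume v: "v \<in> carrier Hsp" "tensor_lift Hsp Hsp (\<lambda>a b. fscale (eps a) b) (comul v) = v"
    show "tensor_lift Hsp Hsp (\<lambda>a b. fscale (eps a) b) (KK (comul v)) = opK v"
      unfolding lift(1)[OF v(1)] by (subst v(2)[symmetric], subst post[OF linear_ops(1) v(1)])
        (rule tensor_lift_cong, simp add: ops_linear)
    show "tensor_lift Hsp Hsp (\<lambda>a b. fscale (eps a) b) (EE (comul v)) = opE v"
      unfolding lift(2)[OF v(1)] by (subst v(2)[symmetric], subst post[OF linear_ops(2) v(1)])
        (rule tensor_lift_cong, simp add: ops_linear)
    show "tensor_lift Hsp Hsp (\<lambda>a b. fscale (eps a) b) (FF (comul v)) = opF v"
      unfolding lift(3)[OF v(1)] by (subst v(2)[symmetric], subst post[OF linear_ops(3) v(1)])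
        (rule tensor_lift_cong, simp add: ops_linear)
  qed
qed

lemma counit_r:
  assumes "x \<in> carrier Hsp"
  shows "tensor_lift Hsp Hsp (\<lambda>a b. fscale (eps b) a) (comul x) = x"
proof -
  have b: "bilinear_on Hsp Hsp Hsp (\<lambda>a b. fscale (eps b) a)"
    using bilinear_on_scale_form[OF vspace_Hsp linear_eps] by simp
  note lift = lift_ops[OF vspace_Hsp b comul_closed]
  note post = tensor_lift_comp[OF vspace_Hsp vspace_Hsp vspace_Hsp vspace_Hsp b _ comul_closed]
  show ?thesis
  proof (rule comul_linear_eq[OF linear_on_tensor_lift[OF vspace_Hsp vspace_Hsp vspace_Hsp b] linear_on_id assms])
    show "tensor_lift Hsp Hsp (\<lambda>a b. fscale (eps b) a) (pu one one) = one"
      by (simp add: tensor_lift_pure[OF vspace_Hsp b])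
    fix v assume v: "v \<in> carrier Hsp" "tensor_lift Hsp Hsp (\<lambda>a b. fscale (eps b) a) (comul v) = v"
    show "tensor_lift Hsp Hsp (\<lambda>a b. fscale (eps b) a) (KK (comul v)) = opK v"
      unfolding lift(1)[OF v(1)] by (subst v(2)[symmetric], subst post[OF linear_ops(1) v(1)])
        (rule tensor_lift_cong, simp add: ops_linear)
    show "tensor_lift Hsp Hsp (\<lambda>a b. fscale (eps b) a) (EE (comul v)) = opE v"
      unfolding lift(2)[OF v(1)] by (subst v(2)[symmetric], subst post[OF linear_ops(2) v(1)])
        (rule tensor_lift_cong, simp add: ops_linear)
    show "tensor_lift Hsp Hsp (\<lambda>a b. fscale (eps b) a) (FF (comul v)) = opF v"
      unfolding lift(3)[OF v(1)] by (subst v(2)[symmetric], subst post[OF linear_ops(3) v(1)])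
        (rule tensor_lift_cong, simp add: ops_linear)
  qed
qed

lemma linear_unit: "linear_on Hsp Hsp (\<lambda>x. fscale (eps x) one)"
  using linear_on_form_scale[OF vspace_Hsp linear_eps one_closed] by simp

text \<open>In \<open>S(a) b\<close> the new factors meet in the middle. For \<open>K\<close> they
  cancel, and for \<open>E\<close> and \<open>F\<close> the two summands of the coproduct are
  opposite for each pair \<open>a\<close>, \<open>b\<close>, so the lift is already that of
  0.\<close>

lemma antipode_l:
  assumes "x \<in> carrier Hsp"
  shows "tensor_lift Hsp Hsp (\<lambda>a b. mul (anti a) b) (comul x) = fscale (eps x) one"
proof -
  have b: "bilinear_on Hsp Hsp Hsp (\<lambda>a b. mul (anti a) b)"
    by (rule bilinear_on_comp[OF bilinear_mul linear_anti linear_on_id])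
  note lift = lift_ops[OF vspace_Hsp b comul_closed]
  note zero = tensor_lift_zero[OF vspace_Hsp vspace_Hsp vspace_Hsp comul_closed]
  show ?thesis
  proof (rule comul_linear_eq[OF linear_on_tensor_lift[OF vspace_Hsp vspace_Hsp vspace_Hsp b] linear_unit assms])
    show "tensor_lift Hsp Hsp (\<lambda>a b. mul (anti a) b) (pu one one) = fscale (eps one) one"
      by (simp add: tensor_lift_pure[OF vspace_Hsp b])
    fix v assume v: "v \<in> carrier Hsp"
      "tensor_lift Hsp Hsp (\<lambda>a b. mul (anti a) b) (comul v) = fscale (eps v) one"
    show "tensor_lift Hsp Hsp (\<lambda>a b. mul (anti a) b) (KK (comul v)) = fscale (eps (opK v)) one"
      unfolding lift(1)[OF v(1)] eps_ops[OF v(1)] v(2)[symmetric]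
      by (rule tensor_lift_cong) (simp add: mul_assoc mul_S)
    have "tensor_lift Hsp Hsp (\<lambda>a b. mul (anti a) b) (EE (comul v)) = tensor_lift Hsp Hsp (\<lambda>_ _. 0) (comul v)"
      unfolding lift(2)[OF v(1)]
      by (rule tensor_lift_cong) (simp add: mul_assoc mul_S mul_linear del: plus_fun_apply zero_fun_apply)
    then show "tensor_lift Hsp Hsp (\<lambda>a b. mul (anti a) b) (EE (comul v)) = fscale (eps (opE v)) one"
      using v by (simp add: zero del: zero_fun_apply)
    have "tensor_lift Hsp Hsp (\<lambda>a b. mul (anti a) b) (FF (comul v)) = tensor_lift Hsp Hsp (\<lambda>_ _. 0) (comul v)"
      unfolding lift(3)[OF v(1)]
      by (rule tensor_lift_cong) (simp add: mul_assoc mul_S mul_linear del: plus_fun_apply zero_fun_apply)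
    then show "tensor_lift Hsp Hsp (\<lambda>a b. mul (anti a) b) (FF (comul v)) = fscale (eps (opF v)) one"
      using v by (simp add: zero del: zero_fun_apply)
  qed
qed

text \<open>Here the new factors stand outside \<open>a S(b)\<close>. They are pulled out of the
  lift, the induction hypothesis turns the inner sum into a multiple of 1, and only there do they
  cancel.\<close>

lemma antipode_r:
  assumes "x \<in> carrier Hsp"
  shows "tensor_lift Hsp Hsp (\<lambda>a b. mul a (anti b)) (comul x) = fscale (eps x) one"
proof -
  have b: "bilinear_on Hsp Hsp Hsp (\<lambda>a b. mul a (anti b))"
    by (rule bilinear_on_comp[OF bilinear_mul linear_on_id linear_anti])
  note lift = lift_ops[OF vspace_Hsp b comul_closed]
  note post = tensor_lift_comp[OF vspace_Hsp vspace_Hsp vspace_Hsp vspace_Hsp b _ comul_closed]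
  note R = linear_mul_left[OF S_closed(1)] linear_mul_left[OF S_closed(2)] linear_mul_left[OF S_closed(3)]
  note scl = Hs.scale_closed[unfolded scale_Hsp]
  show ?thesis
  proof (rule comul_linear_eq[OF linear_on_tensor_lift[OF vspace_Hsp vspace_Hsp vspace_Hsp b] linear_unit assms])
    show "tensor_lift Hsp Hsp (\<lambda>a b. mul a (anti b)) (pu one one) = fscale (eps one) one"
      by (simp add: tensor_lift_pure[OF vspace_Hsp b])
    fix v assume v: "v \<in> carrier Hsp"
      "tensor_lift Hsp Hsp (\<lambda>a b. mul a (anti b)) (comul v) = fscale (eps v) one"
    have "tensor_lift Hsp Hsp (\<lambda>a b. mul a (anti b)) (KK (comul v)) = opK (mul (fscale (eps v) one) KI)"
      unfolding lift(1)[OF v(1)] v(2)[symmetric] post[OF linear_on_comp[OF R(1) linear_ops(1)] v(1)]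
      by (rule tensor_lift_cong) (simp add: mul_assoc mul_ops)
    also have "\<dots> = fscale (eps v) one"
      by (simp add: mul_linear ops_linear KI_def)
    finally show "tensor_lift Hsp Hsp (\<lambda>a b. mul a (anti b)) (KK (comul v)) = fscale (eps (opK v)) one"
      using v by simp
    let ?w = "fscale (eps v) one"
    have "tensor_lift Hsp Hsp (\<lambda>a b. mul a (anti b)) (EE (comul v)) = opE ?w + opK (mul ?w SE)"
      unfolding lift(2)[OF v(1)] v(2)[symmetric]
        post[OF linear_on_add[OF vspace_Hsp linear_ops(2) linear_on_comp[OF R(2) linear_ops(1)]] v(1)]
      by (rule tensor_lift_cong) (simp add: mul_assoc mul_ops del: plus_fun_apply)
    also have "\<dots> = 0"
      by (simp add: mul_linear ops_linear SE_def ops_uminus scl del: plus_fun_apply zero_fun_apply)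
    finally show "tensor_lift Hsp Hsp (\<lambda>a b. mul a (anti b)) (EE (comul v)) = fscale (eps (opE v)) one"
      using v by (simp del: zero_fun_apply)
    have "tensor_lift Hsp Hsp (\<lambda>a b. mul a (anti b)) (FF (comul v)) = opF (mul ?w (opK one)) + mul ?w SF"
      unfolding lift(3)[OF v(1)] v(2)[symmetric]
        post[OF linear_on_add[OF vspace_Hsp linear_on_comp[OF linear_mul_left[of "opK one"] linear_ops(3)] R(3)] v(1)]
      by (subst post[OF linear_on_add[OF vspace_Hsp linear_on_comp[OF linear_mul_left[of "opK one"] linear_ops(3)] R(3)] v(1)])
       (simp, rule tensor_lift_cong, simp add: mul_assoc mul_ops del: plus_fun_apply)
    also have "\<dots> = 0"
      by (simp add: mul_linear ops_linear SF_def ops_uminus del: plus_fun_apply zero_fun_apply)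
    finally show "tensor_lift Hsp Hsp (\<lambda>a b. mul a (anti b)) (FF (comul v)) = fscale (eps (opF v)) one"
      using v by (simp del: zero_fun_apply)
  qed
qed

definition Hopf :: "('k, nat \<Rightarrow> 'k) hopf" where
  "Hopf = \<lparr>carrier = carrier Hsp, scale = fscale, mult = mul, unit = one, comult = comul,
     counit = eps, antipode = anti\<rparr>"

lemma Hopf_simps [simp]:
  "carrier Hopf = carrier Hsp" "scale Hopf = fscale" "mult Hopf = mul" "unit Hopf = one"
  "comult Hopf = comul" "counit Hopf = eps" "antipode Hopf = anti"
  by (simp_all add: Hopf_def)

text \<open>\<open>Hopf\<close> and \<open>Hsp\<close> share carrier and scalar multiplication, and
  the tensor constructions see nothing else; these rules carry all statements over.\<close>

lemma linear_on_Hopf [simp]: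
  "linear_on Hopf U = linear_on Hsp U" "linear_on U Hopf = linear_on U Hsp"
  by (simp_all add: linear_on_def fun_eq_iff)

lemma bilinear_on_Hopf [simp]:
  "bilinear_on Hopf V U = bilinear_on Hsp V U" "bilinear_on V Hopf U = bilinear_on V Hsp U"
  "bilinear_on V U Hopf = bilinear_on V U Hsp"
  by (simp_all add: bilinear_on_def fun_eq_iff)

lemma pure_Hopf [simp]: "pure Hopf V = pure Hsp V" "pure V Hopf = pure V Hsp"
  by (simp_all add: pure_def fun_eq_iff)

lemma tensor_Hopf [simp]: "Hopf \<otimes> V = Hsp \<otimes> V" "V \<otimes> Hopf = V \<otimes> Hsp"
  by (simp_all add: tensor_product_def)

lemma tensor_lift_Hopf [simp]: "tensor_lift Hopf V = tensor_lift Hsp V" "tensor_lift V Hopf = tensor_lift V Hsp"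
  by (simp_all add: tensor_lift_def fun_eq_iff)

lemma tensor_map_Hopf [simp]:
  "tensor_map Hopf V W U = tensor_map Hsp V W U" "tensor_map V Hopf W U = tensor_map V Hsp W U"
  "tensor_map V W Hopf U = tensor_map V W Hsp U" "tensor_map V W U Hopf = tensor_map V W U Hsp"
  by (simp_all add: tensor_map_def fun_eq_iff)

lemma tensor_assoc_Hopf [simp]: "tensor_assoc Hopf Hopf Hopf = tensor_assoc Hsp Hsp Hsp"
  by (simp add: tensor_assoc_def fun_eq_iff)

section \<open>Coassociativity\<close>

abbreviation H3 where "H3 \<equiv> Hsp \<otimes> HH"
abbreviation tm3 where "tm3 \<equiv> tensor_map Hsp HH Hsp HH"
abbreviation Dl where "Dl t \<equiv> tensor_assoc Hsp Hsp Hsp (tensor_map Hsp Hsp HH Hsp comul id t)"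
abbreviation Dr where "Dr t \<equiv> tensor_map Hsp Hsp Hsp HH id comul t"

lemma vspace_H3: "vspace H3"
  by (rule vspace_tensor_product)

lemma linear_on_id': "linear_on V V id"
  using linear_on_id by (simp add: id_def)

lemma linear_comul_left: "linear_on HH (HH \<otimes> Hsp) (tensor_map Hsp Hsp HH Hsp comul id)"
  by (rule linear_on_tensor_map[OF vspace_Hsp vspace_Hsp vspace_HH vspace_Hsp linear_comul linear_on_id'])

lemma linear_Dl: "linear_on HH H3 (\<lambda>t. Dl t)"
  by (rule linear_on_comp[OF linear_comul_left linear_on_tensor_assoc[OF vspace_Hsp vspace_Hsp vspace_Hsp]])

lemma linear_Dr: "linear_on HH H3 (\<lambda>t. Dr t)"
  by (rule linear_on_tensor_map[OF vspace_Hsp vspace_Hsp vspace_Hsp vspace_HH linear_on_id' linear_comul])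

lemma Dr_tm:
  assumes "linear_on Hsp Hsp f" "linear_on Hsp Hsp g" "linear_on HH HH g'" "t \<in> carrier HH"
    and "\<And>v. v \<in> carrier Hsp \<Longrightarrow> comul (g v) = g' (comul v)"
  shows "Dr (tm f g t) = tm3 f g' (Dr t)"
  using assms
  by (simp add: tensor_map_comp[OF vspace_Hsp vspace_Hsp vspace_Hsp vspace_Hsp vspace_Hsp vspace_HH _ _ linear_on_id' linear_comul]
      tensor_map_comp[OF vspace_Hsp vspace_Hsp vspace_Hsp vspace_HH vspace_Hsp vspace_HH linear_on_id' linear_comul])
    (rule tensor_map_cong, simp_all)

lemma comul_left_tm:
  assumes "linear_on Hsp Hsp f" "linear_on Hsp Hsp g" "linear_on HH HH f'" "t \<in> carrier HH"
    and "\<And>v. v \<in> carrier Hsp \<Longrightarrow> comul (f v) = f' (comul v)"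
  shows "tensor_map Hsp Hsp HH Hsp comul id (tm f g t)
    = tensor_map HH Hsp HH Hsp f' g (tensor_map Hsp Hsp HH Hsp comul id t)"
  using assms
  by (simp add: tensor_map_comp[OF vspace_Hsp vspace_Hsp vspace_Hsp vspace_Hsp vspace_HH vspace_Hsp _ _ linear_comul linear_on_id']
      tensor_map_comp[OF vspace_Hsp vspace_Hsp vspace_HH vspace_Hsp vspace_HH vspace_Hsp linear_comul linear_on_id'])
    (rule tensor_map_cong, simp_all)

lemma Dl_tm:
  assumes "linear_on Hsp Hsp f" "linear_on Hsp Hsp g" "t \<in> carrier HH"
    and "linear_on Hsp Hsp f1" "linear_on Hsp Hsp f2"
    and "\<And>v. v \<in> carrier Hsp \<Longrightarrow> comul (f v) = tm f1 f2 (comul v)"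
  shows "Dl (tm f g t) = tm3 f1 (tm f2 g) (Dl t)"
  using comul_left_tm[OF assms(1,2) linear_tm[OF assms(4,5)] assms(3,6)]
    tensor_assoc_natural[OF vspace_Hsp vspace_Hsp vspace_Hsp assms(4,5,2) linear_on_closed[OF linear_comul_left assms(3)]]
  by simp

text \<open>For a first leg \<open>E\<close> or \<open>F\<close>, whose coproduct has two summands:
  comultiplying that leg splits the operator into two operators on three legs.\<close>

lemma Dl_tm2:
  assumes "linear_on Hsp Hsp f" "linear_on Hsp Hsp g" "t \<in> carrier HH"
    and f: "linear_on Hsp Hsp f1" "linear_on Hsp Hsp f2" "linear_on Hsp Hsp f3" "linear_on Hsp Hsp f4"
    and eq: "\<And>v. v \<in> carrier Hsp \<Longrightarrow> comul (f v) = tm f1 f2 (comul v) + tm f3 f4 (comul v)"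
  shows "Dl (tm f g t) = tm3 f1 (tm f2 g) (Dl t) + tm3 f3 (tm f4 g) (Dl t)"
proof -
  let ?s = "tensor_map Hsp Hsp HH Hsp comul id t"
  have s: "?s \<in> carrier (HH \<otimes> Hsp)" by (rule linear_on_closed[OF linear_comul_left assms(3)])
  note l12 = linear_tm[OF f(1,2)] and l34 = linear_tm[OF f(3,4)]
  note lm = linear_on_tensor_map[OF vspace_HH vspace_Hsp vspace_HH vspace_Hsp _ assms(2)]
  note sum = linear_on_add[OF vspace_HH l12 l34]
  have "tensor_map HH Hsp HH Hsp (\<lambda>t. tm f1 f2 t + tm f3 f4 t) g ?s
      = tensor_map HH Hsp HH Hsp (tm f1 f2) g ?s + tensor_map HH Hsp HH Hsp (tm f3 f4) g ?s"
  proof (rule linear_on_tensor_unique[OF vspace_HH vspace_Hsp vspace_tensor_product lm[OF sum]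
        linear_on_add[OF vspace_tensor_product lm[OF l12] lm[OF l34]] _ s])
    fix x y assume "x \<in> carrier HH" "y \<in> carrier Hsp"
    then show "tensor_map HH Hsp HH Hsp (\<lambda>t. tm f1 f2 t + tm f3 f4 t) g (pure HH Hsp x y) =
      tensor_map HH Hsp HH Hsp (tm f1 f2) g (pure HH Hsp x y) + tensor_map HH Hsp HH Hsp (tm f3 f4) g (pure HH Hsp x y)"
      using linear_on_plus[OF linear_on_pure_left[OF vspace_HH vspace_Hsp], OF linear_on_closed[OF assms(2)]
          linear_on_closed[OF l12] linear_on_closed[OF l34]]
      by (simp only: tensor_map_pure[OF vspace_HH vspace_Hsp _ assms(2)] l12 l34 sum)
  qed
  then show ?thesis
    using comul_left_tm[OF assms(1,2) sum assms(3) eq]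
      tensor_assoc_natural[OF vspace_Hsp vspace_Hsp vspace_Hsp f(1,2) assms(2) s]
      tensor_assoc_natural[OF vspace_Hsp vspace_Hsp vspace_Hsp f(3,4) assms(2) s]
      linear_on_plus[OF linear_on_tensor_assoc[OF vspace_Hsp vspace_Hsp vspace_Hsp]
        linear_on_closed[OF lm[OF l12] s] linear_on_closed[OF lm[OF l34] s]]
    by (simp only:)
qed

lemma tm3_add:
  assumes "linear_on Hsp Hsp f" "linear_on HH HH g" "linear_on HH HH h" "t \<in> carrier H3"
  shows "tm3 f (\<lambda>s. g s + h s) t = tm3 f g t + tm3 f h t"
proof -
  note lm = linear_on_tensor_map[OF vspace_Hsp vspace_HH vspace_Hsp vspace_HH assms(1)]
  note sum = linear_on_add[OF vspace_HH assms(2,3)]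
  show ?thesis
  proof (rule linear_on_tensor_unique[OF vspace_Hsp vspace_HH vspace_H3 lm[OF sum]
        linear_on_add[OF vspace_H3 lm[OF assms(2)] lm[OF assms(3)]] _ assms(4)])
    fix x y assume "x \<in> carrier Hsp" "y \<in> carrier HH"
    then show "tm3 f (\<lambda>s. g s + h s) (pure Hsp HH x y) = tm3 f g (pure Hsp HH x y) + tm3 f h (pure Hsp HH x y)"
      using linear_on_plus[OF linear_on_pure_right[OF vspace_Hsp vspace_HH], OF linear_on_closed[OF assms(1)]
          linear_on_closed[OF assms(2)] linear_on_closed[OF assms(3)]]
      by (simp only: tensor_map_pure[OF vspace_Hsp vspace_HH assms(1)] assms sum)
  qed
qed

lemma tm_Ki_pow: "t \<in> carrier HH \<Longrightarrow> T.Ki t = tm H.Ki H.Ki t"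
proof (rule HH_eq[OF vspace_HH, where f = T.Ki and g = "tm H.Ki H.Ki"])
  show "linear_on HH HH T.Ki" by (rule T.lin_pow)
  show "linear_on HH HH (tm H.Ki H.Ki)" by (rule linear_tm[OF lin_Ki lin_Ki])
  show "T.Ki (pu x y) = tm H.Ki H.Ki (pu x y)" if "x \<in> carrier Hsp" "y \<in> carrier Hsp" for x y
    using that by (simp add: T.Ki_def KK_pow_pu tm_pu lin_Ki) (simp add: H.Ki_def)
qed

text \<open>Both iterated coproducts respond to a generator with the same operator on three legs.
  For \<open>E\<close> it is \<open>E \<otimes> 1 \<otimes> 1 + K \<otimes> E \<otimes> 1 + K
  \<otimes> K \<otimes> E\<close>, for \<open>F\<close> it is \<open>F \<otimes> K^-1 \<otimes> K^-1
  + 1 \<otimes> F \<otimes> K^-1 + 1 \<otimes> 1 \<otimes> F\<close>.\<close>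

lemma comul_coassoc:
  assumes "x \<in> carrier Hsp"
  shows "Dl (comul x) = Dr (comul x)"
  using assms
proof (induction rule: Hsp_generated)
  case one
  have "tensor_map Hsp Hsp HH Hsp comul id (pu one one) = pure HH Hsp (pu one one) one"
    using tensor_map_pure[OF vspace_HH vspace_Hsp linear_comul linear_on_id' one_closed one_closed] by simp
  moreover have "Dr (pu one one) = pure Hsp HH one (pu one one)"
    using tensor_map_pure[OF vspace_Hsp vspace_HH linear_on_id' linear_comul one_closed one_closed] by simp
  ultimately show ?case
    unfolding comul_one by (simp only: tensor_assoc_pure[OF vspace_Hsp vspace_Hsp vspace_Hsp one_closed one_closed one_closed])
next
  case (linear a v w)
  then show ?case
    using linear_on_comp[OF linear_comul linear_Dl, THEN linear_on_plus, OF Hs.scale_closed]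
      linear_on_comp[OF linear_comul linear_Dl, THEN linear_on_smult]
      linear_on_comp[OF linear_comul linear_Dr, THEN linear_on_plus, OF Hs.scale_closed]
      linear_on_comp[OF linear_comul linear_Dr, THEN linear_on_smult]
    by (simp only: scale_Hsp scale_tensor)
next
  case (K v)
  note t = comul_closed[OF K(1)]
  have "Dl (KK (comul v)) = tm3 opK KK (Dl (comul v))"
    unfolding KK_def by (rule Dl_tm[OF linear_ops(1,1) t linear_ops(1,1)]) (simp add: KK_def)
  moreover have "Dr (KK (comul v)) = tm3 opK KK (Dr (comul v))"
    unfolding KK_def by (rule Dr_tm[OF linear_ops(1,1) linear_tm[OF linear_ops(1,1)] t]) (simp add: KK_def)
  ultimately show ?case
    using K(2) unfolding comul_ops(1)[OF K(1)] by (simp only:)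
next
  case (E v)
  note t = comul_closed[OF E(1)] and i = linear_on_id[of Hsp] and o = linear_ops
  note cl = linear_tm[OF o(2) i, THEN linear_on_closed, OF t] linear_tm[OF o(1,2), THEN linear_on_closed, OF t]
  have l: "Dl (EE (comul v)) = tm3 opE (tm (\<lambda>x. x) (\<lambda>x. x)) (Dl (comul v)) + tm3 opK (tm opE (\<lambda>x. x)) (Dl (comul v))
      + tm3 opK (tm opK opE) (Dl (comul v))"
    using Dl_tm2[OF o(2) i t o(2) i o(1,2)] Dl_tm[OF o(1,2) t o(1,1)] linear_on_plus[OF linear_Dl cl]
    by (simp add: EE_def KK_def del: plus_fun_apply)
  have "Dr (EE (comul v)) = tm3 opE (\<lambda>x. x) (Dr (comul v)) + tm3 opK EE (Dr (comul v))"
    using Dr_tm[OF o(2) i linear_on_id t] Dr_tm[OF o(1,2) linear_EE t] linear_on_plus[OF linear_Dr cl]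
    by (simp add: EE_def del: plus_fun_apply)
  moreover have "tm3 opK EE (Dr (comul v)) = tm3 opK (tm opE (\<lambda>x. x)) (Dr (comul v)) + tm3 opK (tm opK opE) (Dr (comul v))"
    unfolding EE_def by (rule tm3_add[OF o(1) linear_tm[OF o(2) i] linear_tm[OF o(1,2)] linear_on_closed[OF linear_Dr t]])
  moreover have "tm3 opE (tm (\<lambda>x. x) (\<lambda>x. x)) s = tm3 opE (\<lambda>x. x) s" for s
    by (rule tensor_map_cong) (simp_all add: tensor_map_id vspace_Hsp)
  ultimately show ?case
    unfolding comul_ops[OF E(1)] l E(2) by (simp only: add.assoc)
next
  case (F v)
  note t = comul_closed[OF F(1)] and i = linear_on_id[of Hsp] and o = linear_ops and k = lin_Ki
  note cl = linear_tm[OF o(3) k, THEN linear_on_closed, OF t] linear_tm[OF i o(3), THEN linear_on_closed, OF t]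
  have 1: "Dl (tm (\<lambda>x. x) opF (comul v)) = tm3 (\<lambda>x. x) (tm (\<lambda>x. x) opF) (Dl (comul v))"
    by (rule Dl_tm[OF i o(3) t i i]) (simp add: tensor_map_id vspace_Hsp)
  have l: "Dl (FF (comul v)) = tm3 opF (tm H.Ki H.Ki) (Dl (comul v)) + tm3 (\<lambda>x. x) (tm opF H.Ki) (Dl (comul v))
      + tm3 (\<lambda>x. x) (tm (\<lambda>x. x) opF) (Dl (comul v))"
    using Dl_tm2[OF o(3) k t o(3) k i o(3)] 1 linear_on_plus[OF linear_Dl cl]
    by (simp add: FF_def del: plus_fun_apply)
  have "Dr (FF (comul v)) = tm3 opF (tm H.Ki H.Ki) (Dr (comul v)) + tm3 (\<lambda>x. x) FF (Dr (comul v))"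
    using Dr_tm[OF o(3) k linear_tm[OF k k] t] Dr_tm[OF i o(3) linear_FF t] linear_on_plus[OF linear_Dr cl]
    by (simp add: FF_def tm_Ki_pow del: plus_fun_apply)
  moreover have "tm3 (\<lambda>x. x) FF (Dr (comul v)) = tm3 (\<lambda>x. x) (tm opF H.Ki) (Dr (comul v)) + tm3 (\<lambda>x. x) (tm (\<lambda>x. x) opF) (Dr (comul v))"
    unfolding FF_def by (rule tm3_add[OF i linear_tm[OF o(3) k] linear_tm[OF i o(3)] linear_on_closed[OF linear_Dr t]])
  ultimately show ?case
    unfolding comul_ops[OF F(1)] l F(2) by (simp only: add.assoc)
qed

lemma hopf_algebra_Hopf: "hopf_algebra Hopf"
proof (intro hopf_algebra.intro bialgebra.intro unital_algebra.intro counital_coalgebra.intro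
    hopf_algebra_axioms.intro bialgebra_axioms.intro unital_algebra_axioms.intro counital_coalgebra_axioms.intro)
  show "vspace Hopf" "vspace Hopf"
    using vspace_Hsp by (simp_all add: vspace_def)
  show "bilinear_on Hopf Hopf Hopf (mult Hopf)" using bilinear_mul by simp
  show "linear_on Hopf (Hopf \<otimes> Hopf) (comult Hopf)" using linear_comul by simp
  show "linear_on Hopf ground (counit Hopf)" using linear_eps by simp
  show "linear_on Hopf Hopf (antipode Hopf)" using linear_anti by simp
  show "comult Hopf (unit Hopf) = pure Hopf Hopf (unit Hopf) (unit Hopf)" by simp
  show "counit Hopf (unit Hopf) = 1" by simp
  show "unit Hopf \<in> carrier Hopf" by simp
  fix x assume x: "x \<in> carrier Hopf"
  show "mult Hopf (unit Hopf) x = x" "mult Hopf x (unit Hopf) = x"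
    using x by simp_all
  show "tensor_assoc Hopf Hopf Hopf (tensor_map Hopf Hopf (Hopf \<otimes> Hopf) Hopf (comult Hopf) id (comult Hopf x))
      = tensor_map Hopf Hopf Hopf (Hopf \<otimes> Hopf) id (comult Hopf) (comult Hopf x)"
    using comul_coassoc x by simp
  show "tensor_lift Hopf Hopf (\<lambda>a b. scale Hopf (counit Hopf a) b) (comult Hopf x) = x"
    using counit_l x by simp
  show "tensor_lift Hopf Hopf (\<lambda>a b. scale Hopf (counit Hopf b) a) (comult Hopf x) = x"
    using counit_r x by simp
  show "tensor_lift Hopf Hopf (\<lambda>a b. mult Hopf (antipode Hopf a) b) (comult Hopf x)
      = scale Hopf (counit Hopf x) (unit Hopf)"
    using antipode_l x by simp
  show "tensor_lift Hopf Hopf (\<lambda>a b. mult Hopf a (antipode Hopf b)) (comult Hopf x)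
      = scale Hopf (counit Hopf x) (unit Hopf)"
    using antipode_r x by simp
  fix y assume y: "y \<in> carrier Hopf"
  show "comult Hopf (mult Hopf x y) = tensor_mult Hopf (comult Hopf x) (comult Hopf y)"
    using comul_mul x y by (simp add: tensor_mult_def tmul_def tensor_map_def)
  show "counit Hopf (mult Hopf x y) = counit Hopf x * counit Hopf y"
    using eps_mul x y by simp
  fix z assume z: "z \<in> carrier Hopf"
  show "mult Hopf (mult Hopf x y) z = mult Hopf x (mult Hopf y z)"
    using mul_assoc x y z by simp
qed

end

section \<open>Group-like and skew-primitive elements\<close>

context qparam
begin

section \<open>Coproducts of the basis vectors\<close>

lemma opKi_pow_bv: "l < n \<Longrightarrow> k < n \<Longrightarrow> (H.Ki ^^ j) (bv l i k) = fscale (q ^ (l * j)) (bv l (i + j * m1) k)"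
proof (induction j)
  case (Suc j)
  then show ?case
    by (simp add: H.op_linear[unfolded scale_Hsp] H.Ki_def[folded m1_def] opKi_bv power_add mult_ac add_ac)
qed simp

text \<open>The q-binomial expansion of \<open>(E \<otimes> 1 + K \<otimes> E)^k\<close>; the power
  of \<open>p\<close> comes from moving \<open>E^b\<close> past \<open>K^(k-b)\<close> into the
  order of the basis.\<close>

lemma comul_bv_0:
  assumes "k < n"
  shows "comul (bv 0 i k) = (\<Sum>b\<le>k. fscale (qbinom q k b * p ^ ((k - b) * b))
    (pu (bv 0 (i + (k - b)) b) (bv 0 i (k - b))))"
proof -
  have lin: "linear_on HH HH (tm opE (\<lambda>x. x))" "linear_on HH HH (tm opK opE)"
    by (intro linear_tm linear_ops linear_on_id)+
  have E: "(EE ^^ k) (pu one one) = (\<Sum>b\<le>k. fscale (qbinom q k b) ((tm opE (\<lambda>x. x) ^^ b) ((tm opK opE ^^ (k - b)) (pu one one))))"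
    unfolding EE_def scale_tensor[symmetric, of Hsp Hsp]
  proof (rule HH.qbinomial[OF lin])
    fix t assume t: "t \<in> carrier HH"
    show "tm opK opE (tm opE (\<lambda>x. x) t) = scale HH q (tm opE (\<lambda>x. x) (tm opK opE t))"
    proof (rule HH_eq[OF vspace_HH linear_on_comp[OF lin] linear_on_scale[OF vspace_HH linear_on_comp[OF lin(2,1)]] _ t])
      show "tm opK opE (tm opE (\<lambda>x. x) (pu x y)) = scale HH q (tm opE (\<lambda>x. x) (tm opK opE (pu x y)))"
        if "x \<in> carrier Hsp" "y \<in> carrier Hsp" for x y
        using that by (simp add: tm_pu linear_ops linear_on_id ops_KE pu_linear)
    qed
  qed simp
  have "comul (bv 0 i k) = (KK ^^ i) ((EE ^^ k) (pu one one))"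
    using assms by (simp add: comul_def T.act_bv)
  also have "\<dots> = (\<Sum>b\<le>k. (KK ^^ i) (fscale (qbinom q k b) (pu ((opE ^^ b) ((opK ^^ (k - b)) one)) ((opE ^^ (k - b)) one))))"
    unfolding E using assms
    by (subst linear_on_sum[OF vspace_HH linear_on_funpow[OF linear_KK]])
      (simp_all add: tm_pow_pu linear_ops linear_on_id HH.scale_closed[unfolded scale_tensor])
  also have "\<dots> = (\<Sum>b\<le>k. fscale (qbinom q k b * p ^ ((k - b) * b))
    (pu (bv 0 (i + (k - b)) b) (bv 0 i (k - b))))"
  proof (rule sum.cong[OF refl])
    fix b assume "b \<in> {..k}"
    then have b: "b < n" "k - b < n" using assms by auto
    have "(opE ^^ b) ((opK ^^ (k - b)) one) = fscale (p ^ ((k - b) * b)) (bv 0 (k - b) b)"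
      using b by (simp add: opK_pow_bv opE_pow_bv0)
    moreover have "(opE ^^ (k - b)) one = bv 0 0 (k - b)"
      using b by (simp add: opE_pow_bv0)
    ultimately show "(KK ^^ i) (fscale (qbinom q k b) (pu ((opE ^^ b) ((opK ^^ (k - b)) one)) ((opE ^^ (k - b)) one)))
      = fscale (qbinom q k b * p ^ ((k - b) * b)) (pu (bv 0 (i + (k - b)) b) (bv 0 i (k - b)))"
      using b by (simp add: linear_on_smult[OF linear_on_funpow[OF linear_KK], unfolded scale_tensor]
          pu_linear KK_pow_pu opK_pow_bv add.commute HH.scale_closed[unfolded scale_tensor])
  qed
  finally show ?thesis .
qed

text \<open>The coefficient in the coproduct of \<open>F^l K^i E^k\<close> of the term with
  \<open>F^a\<close>, \<open>E^b\<close> on the left and \<open>F^(l-a)\<close>,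
  \<open>E^(k-b)\<close> on the right. It does not depend on \<open>i\<close>.\<close>

definition cf :: "nat \<Rightarrow> nat \<Rightarrow> nat \<Rightarrow> nat \<Rightarrow> 'k" where
  "cf l k a b = qbinom p l a * q ^ ((l - a) * a) * (qbinom q k b * p ^ ((k - b) * b))"

lemma comul_bv:
  assumes "l < n" "k < n"
  shows "comul (bv l i k) = (\<Sum>a\<le>l. \<Sum>b\<le>k. fscale (cf l k a b)
    (pu (bv a (i + (k - b)) b) (bv (l - a) (i + a * m1) (k - b))))"
proof -
  have lin: "linear_on HH HH (tm opF H.Ki)" "linear_on HH HH (tm (\<lambda>x. x) opF)"
    by (intro linear_tm linear_ops linear_on_id lin_Ki)+
  have F: "(FF ^^ l) t = (\<Sum>a\<le>l. fscale (qbinom p l a) ((tm opF H.Ki ^^ a) ((tm (\<lambda>x. x) opF ^^ (l - a)) t)))"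
    if "t \<in> carrier HH" for t
    unfolding FF_def scale_tensor[symmetric, of Hsp Hsp]
  proof (rule HH.qbinomial[OF lin _ that])
    fix t assume t: "t \<in> carrier HH"
    show "tm (\<lambda>x. x) opF (tm opF H.Ki t) = scale HH p (tm opF H.Ki (tm (\<lambda>x. x) opF t))"
    proof (rule HH_eq[OF vspace_HH linear_on_comp[OF lin] linear_on_scale[OF vspace_HH linear_on_comp[OF lin(2,1)]] _ t])
      show "tm (\<lambda>x. x) opF (tm opF H.Ki (pu x y)) = scale HH p (tm opF H.Ki (tm (\<lambda>x. x) opF (pu x y)))"
        if "x \<in> carrier Hsp" "y \<in> carrier Hsp" for x y
        using that by (simp add: tm_pu linear_ops linear_on_id lin_Ki H.F_Ki[unfolded scale_Hsp] pu_linear)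
    qed
  qed
  have "bv l i k = (opF ^^ l) (bv 0 i k)"
    using assms by (simp add: opF_pow_bv)
  moreover have "comul ((opF ^^ j) v) = (FF ^^ j) (comul v)" if "v \<in> carrier Hsp" for j v
    using that by (induction j) simp_all
  ultimately have "comul (bv l i k) = (FF ^^ l) (comul (bv 0 i k))"
    using assms by simp
  also have "\<dots> = (\<Sum>a\<le>l. fscale (qbinom p l a) ((tm opF H.Ki ^^ a) ((tm (\<lambda>x. x) opF ^^ (l - a)) (comul (bv 0 i k)))))"
    using assms by (intro F) simp
  also have "\<dots> = (\<Sum>a\<le>l. \<Sum>b\<le>k. fscale (cf l k a b)
    (pu (bv a (i + (k - b)) b) (bv (l - a) (i + a * m1) (k - b))))"
  proof (rule sum.cong[OF refl])
    fix a assume "a \<in> {..l}"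
    then have a: "a < n" "l - a < n" using assms by auto
    note lin' = linear_on_comp[OF linear_on_funpow[OF lin(2), of "l - a"] linear_on_funpow[OF lin(1), of a]]
    note sc = linear_on_scale[OF vspace_HH lin', of "qbinom p l a", unfolded scale_tensor]
    have "fscale (qbinom p l a) ((tm opF H.Ki ^^ a) ((tm (\<lambda>x. x) opF ^^ (l - a)) (comul (bv 0 i k))))
      = (\<Sum>b\<le>k. fscale (qbinom p l a) ((tm opF H.Ki ^^ a) ((tm (\<lambda>x. x) opF ^^ (l - a))
         (fscale (qbinom q k b * p ^ ((k - b) * b)) (pu (bv 0 (i + (k - b)) b) (bv 0 i (k - b)))))))"
      unfolding comul_bv_0[OF assms(2)] using assms
      by (intro linear_on_sum[OF vspace_HH sc]) (simp add: HH.scale_closed[unfolded scale_tensor])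
    also have "\<dots> = (\<Sum>b\<le>k. fscale (cf l k a b)
      (pu (bv a (i + (k - b)) b) (bv (l - a) (i + a * m1) (k - b))))"
    proof (rule sum.cong[OF refl])
      fix b assume "b \<in> {..k}"
      then have b: "b < n" "k - b < n" using assms by auto
      have "(tm opF H.Ki ^^ a) ((tm (\<lambda>x. x) opF ^^ (l - a)) (pu (bv 0 (i + (k - b)) b) (bv 0 i (k - b))))
        = fscale (q ^ ((l - a) * a)) (pu (bv a (i + (k - b)) b) (bv (l - a) (i + a * m1) (k - b)))"
        using a b by (simp add: tm_pow_pu linear_ops linear_on_id lin_Ki opF_pow_bv opKi_pow_bv pu_linear)
      then show "fscale (qbinom p l a) ((tm opF H.Ki ^^ a) ((tm (\<lambda>x. x) opF ^^ (l - a))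
         (fscale (qbinom q k b * p ^ ((k - b) * b)) (pu (bv 0 (i + (k - b)) b) (bv 0 i (k - b))))))
         = fscale (cf l k a b) (pu (bv a (i + (k - b)) b) (bv (l - a) (i + a * m1) (k - b)))"
        using a b linear_on_smult[OF lin', of "pu (bv 0 (i + (k - b)) b) (bv 0 i (k - b))"]
        by (simp add: cf_def mult_ac)
    qed
    finally show "fscale (qbinom p l a) ((tm opF H.Ki ^^ a) ((tm (\<lambda>x. x) opF ^^ (l - a)) (comul (bv 0 i k))))
      = (\<Sum>b\<le>k. fscale (cf l k a b) (pu (bv a (i + (k - b)) b) (bv (l - a) (i + a * m1) (k - b))))" .
  qed
  finally show ?thesis .
qed

text \<open>The form \<open>wt l\<^sub>0 k\<^sub>0\<close> sums the coefficients of \<open>F\<^sup>l\<^sup>0 K\<^sup>i E\<^sup>k\<^sup>0\<close> over all \<open>i\<close>.\<close>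

definition wt :: "nat \<Rightarrow> nat \<Rightarrow> (nat \<Rightarrow> 'k) \<Rightarrow> 'k" where
  "wt l0 k0 = lext ground (\<lambda>l i k. if l = l0 \<and> k = k0 then 1 else 0)"

lemma linear_wt: "linear_on Hsp ground (wt l0 k0)"
  unfolding wt_def by (rule linear_on_lext[OF vspace_ground]) simp

lemma wt_bv: "l < n \<Longrightarrow> k < n \<Longrightarrow> wt l0 k0 (bv l i k) = (if l = l0 \<and> k = k0 then 1 else 0)"
  by (simp add: wt_def lext_bv[OF vspace_ground])

section \<open>Slices of the coproduct by functionals\<close>

definition lslice where "lslice w v = tensor_lift Hsp Hsp (\<lambda>a b. fscale (w a) b) (comul v)"
definition rslice where "rslice w v = tensor_lift Hsp Hsp (\<lambda>a b. fscale (w b) a) (comul v)"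

lemma bilinear_slice:
  assumes "linear_on Hsp ground w"
  shows "bilinear_on Hsp Hsp Hsp (\<lambda>a b. fscale (w a) b)" "bilinear_on Hsp Hsp Hsp (\<lambda>a b. fscale (w b) a)"
  using bilinear_on_form_scale[OF vspace_Hsp assms] bilinear_on_scale_form[OF vspace_Hsp assms] by simp_all

lemma linear_slice:
  assumes "linear_on Hsp ground w"
  shows "linear_on Hsp Hsp (lslice w)" "linear_on Hsp Hsp (rslice w)"
  unfolding lslice_def rslice_def
  by (intro linear_on_comp[OF linear_comul linear_on_tensor_lift[OF vspace_Hsp vspace_Hsp vspace_Hsp]]
      bilinear_slice assms)+

lemma slice_sum:
  assumes "linear_on Hsp ground w"
    and "comul v = (\<Sum>i\<in>A. fscale (s i) (pu (x i) (y i)))"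
    and "\<And>i. i \<in> A \<Longrightarrow> x i \<in> carrier Hsp" "\<And>i. i \<in> A \<Longrightarrow> y i \<in> carrier Hsp"
  shows "lslice w v = (\<Sum>i\<in>A. fscale (s i * w (x i)) (y i))" "rslice w v = (\<Sum>i\<in>A. fscale (s i * w (y i)) (x i))"
proof -
  note b = bilinear_slice[OF assms(1)]
  note lin = linear_on_tensor_lift[OF vspace_Hsp vspace_Hsp vspace_Hsp b(1)]
    linear_on_tensor_lift[OF vspace_Hsp vspace_Hsp vspace_Hsp b(2)]
  have c: "\<And>i. i \<in> A \<Longrightarrow> fscale (s i) (pu (x i) (y i)) \<in> carrier HH"
    using assms(3,4) by (simp add: HH.scale_closed[unfolded scale_tensor])
  have "lslice w v = (\<Sum>i\<in>A. tensor_lift Hsp Hsp (\<lambda>a b. fscale (w a) b) (fscale (s i) (pu (x i) (y i))))"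
    unfolding lslice_def assms(2) by (rule linear_on_sum[OF vspace_HH lin(1)]) (rule c)
  also have "\<dots> = (\<Sum>i\<in>A. fscale (s i * w (x i)) (y i))"
    by (rule sum.cong)
      (simp_all add: assms(3,4) linear_on_smult[OF lin(1), unfolded scale_tensor scale_Hsp] tensor_lift_pure[OF vspace_Hsp b(1)])
  finally show "lslice w v = (\<Sum>i\<in>A. fscale (s i * w (x i)) (y i))" .
  have "rslice w v = (\<Sum>i\<in>A. tensor_lift Hsp Hsp (\<lambda>a b. fscale (w b) a) (fscale (s i) (pu (x i) (y i))))"
    unfolding rslice_def assms(2) by (rule linear_on_sum[OF vspace_HH lin(2)]) (rule c)
  also have "\<dots> = (\<Sum>i\<in>A. fscale (s i * w (y i)) (x i))"
    by (rule sum.cong)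
      (simp_all add: assms(3,4) linear_on_smult[OF lin(2), unfolded scale_tensor scale_Hsp] tensor_lift_pure[OF vspace_Hsp b(2)])
  finally show "rslice w v = (\<Sum>i\<in>A. fscale (s i * w (y i)) (x i))" .
qed

text \<open>As \<open>wt l0 k0\<close> ignores powers of \<open>K\<close>, at most one pair
  \<open>(a, b)\<close> survives: \<open>(l0, k0)\<close> on the left leg and
  \<open>(l - l0, k - k0)\<close> on the right leg.\<close>

lemma slice_bv:
  assumes "l < n" "k < n" "l0 < n" "k0 < n"
  shows "lslice (wt l0 k0) (bv l i k) = (if l0 \<le> l \<and> k0 \<le> k
      then fscale (cf l k l0 k0) (bv (l - l0) (i + l0 * m1) (k - k0)) else 0)"
    and "rslice (wt l0 k0) (bv l i k) = (if l0 \<le> l \<and> k0 \<le> k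
      then fscale (cf l k (l - l0) (k - k0)) (bv (l - l0) (i + k0) (k - k0)) else 0)"
proof -
  let ?A = "{..l} \<times> {..k}"
  let ?s = "\<lambda>(a, b). cf l k a b" and ?x = "\<lambda>(a, b). bv a (i + (k - b)) b"
    and ?y = "\<lambda>(a, b). bv (l - a) (i + a * m1) (k - b)"
  have eq: "comul (bv l i k) = (\<Sum>i\<in>?A. fscale (?s i) (pu (?x i) (?y i)))"
    unfolding comul_bv[OF assms(1,2)] sum.cartesian_product by (rule sum.cong) auto
  have x: "?x j \<in> carrier Hsp" and y: "?y j \<in> carrier Hsp" if "j \<in> ?A" for j
    using that assms by auto
  have S: "lslice (wt l0 k0) (bv l i k) = (\<Sum>j\<in>?A. fscale (?s j * wt l0 k0 (?x j)) (?y j))"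
    "rslice (wt l0 k0) (bv l i k) = (\<Sum>j\<in>?A. fscale (?s j * wt l0 k0 (?y j)) (?x j))"
    by (rule slice_sum[OF linear_wt eq], fact x, fact y)+
  have "lslice (wt l0 k0) (bv l i k) = (\<Sum>j\<in>?A. if j = (l0, k0) then fscale (?s j) (?y j) else 0)"
    unfolding S(1) using assms by (intro sum.cong) (auto simp: wt_bv)
  also have "\<dots> = (if l0 \<le> l \<and> k0 \<le> k
      then fscale (cf l k l0 k0) (bv (l - l0) (i + l0 * m1) (k - k0)) else 0)"
    by (subst sum.delta) auto
  finally show "lslice (wt l0 k0) (bv l i k) = (if l0 \<le> l \<and> k0 \<le> k
      then fscale (cf l k l0 k0) (bv (l - l0) (i + l0 * m1) (k - k0)) else 0)" .
  show "rslice (wt l0 k0) (bv l i k) = (if l0 \<le> l \<and> k0 \<le> k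
      then fscale (cf l k (l - l0) (k - k0)) (bv (l - l0) (i + k0) (k - k0)) else 0)"
  proof (cases "l0 \<le> l \<and> k0 \<le> k")
    case True
    have "rslice (wt l0 k0) (bv l i k) = (\<Sum>j\<in>?A. if j = (l - l0, k - k0) then fscale (?s j) (?x j) else 0)"
      unfolding S(2) using assms True by (intro sum.cong) (auto simp: wt_bv split: if_splits)
    also have "\<dots> = fscale (cf l k (l - l0) (k - k0)) (bv (l - l0) (i + k0) (k - k0))"
      using True by (subst sum.delta) auto
    finally show ?thesis using True by simp
  next
    case False
    have "rslice (wt l0 k0) (bv l i k) = (\<Sum>j\<in>?A. 0)"
      unfolding S(2) using assms False by (intro sum.cong) (auto simp: wt_bv)
    then show ?thesis using False by (simp only: sum.neutral_const if_False)
  qed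
qed

lemma linear_coord: "linear_on Hsp ground (\<lambda>v. v m)"
  by (simp add: linear_on_def fscale_def)

text \<open>All orders stay below \<open>n\<close>, where no Gaussian binomial vanishes. So
  coordinates can be read back from a slice.\<close>

lemma cf_nonzero: "a \<le> l \<Longrightarrow> l < n \<Longrightarrow> b \<le> k \<Longrightarrow> k < n \<Longrightarrow> cf l k a b \<noteq> 0"
  by (simp add: cf_def qbinom_nonzero[OF q_root] qbinom_nonzero[OF p_root])

lemma lslice_E_coord:
  assumes "v \<in> carrier Hsp" "l < n" "i < 2 * n" "k < n"
  shows "lslice (wt 0 1) v (code l i k) = (if Suc k < n then cf l (Suc k) 0 1 * v (code l i (Suc k)) else 0)"
proof (rule Hsp_linear_eq[where M = ground and f = "\<lambda>v. lslice (wt 0 1) v (code l i k)"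
      and g = "\<lambda>v. if Suc k < n then cf l (Suc k) 0 1 * v (code l i (Suc k)) else 0", OF _ _ _ assms(1)])
  show "linear_on Hsp ground (\<lambda>v. lslice (wt 0 1) v (code l i k))"
    by (rule linear_on_comp[OF linear_slice(1)[OF linear_wt] linear_coord])
  show "linear_on Hsp ground (\<lambda>v. if Suc k < n then cf l (Suc k) 0 1 * v (code l i (Suc k)) else 0)"
    by (auto simp: linear_on_def fscale_def algebra_simps)
  fix l' i' k' assume *: "l' < n" "i' < 2 * n" "k' < n"
  then show "lslice (wt 0 1) (bv l' i' k') (code l i k)
      = (if Suc k < n then cf l (Suc k) 0 1 * bv l' i' k' (code l i (Suc k)) else 0)"
    using assms n_gt_2 by (cases k') (auto simp: slice_bv fscale_def bv_at_code)
qed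

lemma mod_m1_inj: "i < 2 * n \<Longrightarrow> j < 2 * n \<Longrightarrow> (i + m1) mod (2 * n) = (j + m1) mod (2 * n) \<Longrightarrow> i = j"
proof -
  assume *: "i < 2 * n" "j < 2 * n" "(i + m1) mod (2 * n) = (j + m1) mod (2 * n)"
  then have "(i + m1 + 1) mod (2 * n) = (j + m1 + 1) mod (2 * n)" by (metis mod_add_left_eq)
  moreover have "i + m1 + 1 = i + 2 * n" "j + m1 + 1 = j + 2 * n" using n_gt_2 by (simp_all add: m1_def)
  ultimately have "(i + 2 * n) mod (2 * n) = (j + 2 * n) mod (2 * n)" by (simp only:)
  then show ?thesis using *(1,2) by simp
qed

text \<open>Beside \<open>F\<close> the coproduct carries a \<open>K^-1\<close>, which shifts the
  exponent of \<open>K\<close> as well; hence the coordinate at \<open>i + m1\<close>, that is, at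
  \<open>i - 1\<close>.\<close>

lemma lslice_F_coord:
  assumes "v \<in> carrier Hsp" "l < n" "i < 2 * n" "k < n"
  shows "lslice (wt 1 0) v (code l ((i + m1) mod (2 * n)) k) = (if Suc l < n then cf (Suc l) k 1 0 * v (code (Suc l) i k) else 0)"
proof (rule Hsp_linear_eq[where M = ground and f = "\<lambda>v. lslice (wt 1 0) v (code l ((i + m1) mod (2 * n)) k)"
      and g = "\<lambda>v. if Suc l < n then cf (Suc l) k 1 0 * v (code (Suc l) i k) else 0", OF _ _ _ assms(1)])
  show "linear_on Hsp ground (\<lambda>v. lslice (wt 1 0) v (code l ((i + m1) mod (2 * n)) k))"
    by (rule linear_on_comp[OF linear_slice(1)[OF linear_wt] linear_coord])
  show "linear_on Hsp ground (\<lambda>v. if Suc l < n then cf (Suc l) k 1 0 * v (code (Suc l) i k) else 0)"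
    by (auto simp: linear_on_def fscale_def algebra_simps)
  fix l' i' k' assume *: "l' < n" "i' < 2 * n" "k' < n"
  then show "lslice (wt 1 0) (bv l' i' k') (code l ((i + m1) mod (2 * n)) k)
      = (if Suc l < n then cf (Suc l) k 1 0 * bv l' i' k' (code (Suc l) i k) else 0)"
    using assms n_gt_2 by (cases l') (auto simp: slice_bv fscale_def bv_at_code dest: mod_m1_inj)
qed

lemma mod_m1_surj: "j < 2 * n \<Longrightarrow> \<exists>i<2 * n. (i + m1) mod (2 * n) = j"
proof (intro exI conjI)
  assume j: "j < 2 * n"
  have "((j + 1) mod (2 * n) + m1) mod (2 * n) = (j + 1 + m1) mod (2 * n)"
    by (rule mod_add_left_eq)
  also have "j + 1 + m1 = j + 2 * n" using n_gt_2 by (simp add: m1_def)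
  finally show "((j + 1) mod (2 * n) + m1) mod (2 * n) = j" using j by simp
qed (use n_gt_2 in simp)

lemma Hsp_ext:
  assumes "v \<in> carrier Hsp" "w \<in> carrier Hsp"
    and "\<And>l i k. l < n \<Longrightarrow> i < 2 * n \<Longrightarrow> k < n \<Longrightarrow> v (code l i k) = w (code l i k)"
  shows "v = w"
proof
  fix m
  show "v m = w m"
  proof (cases "m \<in> (\<lambda>(l, i, k). code l i k) ` Idx")
    case True
    then show ?thesis using assms(3) by (auto simp: Idx_def)
  next
    case False
    then show ?thesis using assms(1,2) by (simp add: Hsp_def)
  qed
qed

definition grouplike :: "(nat \<Rightarrow> 'k) \<Rightarrow> bool" where
  "grouplike g \<longleftrightarrow> g \<in> carrier Hsp \<and> comul g = pu g g"

text \<open>Oriented so that \<open>E\<close> and \<open>F K\<close> both belong to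
  \<open>g = K\<close>; the factor \<open>K\<close> brings the coproduct of \<open>F\<close> into
  this form.\<close>

definition skew_primitive :: "(nat \<Rightarrow> 'k) \<Rightarrow> (nat \<Rightarrow> 'k) \<Rightarrow> bool" where
  "skew_primitive g z \<longleftrightarrow> z \<in> carrier Hsp \<and> comul z = pu z one + pu g z"

text \<open>The group algebra of the cyclic group generated by \<open>K\<close>.\<close>

definition K_span :: "(nat \<Rightarrow> 'k) set" where
  "K_span = {v \<in> carrier Hsp. \<forall>l<n. \<forall>i<2 * n. \<forall>k<n. l \<noteq> 0 \<or> k \<noteq> 0 \<longrightarrow> v (code l i k) = 0}"

text \<open>The slice of a group-like element \<open>g\<close> is a multiple of \<open>g\<close>, but slicing is nilpotent.\<close>

lemma grouplike_wt_E:
  assumes "grouplike g"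
  shows "wt 0 1 g = 0"
proof (rule ccontr)
  assume w: "wt 0 1 g \<noteq> 0"
  have g: "g \<in> carrier Hsp" "comul g = pu g g" using assms by (auto simp: grouplike_def)
  have "lslice (wt 0 1) g = fscale (wt 0 1 g) g"
    using g by (simp add: lslice_def tensor_lift_pure[OF vspace_Hsp bilinear_slice(1)[OF linear_wt]])
  then have eq: "wt 0 1 g * g (code l i k) = (if Suc k < n then cf l (Suc k) 0 1 * g (code l i (Suc k)) else 0)"
    if "l < n" "i < 2 * n" "k < n" for l i k
    using lslice_E_coord[OF g(1) that] by (simp add: fscale_def)
  have "g (code l i k) = 0" if "l < n" "i < 2 * n" "k \<le> n - 1" for l i k
    using that(3)
  proof (induction k rule: inc_induct)
    case base
    show ?case using eq[OF that(1,2), of "n - 1"] w n_gt_2 by simp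
  next
    case (step k)
    then have "k < n" by simp
    then show ?case using eq[OF that(1,2), of k] w step by (simp split: if_splits)
  qed
  then have "g = 0"
    using g by (intro Hsp_ext) auto
  then show False
    using w linear_on_0[OF vspace_Hsp linear_wt] by metis
qed

lemma grouplike_wt_F:
  assumes "grouplike g"
  shows "wt 1 0 g = 0"
proof (rule ccontr)
  assume w: "wt 1 0 g \<noteq> 0"
  have g: "g \<in> carrier Hsp" "comul g = pu g g" using assms by (auto simp: grouplike_def)
  have "lslice (wt 1 0) g = fscale (wt 1 0 g) g"
    using g by (simp add: lslice_def tensor_lift_pure[OF vspace_Hsp bilinear_slice(1)[OF linear_wt]])
  then have eq: "wt 1 0 g * g (code l ((i + m1) mod (2 * n)) k) = (if Suc l < n then cf (Suc l) k 1 0 * g (code (Suc l) i k) else 0)"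
    if "l < n" "i < 2 * n" "k < n" for l i k
    using lslice_F_coord[OF g(1) that] by (simp add: fscale_def)
  have "\<forall>i<2 * n. g (code l i k) = 0" if "k < n" "l \<le> n - 1" for l k
    using that(2)
  proof (induction l rule: inc_induct)
    case base
    show ?case
    proof (intro allI impI)
      fix j assume "j < 2 * n"
      then obtain i where "i < 2 * n" "(i + m1) mod (2 * n) = j" using mod_m1_surj by blast
      then show "g (code (n - 1) j k) = 0"
        using eq[of "n - 1" i k] w n_gt_2 that(1) by simp
    qed
  next
    case (step l)
    show ?case
    proof (intro allI impI)
      fix j assume "j < 2 * n"
      then obtain i where "i < 2 * n" "(i + m1) mod (2 * n) = j" using mod_m1_surj by blast
      moreover have "l < n" using step by simp
      ultimately show "g (code l j k) = 0"
        using eq[of l i k] w step that(1) by (simp split: if_splits)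
    qed
  qed
  then have "g = 0"
    using g by (intro Hsp_ext) auto
  then show False
    using w linear_on_0[OF vspace_Hsp linear_wt] by metis
qed

text \<open>With both weights zero, the slices along \<open>E\<close> and \<open>F\<close> vanish.
  Up to nonzero factors these slices consist of the coordinates with \<open>k > 0\<close> and with
  \<open>l > 0\<close>.\<close>

lemma grouplike_K_span:
  assumes "grouplike g"
  shows "g \<in> K_span"
proof -
  have g: "g \<in> carrier Hsp" "comul g = pu g g" using assms by (auto simp: grouplike_def)
  have "lslice (wt 0 1) g = 0" "lslice (wt 1 0) g = 0"
    using g grouplike_wt_E[OF assms] grouplike_wt_F[OF assms]
    by (simp_all add: lslice_def tensor_lift_pure[OF vspace_Hsp bilinear_slice(1)[OF linear_wt]] del: zero_fun_apply)
  then have E: "g (code l i (Suc k)) = 0" and F: "g (code (Suc l') i k') = 0"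
    if "l < n" "i < 2 * n" "Suc k < n" "Suc l' < n" "k' < n" for l i k l' k'
    using lslice_E_coord[OF g(1), of l i k] lslice_F_coord[OF g(1), of l' i k'] that
      cf_nonzero[of 0 l 1 "Suc k"] cf_nonzero[of 1 "Suc l'" 0 k']
    by simp_all
  have "g (code l i k) = 0" if "l < n" "i < 2 * n" "k < n" "l \<noteq> 0 \<or> k \<noteq> 0" for l i k
    using that E[of l i "k - 1" 0 0] F[of 0 i 0 "l - 1" k] n_gt_2 by (cases k; cases l; simp)
  then show ?thesis using g by (simp add: K_span_def)
qed

lemma K_span_linear_eq:
  assumes "vspace M" "linear_on Hsp M f" "linear_on Hsp M g" "v \<in> K_span"
    and "\<And>i. i < 2 * n \<Longrightarrow> f (bv 0 i 0) = g (bv 0 i 0)"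
  shows "f v = g v"
proof -
  interpret M: vspace M by fact
  have v: "v \<in> carrier Hsp" using assms(4) by (simp add: K_span_def)
  have cl: "(case x of (l, i, k) \<Rightarrow> fscale (v (code l i k)) (bv l i k)) \<in> carrier Hsp" if "x \<in> Idx" for x
    using that by (auto simp: Idx_def Hs.scale_closed[unfolded scale_Hsp])
  have *: "h v = (\<Sum>(l, i, k)\<in>Idx. scale M (v (code l i k)) (h (bv l i k)))" if "linear_on Hsp M h" for h
  proof -
    have "h v = (\<Sum>x\<in>Idx. h (case x of (l, i, k) \<Rightarrow> fscale (v (code l i k)) (bv l i k)))"
      by (subst Hsp_expand[OF v]) (rule linear_on_sum[OF vspace_Hsp that cl])
    also have "\<dots> = (\<Sum>(l, i, k)\<in>Idx. scale M (v (code l i k)) (h (bv l i k)))"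
      by (rule sum.cong) (auto simp: Idx_def linear_on_smult[OF that, unfolded scale_Hsp])
    finally show ?thesis .
  qed
  show ?thesis
    unfolding *[OF assms(2)] *[OF assms(3)]
  proof (rule sum.cong[OF refl], clarify)
    fix l i k assume "(l, i, k) \<in> Idx"
    then show "scale M (v (code l i k)) (f (bv l i k)) = scale M (v (code l i k)) (g (bv l i k))"
      using assms(4,5) by (cases "l = 0 \<and> k = 0") (auto simp: K_span_def Idx_def)
  qed
qed

lemma K_span_commute:
  assumes "u \<in> K_span" "v \<in> K_span"
  shows "mul u v = mul v u"
proof -
  have c: "u \<in> carrier Hsp" "v \<in> carrier Hsp" using assms by (auto simp: K_span_def)
  have A: "mul w (bv 0 i 0) = (opK ^^ i) w" if "w \<in> K_span" for w i
    by (rule K_span_linear_eq[OF vspace_Hsp linear_mul_left linear_on_funpow[OF linear_ops(1)] that])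
      (simp_all add: H.act_bv opK_pow_bv add.commute)
  show ?thesis
    by (rule K_span_linear_eq[OF vspace_Hsp linear_mul_left linear_mul_right assms(1)])
      (simp_all add: c H.act_bv A[OF assms(2)])
qed

lemma K_span_rslice:
  assumes "v \<in> K_span" "l0 < n" "k0 < n" "l0 \<noteq> 0 \<or> k0 \<noteq> 0"
  shows "rslice (wt l0 k0) v = 0"
  by (rule K_span_linear_eq[OF vspace_Hsp linear_slice(2)[OF linear_wt] linear_on_zero[OF vspace_Hsp] assms(1)])
    (use assms in \<open>auto simp: slice_bv simp del: zero_fun_apply\<close>)

lemma lslice_skew:
  assumes "grouplike g" "skew_primitive g z" "linear_on Hsp ground w" "w g = 0"
  shows "lslice w z = fscale (w z) one"
proof -
  have c: "g \<in> carrier Hsp" "z \<in> carrier Hsp" "comul z = pu z one + pu g z"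
    using assms by (auto simp: grouplike_def skew_primitive_def)
  note b = bilinear_slice(1)[OF assms(3)]
  show ?thesis
    unfolding lslice_def c(3)
      linear_on_plus[OF linear_on_tensor_lift[OF vspace_Hsp vspace_Hsp vspace_Hsp b] pu_closed[OF c(2) one_closed] pu_closed[OF c(1,2)]]
    using c(1,2) assms(4) by (simp add: tensor_lift_pure[OF vspace_Hsp b] del: plus_fun_apply zero_fun_apply)
qed

text \<open>On this side the slice is a multiple of \<open>g\<close>, not of 1. Comparison with the
  slices of \<open>E\<close> and \<open>F K\<close> will identify \<open>g\<close>.\<close>

lemma rslice_skew:
  assumes "grouplike g" "skew_primitive g z" "linear_on Hsp ground w" "w one = 0"
  shows "rslice w z = fscale (w z) g"
proof -
  have c: "g \<in> carrier Hsp" "z \<in> carrier Hsp" "comul z = pu z one + pu g z"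
    using assms by (auto simp: grouplike_def skew_primitive_def)
  note b = bilinear_slice(2)[OF assms(3)]
  show ?thesis
    unfolding rslice_def c(3)
      linear_on_plus[OF linear_on_tensor_lift[OF vspace_Hsp vspace_Hsp vspace_Hsp b] pu_closed[OF c(2) one_closed] pu_closed[OF c(1,2)]]
    using c(1,2) assms(4) by (simp add: tensor_lift_pure[OF vspace_Hsp b] del: plus_fun_apply zero_fun_apply)
qed

lemma cf_simps [simp]: "cf 0 (Suc 0) 0 (Suc 0) = 1" "cf (Suc 0) 0 (Suc 0) 0 = 1"
  "cf 0 (Suc 0) 0 0 = 1" "cf (Suc 0) 0 0 0 = 1"
  by (simp_all add: cf_def)

text \<open>The left slices of \<open>z\<close> along \<open>E\<close> and \<open>F\<close> are
  multiples of 1, whose only coordinate is at \<open>(0, 0, 0)\<close>. Undoing the shifts leaves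
  just the coordinate of \<open>E\<close> among those with \<open>k > 0\<close>, and just that of
  \<open>F K\<close> among those with \<open>l > 0\<close>.\<close>

lemma skew_wt:
  assumes "grouplike g" "skew_primitive g z"
  shows "wt 0 1 z = z (code 0 0 1)" "wt 1 0 z = z (code 1 1 0)"
    and "\<And>l i k. l < n \<Longrightarrow> i < 2 * n \<Longrightarrow> Suc k < n \<Longrightarrow> (l, i, k) \<noteq> (0, 0, 0) \<Longrightarrow> z (code l i (Suc k)) = 0"
    and "\<And>l i k. Suc l < n \<Longrightarrow> i < 2 * n \<Longrightarrow> k < n \<Longrightarrow> (l, i, k) \<noteq> (0, 1, 0) \<Longrightarrow> z (code (Suc l) i k) = 0"
proof -
  have z: "z \<in> carrier Hsp" using assms by (simp add: skew_primitive_def)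
  note L = lslice_skew[OF assms linear_wt grouplike_wt_E[OF assms(1)]]
    lslice_skew[OF assms linear_wt grouplike_wt_F[OF assms(1)]]
  have m1: "(1 + m1) mod (2 * n) = 0" using n_gt_2 by (simp add: m1_def)
  show "wt 0 1 z = z (code 0 0 1)"
    using lslice_E_coord[OF z, of 0 0 0] n_gt_2 unfolding L by (simp add: fscale_def bv_at_code)
  show "wt 1 0 z = z (code 1 1 0)"
    using lslice_F_coord[OF z, of 0 1 0] n_gt_2 unfolding m1 L by (simp add: fscale_def bv_at_code)
  show "z (code l i (Suc k)) = 0" if "l < n" "i < 2 * n" "Suc k < n" "(l, i, k) \<noteq> (0, 0, 0)" for l i k
    using lslice_E_coord[OF z that(1,2), of k] that cf_nonzero[of 0 l 1 "Suc k"]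
    unfolding L by (auto simp: fscale_def bv_at_code split: if_splits)
  show "z (code (Suc l) i k) = 0" if "Suc l < n" "i < 2 * n" "k < n" "(l, i, k) \<noteq> (0, 1, 0)" for l i k
  proof -
    have "(i + m1) mod (2 * n) = 0 \<Longrightarrow> i = 1"
      using mod_m1_inj[of i 1] m1 that(2) n_gt_2 by simp
    then show ?thesis
      using lslice_F_coord[OF z, of l i k] that cf_nonzero[of 1 "Suc l" 0 k]
      unfolding L by (auto simp: fscale_def bv_at_code split: if_splits)
  qed
qed

lemma skew_expand:
  assumes "grouplike g" "skew_primitive g z"
  shows "\<exists>u\<in>K_span. z = fscale (wt 0 1 z) (bv 0 0 1) + fscale (wt 1 0 z) (bv 1 1 0) + u"
proof
  have z: "z \<in> carrier Hsp" using assms by (simp add: skew_primitive_def)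
  let ?y = "fscale (wt 0 1 z) (bv 0 0 1) + fscale (wt 1 0 z) (bv 1 1 0)"
  have y: "?y \<in> carrier Hsp"
    using n_gt_2 by (intro Hs.add_closed Hs.scale_closed[unfolded scale_Hsp] bv_closed) auto
  show "z = ?y + (z - ?y)" by simp
  have "(z - ?y) (code l i k) = 0" if "l < n" "i < 2 * n" "k < n" "l \<noteq> 0 \<or> k \<noteq> 0" for l i k
    using that skew_wt(3)[OF assms, of l i "k - 1"] skew_wt(4)[OF assms, of "l - 1" i k] n_gt_2
      skew_wt(1,2)[OF assms]
    by (cases k; cases l) (auto simp: fscale_def bv_at_code)
  then show "z - ?y \<in> K_span"
    using Hs.diff_closed[OF z y] by (simp add: K_span_def)
qed

text \<open>Without a component along \<open>E\<close> or \<open>F K\<close>, the element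
  \<open>z\<close> would lie in the commutative \<open>K_span\<close> together with
  \<open>g\<close>, and \<open>s \<noteq> 1\<close> would force \<open>g z = 0\<close>, hence
  \<open>z = 0\<close>. Otherwise a right slice along that component yields the same nonzero
  multiple of \<open>K\<close> and of \<open>g\<close>.\<close>

lemma skew_grouplike_eq_K:
  assumes "grouplike g" "skew_primitive g z" "h \<in> carrier Hsp" "mul h g = one"
    and comm: "mul g z = fscale s (mul z g)" "s \<noteq> 1" and "z \<noteq> 0"
  shows "g = opK one"
proof -
  have c: "g \<in> carrier Hsp" "z \<in> carrier Hsp"
    using assms by (auto simp: grouplike_def skew_primitive_def)
  obtain u where u: "u \<in> K_span" and zu: "z = fscale (wt 0 1 z) (bv 0 0 1) + fscale (wt 1 0 z) (bv 1 1 0) + u"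
    using skew_expand[OF assms(1,2)] by blast
  have uc: "u \<in> carrier Hsp" using u by (simp add: K_span_def)
  have lt: "0 < n" "1 < n" using n_gt_2 by auto
  note sc = Hs.scale_closed[unfolded scale_Hsp]
  have R: "rslice (wt l0 k0) z = fscale (wt 0 1 z) (rslice (wt l0 k0) (bv 0 0 1))
      + fscale (wt 1 0 z) (rslice (wt l0 k0) (bv 1 1 0)) + rslice (wt l0 k0) u" for l0 k0
  proof -
    note lin = linear_slice(2)[OF linear_wt, of l0 k0]
    show ?thesis
      by (subst zu) (simp add: linear_on_plus[OF lin] linear_on_smult[OF lin, unfolded scale_Hsp] lt uc sc Hs.add_closed
          del: plus_fun_apply One_nat_def)
  qed
  have K: "opK one = bv 0 1 0" by (simp add: opK_bv)
  have w1: "wt 0 1 one = 0" "wt 1 0 one = 0" by (simp_all add: wt_bv)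
  have 1: "fscale (wt 0 1 z) (opK one) = fscale (wt 0 1 z) g"
    using R[of 0 1] rslice_skew[OF assms(1,2) linear_wt w1(1)] K_span_rslice[OF u, of 0 1] lt
    by (simp add: slice_bv K del: plus_fun_apply zero_fun_apply)
  have 2: "fscale (wt 1 0 z) (opK one) = fscale (wt 1 0 z) g"
    using R[of 1 0] rslice_skew[OF assms(1,2) linear_wt w1(2)] K_span_rslice[OF u, of 1 0] lt
    by (simp add: slice_bv K del: plus_fun_apply zero_fun_apply)
  have "\<not> (wt 0 1 z = 0 \<and> wt 1 0 z = 0)"
  proof
    assume "wt 0 1 z = 0 \<and> wt 1 0 z = 0"
    then have "z = u" using zu by (simp del: plus_fun_apply zero_fun_apply)
    then have gz: "mul g z = mul z g" using K_span_commute[OF grouplike_K_span[OF assms(1)] u] by simp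
    then have "fscale (1 - s) (mul g z) = 0"
      using comm(1) by (simp add: fs.scale_left_diff_distrib del: zero_fun_apply)
    then have "mul g z = 0" using comm(2) by (simp del: zero_fun_apply)
    then have "mul h (mul g z) = 0"
      using linear_on_0[OF vspace_Hsp linear_mul_right] by metis
    moreover have "mul h (mul g z) = z"
      using mul_assoc[OF assms(3) c] assms(4) c by simp
    ultimately show False using assms(7) by simp
  qed
  then show ?thesis
    using 1 2 by (metis fs.scale_cancel_left)
qed

section \<open>Commutation with K\<close>

lemma mod_Suc_inj: "i < 2 * n \<Longrightarrow> j < 2 * n \<Longrightarrow> Suc i mod (2 * n) = Suc j mod (2 * n) \<Longrightarrow> i = j"
  by (auto simp: mod_Suc split: if_splits)

lemma mul_bv_K: "l < n \<Longrightarrow> k < n \<Longrightarrow> mul (bv l i k) (opK one) = fscale (p ^ k) (bv l (Suc i) k)"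
proof -
  assume lk: "l < n" "k < n"
  have "opK ((opE ^^ k) one) = fscale (q ^ k) ((opE ^^ k) (opK one))"
    using H.K_Epow[of one k] by simp
  then have "(opE ^^ k) (opK one) = fscale (p ^ k) (opK ((opE ^^ k) one))"
    by simp
  also have "\<dots> = fscale (p ^ k) (bv 0 1 k)"
    using lk by (simp add: opE_pow_bv0 opK_bv)
  finally show ?thesis
    using lk H.op_linear[unfolded scale_Hsp]
    by (simp add: H.act_bv opK_pow_bv opF_pow_bv)
qed

text \<open>Left and right multiplication by \<open>K\<close> shift \<open>i\<close> alike and
  differ only in the factors \<open>p^l\<close> and \<open>p^k\<close>, so commutation up to
  \<open>s\<close> can be tested coordinate by coordinate.\<close>

lemma K_commute_coord:
  assumes "v \<in> carrier Hsp" "opK v = fscale s (mul v (opK one))" "l < n" "i < 2 * n" "k < n"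
  shows "p ^ l * v (code l i k) = s * p ^ k * v (code l i k)"
proof -
  let ?m = "code l (Suc i mod (2 * n)) k"
  have "opK v ?m = p ^ l * v (code l i k)"
  proof (rule Hsp_linear_eq[where M = ground and f = "\<lambda>v. opK v ?m" and g = "\<lambda>v. p ^ l * v (code l i k)", OF _ _ _ assms(1)])
    show "linear_on Hsp ground (\<lambda>v. opK v ?m)"
      by (rule linear_on_comp[OF linear_ops(1) linear_coord])
    show "linear_on Hsp ground (\<lambda>v. p ^ l * v (code l i k))"
      by (auto simp: linear_on_def fscale_def algebra_simps)
    show "opK (bv l' i' k') ?m = p ^ l * bv l' i' k' (code l i k)" if "l' < n" "i' < 2 * n" "k' < n" for l' i' k'
      using that assms by (auto simp: opK_bv fscale_def bv_at_code dest: mod_Suc_inj)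
  qed
  moreover have "mul v (opK one) ?m = p ^ k * v (code l i k)"
  proof (rule Hsp_linear_eq[where M = ground and f = "\<lambda>v. mul v (opK one) ?m" and g = "\<lambda>v. p ^ k * v (code l i k)", OF _ _ _ assms(1)])
    show "linear_on Hsp ground (\<lambda>v. mul v (opK one) ?m)"
      by (rule linear_on_comp[OF linear_mul_left linear_coord]) simp
    show "linear_on Hsp ground (\<lambda>v. p ^ k * v (code l i k))"
      by (auto simp: linear_on_def fscale_def algebra_simps)
    show "mul (bv l' i' k') (opK one) ?m = p ^ k * bv l' i' k' (code l i k)" if "l' < n" "i' < 2 * n" "k' < n" for l' i' k'
      using that assms by (auto simp: mul_bv_K fscale_def bv_at_code dest: mod_Suc_inj)
  qed
  moreover have "opK v ?m = s * mul v (opK one) ?m"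
    using fun_cong[OF assms(2), of ?m] by (simp add: fscale_def)
  ultimately show ?thesis by (metis mult.assoc)
qed

text \<open>A skew-primitive element for \<open>K\<close> has coordinates only at powers of
  \<open>K\<close>, at \<open>E\<close> and at \<open>F K\<close>. These commute with
  \<open>K\<close> up to 1, \<open>q\<close> and \<open>p\<close>, three distinct scalars, so the
  factor singles out \<open>E\<close>.\<close>

lemma K_skew_q:
  assumes "grouplike (opK one)" "skew_primitive (opK one) z" "opK z = fscale q (mul z (opK one))"
  shows "\<exists>a. z = fscale a (opE one)"
proof
  have z: "z \<in> carrier Hsp" using assms by (simp add: skew_primitive_def)
  have E: "opE one = bv 0 0 1" using opE_pow_bv0[of 0 1 0] n_gt_2 by simp
  note coord = K_commute_coord[OF z assms(3)]
  have "p \<noteq> q" using q_neq_p by metis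
  then have z1: "z (code 1 1 0) = 0"
    using coord[of 1 1 0] n_gt_2 by auto
  have z0: "z (code 0 i 0) = 0" if "i < 2 * n" for i
    using coord[of 0 i 0] n_gt_2 that by auto
  show "z = fscale (z (code 0 0 1)) (opE one)"
  proof (rule Hsp_ext[OF z])
    show "fscale (z (code 0 0 1)) (opE one) \<in> carrier Hsp"
      by (simp add: Hs.scale_closed[unfolded scale_Hsp])
    show "z (code l i k) = fscale (z (code 0 0 1)) (opE one) (code l i k)" if "l < n" "i < 2 * n" "k < n" for l i k
      using that z1 z0 skew_wt(3)[OF assms(1,2), of l i "k - 1"] skew_wt(4)[OF assms(1,2), of "l - 1" i k]
      unfolding E by (cases "(l, i, k) = (0, 0, 1)"; cases "(l, i, k) = (1, 1, 0)"; cases k; cases l) (auto simp: fscale_def bv_at_code)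
  qed
qed

lemma K_skew_p:
  assumes "grouplike (opK one)" "skew_primitive (opK one) z" "opK z = fscale p (mul z (opK one))"
  shows "\<exists>a. z = fscale a (opF (opK one))"
proof
  have z: "z \<in> carrier Hsp" using assms by (simp add: skew_primitive_def)
  have F: "opF (opK one) = bv 1 1 0" using n_gt_2 by (simp add: opK_bv opF_bv)
  note coord = K_commute_coord[OF z assms(3)]
  have "p * p \<noteq> 1" using q_neq_p by (metis inverse_inverse_eq inverse_unique)
  then have z1: "z (code 0 0 1) = 0"
    using coord[of 0 0 1] n_gt_2 by auto
  have "p \<noteq> 1" by simp
  then have z0: "z (code 0 i 0) = 0" if "i < 2 * n" for i
    using coord[of 0 i 0] n_gt_2 that by auto
  show "z = fscale (z (code 1 1 0)) (opF (opK one))"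
  proof (rule Hsp_ext[OF z])
    show "fscale (z (code 1 1 0)) (opF (opK one)) \<in> carrier Hsp"
      by (simp add: Hs.scale_closed[unfolded scale_Hsp])
    show "z (code l i k) = fscale (z (code 1 1 0)) (opF (opK one)) (code l i k)" if "l < n" "i < 2 * n" "k < n" for l i k
      using that z1 z0 skew_wt(3)[OF assms(1,2), of l i "k - 1"] skew_wt(4)[OF assms(1,2), of "l - 1" i k]
      unfolding F by (cases "(l, i, k) = (0, 0, 1)"; cases "(l, i, k) = (1, 1, 0)"; cases k; cases l) (auto simp: fscale_def bv_at_code)
  qed
qed

end

section \<open>Isomorphisms\<close>

lemma hopf_iso_id:
  assumes "hopf_algebra H"
  shows "hopf_iso H H id"
proof -
  interpret hopf_algebra H by fact
  have "vspace H" ..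
  moreover have "comult H x \<in> carrier (H \<otimes> H)" if "x \<in> carrier H" for x
    using linear_on_closed[OF comult_linear that] .
  ultimately show ?thesis
    using linear_on_id[of H] by (simp add: hopf_iso_def tensor_map_id id_def bij_betw_def)
qed

lemma hopf_isomorphic_refl: "hopf_algebra H \<Longrightarrow> hopf_isomorphic H H"
  unfolding hopf_isomorphic_def using hopf_iso_id by blast

section \<open>Dimension and the invariant of the family\<close>

context qparam
begin

lemma dim_Hsp: "fs.dim (carrier Hsp) = card Idx"
proof -
  let ?b = "\<lambda>(l, i, k). bv l i k"
  have app: "(\<Sum>x\<in>A. g x) m = (\<Sum>x\<in>A. g x m)" for A m and g :: "_ \<Rightarrow> nat \<Rightarrow> 'k"
    by (induction A rule: infinite_finite_induct) auto
  have inj: "inj_on ?b Idx"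
  proof (rule inj_onI)
    fix x y assume xy: "x \<in> Idx" "y \<in> Idx" "?b x = ?b y"
    obtain l i k l' i' k' where eq: "x = (l, i, k)" "y = (l', i', k')" by (cases x, cases y)
    have "bv l i k (code l i k) = 1" using xy(1) by (simp add: eq bv_at_code Idx_def)
    with xy(3) have "bv l' i' k' (code l i k) = 1" by (simp add: eq)
    then show "x = y"
      using xy(1,2) by (auto simp: eq bv_at_code Idx_def split: if_splits)
  qed
  have ind: "fs.independent (?b ` Idx)"
  proof (rule fs.independent_if_scalars_zero)
    fix f v assume f: "(\<Sum>x\<in>?b ` Idx. fscale (f x) x) = 0" and v: "v \<in> ?b ` Idx"
    then obtain l i k where x: "(l, i, k) \<in> Idx" "v = bv l i k" by auto
    have "0 = (\<Sum>x\<in>Idx. fscale (f (?b x)) (?b x)) (code l i k)"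
      using f unfolding sum.reindex[OF inj] comp_def by (simp only: zero_fun_apply)
    also have "\<dots> = (\<Sum>x\<in>Idx. if x = (l, i, k) then f (?b x) else 0)"
      unfolding app using x by (intro sum.cong) (auto simp: fscale_def bv_at_code Idx_def split: if_splits)
    also have "\<dots> = f v" using x by simp
    finally show "f v = 0" ..
  qed simp
  have "carrier Hsp \<subseteq> fs.span (?b ` Idx)"
  proof
    fix v assume v: "v \<in> carrier Hsp"
    have "(\<Sum>(l, i, k)\<in>Idx. fscale (v (code l i k)) (bv l i k)) \<in> fs.span (?b ` Idx)"
    proof (rule fs.span_sum, clarify)
      fix l i k assume "(l, i, k) \<in> Idx"
      then have "bv l i k \<in> ?b ` Idx" by force
      then show "fscale (v (code l i k)) (bv l i k) \<in> fs.span (?b ` Idx)"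
        by (intro fs.span_scale fs.span_base)
    qed
    then show "v \<in> fs.span (?b ` Idx)"
      by (simp only: Hsp_expand[OF v, symmetric])
  qed
  moreover have "?b ` Idx \<subseteq> carrier Hsp" by (auto simp: Idx_def)
  ultimately show ?thesis
    using ind inj by (intro fs.dim_unique[of "?b ` Idx"]) (simp_all add: card_image)
qed

lemma vdim_Hopf: "vdim Hopf = 2 * n ^ 3"
  by (simp add: vdim_def dim_Hsp) (simp add: Idx_def power3_eq_cube)

lemma grouplike_K: "grouplike (opK one)"
  by (simp add: grouplike_def)

lemma hopf_iso_Hopf:
  assumes "hopf_iso (qparam.Hopf n q c') Hopf f"
  shows "c' ^ n = c ^ n"
proof -
  \<comment> \<open>Both Hopf algebras share the space, \<open>opK\<close> and \<open>opF\<close>;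
    only \<open>o.opE\<close> and what is built from it depend on \<open>c'\<close>.\<close>
  interpret o: qparam n q c'
    by unfold_locales (fact n_gt_2 q_root)+
  note K_o = o.H.act_opK o.H.act_opE o.H.act_opF
  have bij: "bij_betw f (carrier Hsp) (carrier Hsp)" and lin: "linear_on Hsp Hsp f"
    and mult: "\<And>x y. x \<in> carrier Hsp \<Longrightarrow> y \<in> carrier Hsp \<Longrightarrow> f (o.mul x y) = mul (f x) (f y)"
    and fone: "f one = one"
    and com: "\<And>x. x \<in> carrier Hsp \<Longrightarrow> comul (f x) = tm f f (o.comul x)"
    using assms unfolding hopf_iso_def by simp_all
  have cl [simp]: "f x \<in> carrier Hsp" if "x \<in> carrier Hsp" for x
    using linear_on_closed[OF lin that] .
  have inj: "f x = f y \<longleftrightarrow> x = y" if "x \<in> carrier Hsp" "y \<in> carrier Hsp" for x y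
    using bij that by (auto simp: bij_betw_def inj_on_def)
  have f0: "f 0 = 0" by (rule linear_on_0[OF vspace_Hsp lin])
  have fnz: "f x \<noteq> 0" if "x \<in> carrier Hsp" "x \<noteq> 0" for x
    using inj[OF that(1) Hs.zero_closed] f0 that(2) by simp
  note flin = linear_on_plus[OF lin] linear_on_smult[OF lin, unfolded scale_Hsp] linear_on_minus[OF vspace_Hsp lin]
  note tm_plus = linear_on_plus[OF linear_tm[OF lin lin]]
  let ?g = "f (opK one)" and ?x = "f (o.opE one)" and ?y = "f (opF (opK one))"
  have gl: "grouplike ?g"
    by (simp add: grouplike_def com tm_pu lin)
  have x: "skew_primitive ?g ?x"
    by (simp add: skew_primitive_def com tm_pu tm_plus lin fone del: plus_fun_apply)
  have y: "skew_primitive ?g ?y"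
    by (simp add: skew_primitive_def com tm_pu tm_plus lin fone del: plus_fun_apply)
  have inv: "mul (f (H.Ki one)) ?g = one"
    by (simp add: mult[symmetric] o.H.act_opKi fone)
  have commx: "mul ?g ?x = fscale q (mul ?x ?g)"
    by (simp add: mult[symmetric] K_o o.ops_KE flin)
  have commy: "mul ?g ?y = fscale p (mul ?y ?g)"
    by (simp add: mult[symmetric] K_o o.ops_KF flin)
  have E: "o.opE one = bv 0 0 1" using o.opE_pow_bv0[of 0 1 0] n_gt_2 by simp
  have "bv 0 0 1 \<noteq> 0"
    using bv_at_code[of 0 0 0 1 0 1] n_gt_2 by (metis n_pos(2) mod_0 zero_fun_apply zero_neq_one)
  then have xnz: "?x \<noteq> 0"
    using fnz[of "bv 0 0 1"] bv_closed[of 0 1 0] n_gt_2 unfolding E by simp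
  have g: "?g = opK one"
    by (rule skew_grouplike_eq_K[OF gl x _ inv commx q_neq_1 xnz]) simp
  obtain a where a: "?x = fscale a (opE one)"
    using K_skew_q[of ?x] x commx grouplike_K unfolding g by (auto simp: mul_ops)
  obtain b where b: "?y = fscale b (opF (opK one))"
    using K_skew_p[of ?y] y commy grouplike_K unfolding g by (auto simp: mul_ops)
  have fK: "f (opK v) = opK (f v)" if "v \<in> carrier Hsp" for v
    using mult[of "opK one" v] that by (simp add: g K_o mul_ops)
  have fE: "f (o.opE v) = fscale a (opE (f v))" if "v \<in> carrier Hsp" for v
    using mult[of "o.opE one" v] that by (simp add: a K_o mul_ops mul_linear)
  have fKi: "f (H.Ki one) = H.Ki one"
  proof -
    have "opK (f (H.Ki one)) = one" using fK[of "H.Ki one"] by (simp add: fone)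
    then show ?thesis using H.K_Ki(2)[of "f (H.Ki one)"] by simp
  qed
  \<comment> \<open>\<open>F\<close> is recovered as \<open>(F K) K^-1\<close>, a product of two
    elements with known images.\<close>
  have fF: "f (opF one) = fscale b (opF one)"
    using mult[of "opF (opK one)" "H.Ki one"] by (simp add: b fKi K_o mul_ops mul_linear)
  have fF': "f (opF v) = fscale b (opF (f v))" if "v \<in> carrier Hsp" for v
    using mult[of "opF one" v] that by (simp add: fF K_o mul_ops mul_linear)
  have sc: "fscale s v \<in> carrier Hsp" if "v \<in> carrier Hsp" for s v
    using Hs.scale_closed that by simp
  have Kn: "f ((opK ^^ j) one) = (opK ^^ j) one" for j
    by (induction j) (simp_all add: fone fK)
  have En: "f ((o.opE ^^ j) one) = fscale (a ^ j) ((opE ^^ j) one)" for j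
    by (induction j) (simp_all add: fone fE ops_linear)
  have Fn: "f ((opF ^^ j) one) = fscale (b ^ j) ((opF ^^ j) one)" for j
    by (induction j) (simp_all add: fone fF' ops_linear)
  have Kn_bv: "(opK ^^ n) one = bv 0 n 0" by (simp add: opK_pow_bv)
  \<comment> \<open>Because \<open>0 < n < 2 * n\<close>, the power \<open>K^n\<close> is not 1;
    this is what lets the power relations determine \<open>a^n\<close> and
    \<open>b^n\<close>.\<close>
  have d: "(opK ^^ n) one - one \<noteq> 0"
  proof
    assume "(opK ^^ n) one - one = 0"
    then have "bv 0 n 0 (code 0 0 0) = bv 0 0 0 (code 0 0 0)" by (simp add: Kn_bv)
    then show False using n_gt_2 by (simp add: bv_at_code)
  qed
  have "fscale (a ^ n) ((opK ^^ n) one - one) = (opK ^^ n) one - one"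
    using En[of n] by (simp add: opE_pow_n o.opE_pow_n flin Kn fone del: minus_apply)
  then have an: "a ^ n = 1"
    using d by (metis fs.scale_cancel_right fs.scale_one)
  have "fscale (b ^ n) (one - (opK ^^ n) one) = one - (opK ^^ n) one"
    using Fn[of n] by (simp add: opF_pow_n flin Kn fone del: minus_apply)
  moreover have "one - (opK ^^ n) one \<noteq> 0" using d by (metis right_minus_eq)
  ultimately have bn: "b ^ n = 1"
    by (metis fs.scale_cancel_right fs.scale_one)
  \<comment> \<open>\<open>f\<close> fixes \<open>K - K^-1\<close>. Its value on the commutator is
    therefore \<open>c' (K - K^-1)\<close>, and from the images \<open>a E\<close> and
    \<open>b F\<close> it is also \<open>a b c (K - K^-1)\<close>.\<close>
  have "f (o.opE (opF one)) - f (opF (o.opE one)) = f (fscale c' (opK one - H.Ki one))"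
    using o.H.EF[of one] by (simp add: flin sc H.Ki_def flip: flin(3) del: minus_apply)
  moreover have "f (fscale c' (opK one - H.Ki one)) = fscale c' (opK one - H.Ki one)"
    by (simp add: flin g fKi del: minus_apply)
  moreover have "f (o.opE (opF one)) - f (opF (o.opE one)) = fscale (a * b) (opE (opF one) - opF (opE one))"
    by (simp add: fE fF' fone ops_linear fs.scale_right_diff_distrib mult.commute del: minus_apply)
  moreover have "\<dots> = fscale (a * b * c) (opK one - H.Ki one)"
    using H.EF[of one] by (simp add: H.Ki_def del: minus_apply)
  ultimately have "fscale c' (opK one - H.Ki one) = fscale (a * b * c) (opK one - H.Ki one)"
    by (simp only:)
  moreover have "opK one - H.Ki one \<noteq> 0"
  proof
    assume "opK one - H.Ki one = 0"
    then have "bv 0 1 0 = bv 0 m1 0"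
      by (simp add: opK_bv H.Ki_def[folded m1_def] opK_pow_bv del: minus_apply)
    then have "bv 0 1 0 (code 0 1 0) = bv 0 m1 0 (code 0 1 0)" by simp
    moreover have "m1 < 2 * n" "m1 \<noteq> 1" using n_gt_2 by (auto simp: m1_def)
    ultimately show False using n_gt_2 by (simp add: bv_at_code)
  qed
  ultimately have "c' = a * b * c" by (metis fs.scale_cancel_right)
  then show ?thesis by (simp add: power_mult_distrib an bn)
qed

end

theorem corollary3p3:
  fixes n :: nat and \<zeta> :: "'k::field"
  assumes "infinite (UNIV :: 'k set)"
    and "n > 2"
    and "primitive_root_of_unity n \<zeta>"
  shows "\<not> kaplansky_tenth_conjecture TYPE('k) \<and>
    (\<exists>d>0. \<exists>\<H> :: ('k, nat \<Rightarrow> 'k) hopf set.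
       infinite \<H> \<and>
       (\<forall>H\<in>\<H>. hopf_algebra H \<and> vdim H = d) \<and>
       (\<forall>H\<in>\<H>. \<forall>H'\<in>\<H>. H \<noteq> H' \<longrightarrow> \<not> hopf_isomorphic H H'))"
proof -
  let ?X = "qparam.Hopf n \<zeta>" and ?d = "2 * n ^ 3"
  have q: "qparam n \<zeta>"
    using assms by unfold_locales
  have hopf: "hopf_algebra (?X c)" and dim: "vdim (?X c) = ?d" for c
    using qparam.hopf_algebra_Hopf[OF q] qparam.vdim_Hopf[OF q] by auto
  have iso: "c ^ n = c' ^ n" if "hopf_isomorphic (?X c) (?X c')" for c c'
    using that qparam.hopf_iso_Hopf[OF q] unfolding hopf_isomorphic_def by blast
  have "infinite (range (\<lambda>c :: 'k. c ^ n))"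
  proof
    assume "finite (range (\<lambda>c :: 'k. c ^ n))"
    moreover have "finite ((\<lambda>c :: 'k. c ^ n) -` {a})" for a
      using finite_power_fibre[of n a] assms(2) by (simp add: vimage_def)
    ultimately have "finite (\<Union>a\<in>range (\<lambda>c :: 'k. c ^ n). (\<lambda>c :: 'k. c ^ n) -` {a})"
      by (rule finite_UN_I)
    moreover have "(\<Union>a\<in>range (\<lambda>c :: 'k. c ^ n). (\<lambda>c :: 'k. c ^ n) -` {a}) = UNIV" by auto
    ultimately show False using assms(1) by (simp only:)
  qed
  \<comment> \<open>\<open>C\<close> contains one scalar for each \<open>n\<close>-th power, so its
    members are told apart by the invariant.\<close>
  moreover obtain C where C: "inj_on (\<lambda>c :: 'k. c ^ n) C" "range (\<lambda>c :: 'k. c ^ n) = (\<lambda>c. c ^ n) ` C"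
    using subset_image_inj[of "range (\<lambda>c :: 'k. c ^ n)" "\<lambda>c. c ^ n" UNIV] by auto
  ultimately have "infinite C" by (metis finite_imageI)
  have eq: "c = c'" if "c \<in> C" "c' \<in> C" "hopf_isomorphic (?X c) (?X c')" for c c'
    using inj_onD[OF C(1) iso[OF that(3)] that(1,2)] .
  \<comment> \<open>Equal Hopf algebras are isomorphic, so distinct members of \<open>C\<close> also
    give distinct records.\<close>
  have "inj_on ?X C"
    by (rule inj_onI) (metis eq hopf hopf_isomorphic_refl)
  with \<open>infinite C\<close> have inf: "infinite (?X ` C)" by (simp add: finite_image_iff)
  have noniso: "\<not> hopf_isomorphic H H'" if "H \<in> ?X ` C" "H' \<in> ?X ` C" "H \<noteq> H'" for H H'
    using that eq by blast
  have d: "?d > 0" using assms(2) by simp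
  let ?A = "hopf_algebras ?d :: ('k, nat \<Rightarrow> 'k) hopf set"
  let ?R = "{(H, H'). H \<in> ?A \<and> H' \<in> ?A \<and> hopf_isomorphic H H'}"
  have sub: "?X ` C \<subseteq> ?A" using hopf dim by (auto simp: hopf_algebras_def)
  \<comment> \<open>Reflexivity puts \<open>H'\<close> into its own class; if the classes agree,
    \<open>H\<close> is isomorphic to \<open>H'\<close>.\<close>
  have injR: "inj_on (\<lambda>H. ?R `` {H}) (?X ` C)"
  proof (rule inj_onI)
    fix H H' assume *: "H \<in> ?X ` C" "H' \<in> ?X ` C" "?R `` {H} = ?R `` {H'}"
    then have "H' \<in> ?R `` {H'}" using sub hopf_isomorphic_refl by (auto simp: hopf_algebras_def)
    then have "hopf_isomorphic H H'" using *(3) by auto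
    then show "H = H'" using noniso *(1,2) by blast
  qed
  have "infinite ((\<lambda>H. ?R `` {H}) ` (?X ` C))"
    unfolding finite_image_iff[OF injR] by (rule inf)
  moreover have "(\<lambda>H. ?R `` {H}) ` (?X ` C) \<subseteq> ?A // ?R"
    using sub by (intro image_subsetI quotientI) blast
  ultimately have "infinite (?A // ?R)" using finite_subset by blast
  then have "\<not> kaplansky_tenth_conjecture TYPE('k)"
    using d unfolding kaplansky_tenth_conjecture_def by blast
  moreover have "\<forall>H\<in>?X ` C. hopf_algebra H \<and> vdim H = ?d"
    using hopf dim by blast
  ultimately show ?thesis
    using d inf noniso by (intro conjI exI[of _ ?d] exI[of _ "?X ` C"] ballI impI) blast+
qed

end
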